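(* Let $X_1,X_2,\dots$ be i.i.d. real random variables with continuous distribution function $F$, let $h(x_1,\dots,x_m)$ be a real-valued symmetric kernel of degree $m\ge1$, and assume that $G(t)=\mathbb P(h(X_1,\dots,X_m)<t)$ is continuous, with $G(\alpha)=0$, $G(\beta)=1$ and $G$ strictly increasing on $[\alpha,\beta]$, for a finite or infinite interval $[\alpha,\beta]$ (the parameter interval). Let $DU_n=\sup_t|G_n(t)-G(t)|$ and $SU_n=\sup_t|G_n(t)-F_n(t)|$. (i) If the family of kernels $\Theta(x_1,\dots,x_m;t)=I\{h(x_1,\dots,x_m)<t\}-G(t)$ is non-degenerate, then for all sufficiently small $a>0$ $$\lim_{n\to\infty}n^{-1}\ln\mathbb P(DU_n>a)=v_D(a):=-\min\big(g_T(a|\Theta),\,g_T(a|-\Theta)\big).$$ (ii) If the family of kernels $\Psi(x_1,\dots,x_m;t)=I\{h(x_1,\dots,x_m)<t\}-m^{-1}\sum_{i=1}^m I\{x_i<t\}$ is non-degenerate and centred (i.e. $E\Psi(X_1,\dots,X_m;t)=0$ for all $t$), then for all sufficiently small $a>0$ $$\lim_{n\to\infty}n^{-1}\ln\mathbb P(SU_n>a)=v_S(a):=-\min\big(g_T(a|\Psi),\,g_T(a|-\Psi)\big).$$ The functions $v_D$ and $v_S$ (in the respective cases) are continuous for sufficiently small $a>0$ and satisfy, as $a\to0$, $$v_D(a)\sim-\frac{a^2}{2m^2\theta_0^2},\qquad v_S(a)\sim-\frac{a^2}{2m^2\psi_0^2}.$$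
   Context: $F_n(t)=n^{-1}\sum_{i=1}^n I\{X_i<t\}$ is the empirical distribution function, and $G_n(t)=\binom nm^{-1}\sum_{1\le i_1<\dots<i_m\le n}I\{h(X_{i_1},\dots,X_{i_m})<t\}$ is the $U$-empirical distribution function; $I$ denotes an indicator. If $\beta=+\infty$ or $\alpha=-\infty$, values at infinite endpoints are understood as limits. For a family of real symmetric bounded centred kernels $\Phi(x_1,\dots,x_m;t)$, $t\in[\alpha,\beta]$ (here $\Phi=\pm\Theta$ or $\pm\Psi$): - $U_n(t)=\binom{n}{m}^{-1}\sum_{1\le i_1<\dots<i_m\le n}\Phi(X_{i_1},\dots,X_{i_m};t)$ is the corresponding $U$-statistic. - Projection $\varphi(s;t)=E(\Phi(X_1,\dots,X_m;t)\mid X_1=s)$; variance function $\sigma_\varphi^2(t)=E\varphi^2(X_1;t)$. The family is non-degenerate if $\sigma_\varphi^2(t)$ can vanish only at the ends of $[\alpha,\beta]$ and at a finite number of interior points. - $\varphi_0^2=\sup_{t\in[\alpha,\beta]}\sigma_\varphi^2(t)$, and $T=\{t\in[\alpha,\beta]:\sigma_\varphi^2(t)>\frac12\varphi_0^2\}$ (so $T$ depends on the family, but is the same for $\Phi$ and $-\Phi$). - For $t\in T$, $g(a,t|\Phi)$ is defined by $\lim_{n\to\infty}n^{-1}\ln\mathbb P(U_n(t)\ge a)=-g(a,t|\Phi)$. By a previously known theorem (for a single centred, bounded kernel with $\sigma_\varphi^2(t)>0$) this limit exists for sufficiently small $a>0$ and $g(a,t|\Phi)=\sum_{j=2}^\infty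 b_j(t)a^j$, a power series convergent for sufficiently small $a>0$, with $b_2(t)=(2m^2\sigma_\varphi^2(t))^{-1}$. Finally $g_T(a|\Phi)=\inf_{t\in T}g(a,t|\Phi)$; "sufficiently small $a$" means $0<a<a_0$ for some $a_0>0$ depending on the family but not on $t$, on which range these quantities are defined for all $t\in T$. $\theta_0^2$ and $\psi_0^2$ denote $\varphi_0^2$ for the families $\Theta$ and $\Psi$ respectively, i.e. $\theta_0^2=\sup_t E\theta^2(X_1;t)$ with $\theta(s;t)=E(\Theta(X_1,\dots,X_m;t)\mid X_1=s)$ and $\psi_0^2=\sup_tE\psi^2(X_1;t)$ with $\psi(s;t)=E(\Psi(X_1,\dots,X_m;t)\mid X_1=s)$. *)

theory Defs
  imports "HOL-Probability.Probability"
begin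

(* Samples are indexed from 0, so X 0, X 1, ... play the role of X_1, X_2, ...
   A kernel of degree m is a function on the extensional tuples in PiM {..<m} (\<lambda>_. borel).
   The parameter t of a family of kernels is an extended real: at t = \<infinity> and
   t = -\<infinity> the indicator of {y < t} takes its limiting value 1 or 0. *)

definition tuple :: "nat \<Rightarrow> (nat \<Rightarrow> 'a \<Rightarrow> real) \<Rightarrow> 'a \<Rightarrow> nat \<Rightarrow> real" where
  "tuple m X \<omega> = (\<lambda>j\<in>{..<m}. X j \<omega>)"

definition symmetric_kernel :: "nat \<Rightarrow> ((nat \<Rightarrow> real) \<Rightarrow> real) \<Rightarrow> bool" where
  "symmetric_kernel m h \<longleftrightarrow>
     (\<forall>\<pi> x. \<pi> permutes {..<m} \<and> x \<in> {..<m} \<rightarrow>\<^sub>E UNIV \<longrightarrow> h (x \<circ> \<pi>) = h x)"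

definition U_stat :: "nat \<Rightarrow> ((nat \<Rightarrow> real) \<Rightarrow> real) \<Rightarrow> nat \<Rightarrow> (nat \<Rightarrow> 'a \<Rightarrow> real) \<Rightarrow> 'a \<Rightarrow> real" where
  "U_stat m k n X \<omega> =
     (\<Sum>i | i \<in> {..<m} \<rightarrow>\<^sub>E {..<n} \<and> strict_mono_on {..<m} i. k (\<lambda>j\<in>{..<m}. X (i j) \<omega>))
       / real (n choose m)"

definition emp_df :: "nat \<Rightarrow> (nat \<Rightarrow> 'a \<Rightarrow> real) \<Rightarrow> 'a \<Rightarrow> real \<Rightarrow> real" where
  "emp_df n X \<omega> t = (\<Sum>i<n. of_bool (X i \<omega> < t)) / real n"

definition U_emp_df ::
  "nat \<Rightarrow> ((nat \<Rightarrow> real) \<Rightarrow> real) \<Rightarrow> nat \<Rightarrow> (nat \<Rightarrow> 'a \<Rightarrow> real) \<Rightarrow> 'a \<Rightarrow> real \<Rightarrow> real" where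
  "U_emp_df m h n X \<omega> t = U_stat m (\<lambda>y. of_bool (h y < t)) n X \<omega>"

definition kernel_df ::
  "'a measure \<Rightarrow> (nat \<Rightarrow> 'a \<Rightarrow> real) \<Rightarrow> nat \<Rightarrow> ((nat \<Rightarrow> real) \<Rightarrow> real) \<Rightarrow> ereal \<Rightarrow> real" where
  "kernel_df M X m h t = measure M {\<omega> \<in> space M. ereal (h (tuple m X \<omega>)) < t}"

definition DU ::
  "'a measure \<Rightarrow> (nat \<Rightarrow> 'a \<Rightarrow> real) \<Rightarrow> nat \<Rightarrow> ((nat \<Rightarrow> real) \<Rightarrow> real) \<Rightarrow> nat \<Rightarrow> 'a \<Rightarrow> real" where
  "DU M X m h n \<omega> = (SUP t::real. \<bar>U_emp_df m h n X \<omega> t - kernel_df M X m h (ereal t)\<bar>)"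

definition SU ::
  "(nat \<Rightarrow> 'a \<Rightarrow> real) \<Rightarrow> nat \<Rightarrow> ((nat \<Rightarrow> real) \<Rightarrow> real) \<Rightarrow> nat \<Rightarrow> 'a \<Rightarrow> real" where
  "SU X m h n \<omega> = (SUP t::real. \<bar>U_emp_df m h n X \<omega> t - emp_df n X \<omega> t\<bar>)"

type_synonym kernel_family = "(nat \<Rightarrow> real) \<Rightarrow> ereal \<Rightarrow> real"

definition Theta ::
  "'a measure \<Rightarrow> (nat \<Rightarrow> 'a \<Rightarrow> real) \<Rightarrow> nat \<Rightarrow> ((nat \<Rightarrow> real) \<Rightarrow> real) \<Rightarrow> kernel_family" where
  "Theta M X m h x t = of_bool (ereal (h x) < t) - kernel_df M X m h t"

definition Psi :: "nat \<Rightarrow> ((nat \<Rightarrow> real) \<Rightarrow> real) \<Rightarrow> kernel_family" where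
  "Psi m h x t = of_bool (ereal (h x) < t) - (\<Sum>i<m. of_bool (ereal (x i) < t)) / real m"

definition neg_family :: "kernel_family \<Rightarrow> kernel_family" where
  "neg_family \<Phi> x t = - \<Phi> x t"

definition centred ::
  "'a measure \<Rightarrow> (nat \<Rightarrow> 'a \<Rightarrow> real) \<Rightarrow> nat \<Rightarrow> ereal \<Rightarrow> ereal \<Rightarrow> kernel_family \<Rightarrow> bool" where
  "centred M X m \<alpha> \<beta> \<Phi> \<longleftrightarrow> (\<forall>t\<in>{\<alpha>..\<beta>}. (\<integral>\<omega>. \<Phi> (tuple m X \<omega>) t \<partial>M) = 0)"

(* E (Y | Z = s) as a Borel function of s: the factor through Z of the conditional
   expectation of Y given the sigma-algebra generated by Z. It is determined only up to
   null sets of the law of Z, which does not affect the variance function below. *)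
definition cond_exp_at :: "'a measure \<Rightarrow> ('a \<Rightarrow> real) \<Rightarrow> ('a \<Rightarrow> real) \<Rightarrow> real \<Rightarrow> real" where
  "cond_exp_at M Y Z = (SOME \<phi>. \<phi> \<in> borel_measurable borel \<and>
     (AE \<omega> in M. \<phi> (Z \<omega>) = real_cond_exp M (vimage_algebra (space M) Z borel) Y \<omega>))"

definition projection ::
  "'a measure \<Rightarrow> (nat \<Rightarrow> 'a \<Rightarrow> real) \<Rightarrow> nat \<Rightarrow> kernel_family \<Rightarrow> real \<Rightarrow> ereal \<Rightarrow> real" where
  "projection M X m \<Phi> s t = cond_exp_at M (\<lambda>\<omega>. \<Phi> (tuple m X \<omega>) t) (X 0) s"

definition variance_fun ::
  "'a measure \<Rightarrow> (nat \<Rightarrow> 'a \<Rightarrow> real) \<Rightarrow> nat \<Rightarrow> kernel_family \<Rightarrow> ereal \<Rightarrow> real" where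
  "variance_fun M X m \<Phi> t = (\<integral>\<omega>. (projection M X m \<Phi> (X 0 \<omega>) t)\<^sup>2 \<partial>M)"

definition nondegenerate ::
  "'a measure \<Rightarrow> (nat \<Rightarrow> 'a \<Rightarrow> real) \<Rightarrow> nat \<Rightarrow> ereal \<Rightarrow> ereal \<Rightarrow> kernel_family \<Rightarrow> bool" where
  "nondegenerate M X m \<alpha> \<beta> \<Phi> \<longleftrightarrow> finite {t \<in> {\<alpha><..<\<beta>}. variance_fun M X m \<Phi> t = 0}"

definition sup_variance ::
  "'a measure \<Rightarrow> (nat \<Rightarrow> 'a \<Rightarrow> real) \<Rightarrow> nat \<Rightarrow> ereal \<Rightarrow> ereal \<Rightarrow> kernel_family \<Rightarrow> real" where
  "sup_variance M X m \<alpha> \<beta> \<Phi> = (SUP t\<in>{\<alpha>..\<beta>}. variance_fun M X m \<Phi> t)"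

definition large_variance_set ::
  "'a measure \<Rightarrow> (nat \<Rightarrow> 'a \<Rightarrow> real) \<Rightarrow> nat \<Rightarrow> ereal \<Rightarrow> ereal \<Rightarrow> kernel_family \<Rightarrow> ereal set" where
  "large_variance_set M X m \<alpha> \<beta> \<Phi> =
     {t \<in> {\<alpha>..\<beta>}. variance_fun M X m \<Phi> t > sup_variance M X m \<alpha> \<beta> \<Phi> / 2}"

(* n^{-1} ln (p n) \<longlonglongrightarrow> L for a finite L. Positivity is required because ln 0 = 0 here,
   whereas ln 0 = -\<infinity> in the mathematical statement. *)
definition has_log_rate :: "(nat \<Rightarrow> real) \<Rightarrow> real \<Rightarrow> bool" where
  "has_log_rate p L \<longleftrightarrow>
     (\<forall>\<^sub>F n in sequentially. p n > 0) \<and> (\<lambda>n. ln (p n) / real n) \<longlonglongrightarrow> L"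

definition U_tail ::
  "'a measure \<Rightarrow> (nat \<Rightarrow> 'a \<Rightarrow> real) \<Rightarrow> nat \<Rightarrow> kernel_family \<Rightarrow> real \<Rightarrow> ereal \<Rightarrow> nat \<Rightarrow> real" where
  "U_tail M X m \<Phi> a t n = measure M {\<omega> \<in> space M. U_stat m (\<lambda>y. \<Phi> y t) n X \<omega> \<ge> a}"

definition rate_defined ::
  "'a measure \<Rightarrow> (nat \<Rightarrow> 'a \<Rightarrow> real) \<Rightarrow> nat \<Rightarrow> kernel_family \<Rightarrow> real \<Rightarrow> ereal \<Rightarrow> bool" where
  "rate_defined M X m \<Phi> a t \<longleftrightarrow> (\<exists>c. has_log_rate (U_tail M X m \<Phi> a t) (- c))"

definition rate ::
  "'a measure \<Rightarrow> (nat \<Rightarrow> 'a \<Rightarrow> real) \<Rightarrow> nat \<Rightarrow> kernel_family \<Rightarrow> real \<Rightarrow> ereal \<Rightarrow> real" where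
  "rate M X m \<Phi> a t = (THE c. has_log_rate (U_tail M X m \<Phi> a t) (- c))"

definition rate_inf ::
  "'a measure \<Rightarrow> (nat \<Rightarrow> 'a \<Rightarrow> real) \<Rightarrow> nat \<Rightarrow> ereal \<Rightarrow> ereal \<Rightarrow> kernel_family \<Rightarrow> real \<Rightarrow> real" where
  "rate_inf M X m \<alpha> \<beta> \<Phi> a = (INF t\<in>large_variance_set M X m \<alpha> \<beta> \<Phi>. rate M X m \<Phi> a t)"

definition v_D ::
  "'a measure \<Rightarrow> (nat \<Rightarrow> 'a \<Rightarrow> real) \<Rightarrow> nat \<Rightarrow> ((nat \<Rightarrow> real) \<Rightarrow> real) \<Rightarrow> ereal \<Rightarrow> ereal \<Rightarrow> real \<Rightarrow> real" where
  "v_D M X m h \<alpha> \<beta> a = - min (rate_inf M X m \<alpha> \<beta> (Theta M X m h) a)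
                              (rate_inf M X m \<alpha> \<beta> (neg_family (Theta M X m h)) a)"

definition v_S ::
  "'a measure \<Rightarrow> (nat \<Rightarrow> 'a \<Rightarrow> real) \<Rightarrow> nat \<Rightarrow> ((nat \<Rightarrow> real) \<Rightarrow> real) \<Rightarrow> ereal \<Rightarrow> ereal \<Rightarrow> real \<Rightarrow> real" where
  "v_S M X m h \<alpha> \<beta> a = - min (rate_inf M X m \<alpha> \<beta> (Psi m h) a)
                              (rate_inf M X m \<alpha> \<beta> (neg_family (Psi m h)) a)"

end

theory Submission
  imports Defs "HOL-Real_Asymp.Real_Asymp"
begin

text \<open>Write \<open>H w\<close> for the relative entropy of the law with density \<open>w\<close> with respect to the law \<open>D\<close> of \<open>X 0\<close>.
  For a bounded centred symmetric kernel \<open>f\<close>, the rate of \<open>U\<^sub>n \<ge> a\<close> is \<open>J a\<close>, the infimum of \<open>H w\<close> over all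
  \<open>w\<close> for which the mean of \<open>f\<close> under independent arguments with density \<open>w\<close> is at least \<open>a\<close>. The lower
  bound comes from tilting the sample by \<open>w\<close>. For the upper bound, \<open>f\<close> is approximated in \<open>L\<^sup>1\<close> by a
  function of finitely many cells, where the method of types applies; Hoeffding's block
  averages make the approximation error superexponentially unlikely.

  The mean is a differentiable function of \<open>w\<close> with gradient \<open>m \<phi>\<close> at \<open>w = 1\<close>, where \<open>\<phi>\<close> is the projection
  of \<open>f\<close>, and the constraint forces \<open>w\<close> to be close to 1 when \<open>a\<close> is small. Hence \<open>J a\<close> is
  \<open>a\<^sup>2 / (2 m\<^sup>2 \<sigma>\<^sup>2)\<close> up to a factor \<open>1 + O(a)\<close>, and mixing \<open>w\<close> with \<open>1 + c \<phi>\<close> shows that \<open>J\<close> is Lipschitz;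
  both estimates are uniform over kernels whose variance \<open>\<sigma>\<^sup>2\<close> is bounded below.
  By monotonicity and continuity of the distribution functions, finitely many parameters control
  the supremum, and those outside \<open>T\<close> do not contribute because their variance is too small.\<close>

section \<open>Averages over injective index tuples\<close>

text \<open>The obstacle sits at the boundary of the constraint: tilting gives a lower bound only
  for densities whose mean strictly exceeds \<open>a\<close>, and approximation gives an upper bound
  only with the threshold lowered by some \<open>d > 0\<close>. The limit exists because
  \<open>J\<close> is continuous, and for infima over \<open>T\<close> the modulus of continuity
  must be common to all parameters; hence the Lipschitz constant is computed from the degree and a
  lower bound on the variance alone. Entropy controls the squared L1 distance of a density from 1. A
  density of entropy of order \<open>a^2\<close> therefore makes the quadratic remainder in the
  expansion of the mean of order \<open>a^2\<close> too, negligible against the linear part, which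
  is of order \<open>a\<close>. Only bounded densities compete in the infimum, so every integral
  exists at once. This loses nothing: the densities that must be available are those constant on
  finitely many cells and those of the form \<open>1 + c * phi\<close>, and all of them are
  bounded.\<close>

definition inj_tuples :: "nat \<Rightarrow> nat \<Rightarrow> (nat \<Rightarrow> nat) set" where
  "inj_tuples m n = {i \<in> {..<m} \<rightarrow>\<^sub>E {..<n}. inj_on i {..<m}}"

text \<open>Averaging over all injective index tuples agrees with the U-statistic for symmetric kernels, and
  remains meaningful for the non-symmetric step kernels used to approximate them.\<close>

definition inj_avg :: "nat \<Rightarrow> nat \<Rightarrow> ((nat \<Rightarrow> 'b) \<Rightarrow> real) \<Rightarrow> (nat \<Rightarrow> 'b) \<Rightarrow> real" where
  "inj_avg m n f x = (\<Sum>i\<in>inj_tuples m n. f (\<lambda>j\<in>{..<m}. x (i j))) / real (card (inj_tuples m n))"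

lemma finite_inj_tuples [simp, intro]: "finite (inj_tuples m n)"
  unfolding inj_tuples_def by (rule finite_subset[OF _ finite_PiE[of "{..<m}" "\<lambda>_. {..<n}"]]) auto

lemma inj_tuples_inj: "i \<in> inj_tuples m n \<Longrightarrow> inj_on i {..<m}"
  and inj_tuples_less: "i \<in> inj_tuples m n \<Longrightarrow> j < m \<Longrightarrow> i j < n"
  and inj_tuples_ext: "i \<in> inj_tuples m n \<Longrightarrow> i \<in> extensional {..<m}"
  by (auto simp: inj_tuples_def PiE_def)

lemma inj_tuplesI: "inj_on i {..<m} \<Longrightarrow> (\<And>j. j < m \<Longrightarrow> i j < n) \<Longrightarrow> restrict i {..<m} \<in> inj_tuples m n"
  by (auto simp: inj_tuples_def)

lemma inj_tuples_nonempty: "m \<le> n \<Longrightarrow> inj_tuples m n \<noteq> {}"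
  using inj_tuplesI[of id m n] by auto

lemma card_inj_tuples: "card (inj_tuples m n) = (\<Prod>i<m. n - i)"
  unfolding inj_tuples_def
  using card_inj_on_subset_funcset[of "{..<m}" "{..<n}" "{..<m}"] by (simp add: atLeast0LessThan)

lemma card_inj_tuples_pos: "m \<le> n \<Longrightarrow> card (inj_tuples m n) > 0"
  using inj_tuples_nonempty card_gt_0_iff by blast

text \<open>Tuples with a repeated index are asymptotically negligible. The upper bound can
  therefore pass to the average over all tuples, which factorises over cells.\<close>

lemma card_inj_tuples_ratio: "(\<lambda>n. real (card (inj_tuples m n)) / real n ^ m) \<longlonglongrightarrow> 1"
proof -
  have "(\<lambda>n. \<Prod>i<m. (real n - real i) / real n) \<longlonglongrightarrow> (\<Prod>i<m. 1)"
  proof (rule tendsto_prod)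
    fix i
    show "(\<lambda>n. (real n - real i) / real n) \<longlonglongrightarrow> 1" by real_asymp
  qed
  moreover have "\<forall>\<^sub>F n in sequentially.
      (\<Prod>i<m. (real n - real i) / real n) = real (card (inj_tuples m n)) / real n ^ m"
    using eventually_ge_at_top[of m]
  proof eventually_elim
    case (elim n)
    have "(\<Prod>i<m. real (n - i)) = (\<Prod>i<m. real n - real i)"
      using elim by (intro prod.cong) (auto simp: of_nat_diff)
    then show ?case by (simp add: card_inj_tuples prod_dividef)
  qed
  ultimately show ?thesis by (simp add: tendsto_cong)
qed

text \<open>Transitivity of the symmetric group on injective tuples: it makes averages over
  permutations independent of the tuple they start from.\<close>

lemma permutes_extends_inj_tuple:
  assumes "e \<in> inj_tuples m n" "e' \<in> inj_tuples m n"
  obtains \<sigma> where "\<sigma> permutes {..<n}" "\<And>j. j < m \<Longrightarrow> \<sigma> (e j) = e' j"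
proof -
  have inj: "inj_on e {..<m}" "inj_on e' {..<m}" and sub: "e ` {..<m} \<subseteq> {..<n}" "e' ` {..<m} \<subseteq> {..<n}"
    using assms by (auto simp: inj_tuples_def)
  have "card ({..<n} - e ` {..<m}) = card ({..<n} - e' ` {..<m})"
    using inj sub by (simp add: card_Diff_subset card_image)
  then obtain g where g: "bij_betw g ({..<n} - e ` {..<m}) ({..<n} - e' ` {..<m})"
    using finite_same_card_bij[of "{..<n} - e ` {..<m}" "{..<n} - e' ` {..<m}"] by auto
  have e1: "bij_betw (e' \<circ> the_inv_into {..<m} e) (e ` {..<m}) (e' ` {..<m})"
    using inj by (intro bij_betw_trans[OF bij_betw_the_inv_into]) (auto simp: bij_betw_def)
  define f where "f x = (if x \<in> e ` {..<m} then (e' \<circ> the_inv_into {..<m} e) x else g x)" for x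
  have "bij_betw f (e ` {..<m} \<union> ({..<n} - e ` {..<m})) (e' ` {..<m} \<union> ({..<n} - e' ` {..<m}))"
  proof (rule bij_betw_combine)
    show "bij_betw f (e ` {..<m}) (e' ` {..<m})"
      using e1 by (simp add: f_def cong: bij_betw_cong)
    show "bij_betw f ({..<n} - e ` {..<m}) ({..<n} - e' ` {..<m})"
      using g by (rule bij_betw_cong[THEN iffD1, rotated]) (auto simp: f_def)
  qed auto
  moreover have "e ` {..<m} \<union> ({..<n} - e ` {..<m}) = {..<n}" "e' ` {..<m} \<union> ({..<n} - e' ` {..<m}) = {..<n}"
    using sub by auto
  ultimately have f: "bij_betw f {..<n} {..<n}" by simp
  define \<sigma> where "\<sigma> x = (if x < n then f x else x)" for x
  have "\<sigma> permutes {..<n}"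
    using f bij_betw_cong[of "{..<n}" \<sigma> f] by (intro bij_imp_permutes) (auto simp: \<sigma>_def)
  moreover have "\<sigma> (e j) = e' j" if "j < m" for j
    using that sub inj by (auto simp: \<sigma>_def f_def the_inv_into_f_f)
  ultimately show ?thesis using that by blast
qed

text \<open>Composing with a permutation that carries \<open>e\<close> to \<open>e'\<close> only
  reindexes the sum, so the left sum is the same for every starting tuple. Summing over all of them
  and exchanging the sums, each permutation acts bijectively on the injective tuples, so each of the
  \<open>fact n\<close> inner sums is the full sum.\<close>

lemma permutation_average:
  fixes F :: "(nat \<Rightarrow> nat) \<Rightarrow> real"
  assumes e: "e \<in> inj_tuples m n"
  shows "(\<Sum>\<pi> | \<pi> permutes {..<n}. F (\<lambda>j\<in>{..<m}. \<pi> (e j))) * real (card (inj_tuples m n))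
    = fact n * (\<Sum>i\<in>inj_tuples m n. F i)"
proof -
  let ?P = "{\<pi>. \<pi> permutes {..<n}}"
  have *: "(\<Sum>\<pi>\<in>?P. F (\<lambda>j\<in>{..<m}. \<pi> (e' j))) = (\<Sum>\<pi>\<in>?P. F (\<lambda>j\<in>{..<m}. \<pi> (e j)))"
    if e': "e' \<in> inj_tuples m n" for e'
  proof -
    obtain \<sigma> where \<sigma>: "\<sigma> permutes {..<n}" "\<And>j. j < m \<Longrightarrow> \<sigma> (e j) = e' j"
      using permutes_extends_inj_tuple[OF e e'] by blast
    have "(\<Sum>\<pi>\<in>?P. F (\<lambda>j\<in>{..<m}. \<pi> (e j))) = (\<Sum>\<pi>\<in>?P. F (\<lambda>j\<in>{..<m}. (\<pi> \<circ> \<sigma>) (e j)))"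
      using sum.reindex_bij_betw[OF bij_betw_byWitness[of ?P "\<lambda>\<pi>. \<pi> \<circ> inv \<sigma>" "\<lambda>\<pi>. \<pi> \<circ> \<sigma>" ?P],
          of "\<lambda>\<pi>. F (\<lambda>j\<in>{..<m}. \<pi> (e j))"] \<sigma>(1)
      by (fastforce simp: permutes_inv_o o_assoc[symmetric] intro: permutes_compose permutes_inv)
    also have "\<dots> = (\<Sum>\<pi>\<in>?P. F (\<lambda>j\<in>{..<m}. \<pi> (e' j)))"
      using \<sigma>(2) by (intro sum.cong refl arg_cong[where f=F]) (auto simp: fun_eq_iff)
    finally show ?thesis by simp
  qed
  have "(\<Sum>\<pi>\<in>?P. F (\<lambda>j\<in>{..<m}. \<pi> (e j))) * real (card (inj_tuples m n))
      = (\<Sum>e'\<in>inj_tuples m n. \<Sum>\<pi>\<in>?P. F (\<lambda>j\<in>{..<m}. \<pi> (e' j)))"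
    using * by simp
  also have "\<dots> = (\<Sum>\<pi>\<in>?P. \<Sum>e'\<in>inj_tuples m n. F (\<lambda>j\<in>{..<m}. \<pi> (e' j)))"
    by (rule sum.swap)
  also have "\<dots> = (\<Sum>\<pi>\<in>?P. \<Sum>i\<in>inj_tuples m n. F i)"
  proof (rule sum.cong[OF refl])
    fix \<pi> assume "\<pi> \<in> ?P"
    then have \<pi>: "\<pi> permutes {..<n}" by simp
    have in1: "(\<lambda>j\<in>{..<m}. \<rho> (i j)) \<in> inj_tuples m n" if "\<rho> permutes {..<n}" "i \<in> inj_tuples m n" for i \<rho>
      using that permutes_in_image[OF that(1)] permutes_inj[OF that(1)]
      by (auto simp: inj_tuples_def inj_on_def PiE_iff dest: injD)
    have "bij_betw (\<lambda>i. \<lambda>j\<in>{..<m}. \<pi> (i j)) (inj_tuples m n) (inj_tuples m n)"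
    proof (rule bij_betw_byWitness[where f'="\<lambda>i. \<lambda>j\<in>{..<m}. inv \<pi> (i j)"])
      show "\<forall>a\<in>inj_tuples m n. (\<lambda>j\<in>{..<m}. inv \<pi> ((\<lambda>j\<in>{..<m}. \<pi> (a j)) j)) = a"
        using permutes_inverses[OF \<pi>] by (auto dest!: inj_tuples_ext simp: fun_eq_iff extensional_def)
      show "\<forall>a\<in>inj_tuples m n. (\<lambda>j\<in>{..<m}. \<pi> ((\<lambda>j\<in>{..<m}. inv \<pi> (a j)) j)) = a"
        using permutes_inverses[OF \<pi>] by (auto dest!: inj_tuples_ext simp: fun_eq_iff extensional_def)
    qed (use in1 \<pi> permutes_inv[OF \<pi>] in auto)
    from sum.reindex_bij_betw[OF this, of F]
    show "(\<Sum>e'\<in>inj_tuples m n. F (\<lambda>j\<in>{..<m}. \<pi> (e' j))) = (\<Sum>i\<in>inj_tuples m n. F i)" by simp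
  qed
  also have "\<dots> = fact n * (\<Sum>i\<in>inj_tuples m n. F i)"
    by (simp add: card_permutations)
  finally show ?thesis .
qed

text \<open>The freedom in \<open>e\<close> is the point: in \<open>inj_avg_mgf\<close> the same
  average is expanded from several disjoint blocks at once.\<close>

lemma inj_avg_eq_permutation_average:
  assumes e: "e \<in> inj_tuples m n"
  shows "inj_avg m n f x = (\<Sum>\<pi> | \<pi> permutes {..<n}. f (\<lambda>j\<in>{..<m}. x (\<pi> (e j)))) / fact n"
proof -
  have "card (inj_tuples m n) > 0" using e by (auto simp: card_gt_0_iff)
  moreover have eq: "f (\<lambda>j\<in>{..<m}. x ((\<lambda>j\<in>{..<m}. \<pi> (e j)) j)) = f (\<lambda>j\<in>{..<m}. x (\<pi> (e j)))" for \<pi>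
    by (rule arg_cong[where f=f]) (auto simp: fun_eq_iff)
  ultimately show ?thesis
    using permutation_average[OF e, of "\<lambda>i. f (\<lambda>j\<in>{..<m}. x (i j))"]
    unfolding inj_avg_def eq using e by (auto simp: divide_eq_eq eq_divide_eq mult.commute)
qed

text \<open>Every injective tuple is, in exactly one way, an increasing tuple composed with a permutation.\<close>

lemma U_stat_eq_inj_avg:
  assumes sym: "symmetric_kernel m k" and mn: "m \<le> n"
  shows "U_stat m k n X \<omega> = inj_avg m n k (\<lambda>i. X i \<omega>)"
proof -
  define S where "S = {i. i \<in> {..<m} \<rightarrow>\<^sub>E {..<n} \<and> strict_mono_on {..<m} i}"
  let ?P = "{\<pi>. \<pi> permutes {..<m}}"
  have S_inj: "S \<subseteq> inj_tuples m n"
    by (auto simp: S_def inj_tuples_def dest: strict_mono_on_imp_inj_on)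
  have finS: "finite S" using S_inj finite_subset by blast
  \<comment> \<open>An increasing tuple lists its image in sorted order and is therefore determined
    by it.\<close>
  have eq0: "i = j" if "i \<in> S" "j \<in> S" "i ` {..<m} = j ` {..<m}" for i j
  proof -
    have map: "map i [0..<m] = sorted_list_of_set (i ` {..<m})" if "i \<in> S" for i
    proof -
      have "strict_mono_on {..<m} i" using that by (simp add: S_def)
      then have "sorted_wrt (<) (map i [0..<m])"
        by (auto simp: sorted_wrt_iff_nth_less strict_mono_on_def)
      then show ?thesis
        by (intro sorted_list_of_set_unique[THEN iffD1, symmetric])
           (auto simp: strict_sorted_iff atLeast0LessThan dest!: distinct_card)
    qed
    have "map i [0..<m] = map j [0..<m]" using map that by simp
    then have "\<forall>x<m. i x = j x" by simp
    with that(1,2) show ?thesis by (intro extensionalityI[of i "{..<m}" j]) (auto simp: S_def PiE_def)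
  qed
  have bij: "bij_betw (\<lambda>(s, \<pi>). \<lambda>j\<in>{..<m}. s (\<pi> j)) (S \<times> ?P) (inj_tuples m n)"
    unfolding bij_betw_def
  proof (intro conjI inj_onI set_eqI iffI)
    fix p q assume p: "p \<in> S \<times> ?P" and q: "q \<in> S \<times> ?P"
      and eq: "(case p of (s, \<pi>) \<Rightarrow> \<lambda>j\<in>{..<m}. s (\<pi> j)) = (case q of (s, \<pi>) \<Rightarrow> \<lambda>j\<in>{..<m}. s (\<pi> j))"
    obtain s \<pi> s' \<pi>' where pq: "p = (s, \<pi>)" "q = (s', \<pi>')" by fastforce
    have \<pi>: "\<pi> permutes {..<m}" "\<pi>' permutes {..<m}" and s: "s \<in> S" "s' \<in> S" using p q pq by auto
    have e: "s (\<pi> j) = s' (\<pi>' j)" if "j < m" for j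
      using fun_cong[OF eq, of j] that by (simp add: pq)
    have "s ` {..<m} = s ` \<pi> ` {..<m}" using permutes_image[OF \<pi>(1)] by simp
    also have "\<dots> = s' ` \<pi>' ` {..<m}" using e by (auto simp: image_image)
    also have "\<dots> = s' ` {..<m}" using permutes_image[OF \<pi>(2)] by simp
    finally have ss: "s = s'" using eq0 s by blast
    have "\<pi> j = \<pi>' j" for j
    proof (cases "j < m")
      case True
      then show ?thesis using e[OF True] ss S_inj s(1) permutes_in_image[OF \<pi>(1), of j] permutes_in_image[OF \<pi>(2), of j]
        by (auto dest!: inj_tuples_inj simp: inj_on_def)
    qed (use \<pi> permutes_not_in in \<open>metis lessThan_iff\<close>)
    with ss pq show "p = q" by auto
  next
    fix i assume "i \<in> (\<lambda>(s, \<pi>). \<lambda>j\<in>{..<m}. s (\<pi> j)) ` (S \<times> ?P)"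
    then obtain s \<pi> where i: "i = (\<lambda>j\<in>{..<m}. s (\<pi> j))" "s \<in> S" "\<pi> permutes {..<m}" by auto
    have "inj_on (\<lambda>j. s (\<pi> j)) {..<m}"
      using comp_inj_on[of \<pi> "{..<m}" s] i S_inj permutes_image[OF i(3)] permutes_inj_on[OF i(3)]
      by (auto dest: inj_tuples_inj simp: o_def)
    with i show "i \<in> inj_tuples m n"
      using S_inj permutes_in_image[OF i(3)] by (auto intro!: inj_tuplesI intro: inj_tuples_less)
  next
    fix i assume i: "i \<in> inj_tuples m n"
    \<comment> \<open>The increasing factor of \<open>i\<close> enumerates the image of
      \<open>i\<close> in order; the permutation records the rank of each entry.\<close>
    define l where "l = sorted_list_of_set (i ` {..<m})"
    have len: "length l = m" using i by (simp add: l_def card_image inj_tuples_inj)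
    have set_l: "set l = i ` {..<m}" by (simp add: l_def)
    define s where "s = (\<lambda>j\<in>{..<m}. l ! j)"
    have s: "s \<in> S"
    proof -
      have "l ! j < n" if "j < m" for j
        using nth_mem[of j l] that len set_l i by (auto dest: inj_tuples_less)
      moreover have "strict_mono_on {..<m} s"
        using len by (auto simp: s_def strict_mono_on_def l_def intro!: sorted_wrt_nth_less[OF strict_sorted_list_of_set])
      ultimately show ?thesis by (auto simp: S_def s_def)
    qed
    have bs: "bij_betw s {..<m} (i ` {..<m})"
    proof -
      have "s ` {..<m} = set l" using len by (auto simp: s_def set_conv_nth)
      then show ?thesis using s S_inj set_l by (auto simp: bij_betw_def dest: inj_tuples_inj)
    qed
    have bi: "bij_betw i {..<m} (i ` {..<m})" using i by (simp add: bij_betw_def inj_tuples_inj)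
    define \<pi> where "\<pi> j = (if j < m then the_inv_into {..<m} s (i j) else j)" for j
    have "bij_betw (the_inv_into {..<m} s \<circ> i) {..<m} {..<m}"
      using bij_betw_trans[OF bi bij_betw_the_inv_into[OF bs]] .
    then have "\<pi> permutes {..<m}"
      using bij_betw_cong[of "{..<m}" \<pi> "the_inv_into {..<m} s \<circ> i"]
      by (intro bij_imp_permutes) (auto simp: \<pi>_def)
    moreover have "i = (\<lambda>j\<in>{..<m}. s (\<pi> j))"
      using i f_the_inv_into_f_bij_betw[OF bs] by (auto simp: fun_eq_iff \<pi>_def dest!: inj_tuples_ext simp: extensional_def)
    ultimately show "i \<in> (\<lambda>(s, \<pi>). \<lambda>j\<in>{..<m}. s (\<pi> j)) ` (S \<times> ?P)" using s by force
  qed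
  \<comment> \<open>Kept general in \<open>f\<close> because the constant kernel 1 then yields the
    cardinality of \<open>S\<close>.\<close>
  have total: "(\<Sum>i\<in>inj_tuples m n. f (\<lambda>j\<in>{..<m}. X (i j) \<omega>)) = fact m * (\<Sum>s\<in>S. f (\<lambda>j\<in>{..<m}. X (s j) \<omega>))"
    if f: "symmetric_kernel m f" for f :: "(nat \<Rightarrow> real) \<Rightarrow> real"
  proof -
    have "(\<Sum>i\<in>inj_tuples m n. f (\<lambda>j\<in>{..<m}. X (i j) \<omega>))
        = (\<Sum>(s, \<pi>)\<in>S \<times> ?P. f (\<lambda>j\<in>{..<m}. X ((\<lambda>j\<in>{..<m}. s (\<pi> j)) j) \<omega>))"
      by (subst sum.reindex_bij_betw[OF bij, symmetric]) (simp add: case_prod_beta)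
    also have "\<dots> = (\<Sum>(s, \<pi>)\<in>S \<times> ?P. f (\<lambda>j\<in>{..<m}. X (s j) \<omega>))"
    proof (rule sum.cong[OF refl], clarify)
      fix s \<pi> assume "s \<in> S" and \<pi>: "\<pi> permutes {..<m}"
      have "(\<lambda>j\<in>{..<m}. X ((\<lambda>j\<in>{..<m}. s (\<pi> j)) j) \<omega>) = (\<lambda>j\<in>{..<m}. X (s j) \<omega>) \<circ> \<pi>"
        using permutes_in_image[OF \<pi>] by (auto simp: fun_eq_iff)
      then show "f (\<lambda>j\<in>{..<m}. X ((\<lambda>j\<in>{..<m}. s (\<pi> j)) j) \<omega>) = f (\<lambda>j\<in>{..<m}. X (s j) \<omega>)"
        using f \<pi> unfolding symmetric_kernel_def by auto
    qed
    also have "\<dots> = fact m * (\<Sum>s\<in>S. f (\<lambda>j\<in>{..<m}. X (s j) \<omega>))"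
      by (simp add: sum.cartesian_product[symmetric] card_permutations sum_distrib_left)
    finally show ?thesis .
  qed
  have cI: "real (card (inj_tuples m n)) = fact m * real (card S)"
    using total[of "\<lambda>_. 1"] by (simp add: symmetric_kernel_def)
  have "card (inj_tuples m n) = fact m * (n choose m)"
  proof -
    have "(\<Prod>i<m. n - i) * fact (n - m) = (fact n :: nat)"
      using mn by (induction m) (auto simp: fact_reduce[of "n - _"] algebra_simps Suc_diff_Suc)
    moreover have "fact m * fact (n - m) * (n choose m) = fact n" using binomial_fact_lemma[OF mn] .
    ultimately have "(\<Prod>i<m. n - i) * fact (n - m) = fact m * (n choose m) * fact (n - m)"
      by (simp add: mult_ac)
    then show ?thesis by (simp add: card_inj_tuples)
  qed
  with cI have cS: "real (card S) = real (n choose m)"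
    by (metis fact_nonzero mult_left_cancel of_nat_fact of_nat_mult)
  show ?thesis
    unfolding U_stat_def inj_avg_def total[OF sym] cI cS S_def[symmetric] by simp
qed

section \<open>Product samples and block averages\<close>

locale sample_law = prob_space D for D :: "'b measure"
begin

text \<open>Instantiated on all of the index type so that its integration rules serve every
  \<open>DP n\<close> as well as \<open>PiM {1..<m}\<close>.\<close>

sublocale P: product_prob_space "\<lambda>_::nat. D" UNIV
  by unfold_locales

abbreviation DP :: "nat \<Rightarrow> (nat \<Rightarrow> 'b) measure" where
  "DP n \<equiv> PiM {..<n} (\<lambda>_. D)"

lemma prob_space_DP: "prob_space (DP n)"
  by (intro prob_space_PiM prob_space_axioms)

lemma measurable_select [measurable (raw)]:
  assumes "\<And>j. j < m \<Longrightarrow> i j < n"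
  shows "(\<lambda>x. \<lambda>j\<in>{..<m}. x (i j)) \<in> measurable (DP n) (DP m)"
  using assms by (intro measurable_restrict measurable_component_singleton) auto

lemma distr_select:
  assumes "inj_on i {..<m}" "\<And>j. j < m \<Longrightarrow> i j < n"
  shows "distr (DP n) (DP m) (\<lambda>x. \<lambda>j\<in>{..<m}. x (i j)) = DP m"
  using distr_PiM_reindex[of "{..<n}" "\<lambda>_. D" i "{..<m}"] assms prob_space_axioms by auto

lemma integral_select:
  fixes f :: "(nat \<Rightarrow> 'b) \<Rightarrow> real"
  assumes "inj_on i {..<m}" "\<And>j. j < m \<Longrightarrow> i j < n" "f \<in> borel_measurable (DP m)"
  shows "(\<integral>x. f (\<lambda>j\<in>{..<m}. x (i j)) \<partial>DP n) = (\<integral>x. f x \<partial>DP m)"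
proof -
  have "(\<integral>x. f x \<partial>distr (DP n) (DP m) (\<lambda>x. \<lambda>j\<in>{..<m}. x (i j))) = (\<integral>x. f (\<lambda>j\<in>{..<m}. x (i j)) \<partial>DP n)"
    using assms by (intro integral_distr measurable_select) auto
  then show ?thesis
    using distr_select[OF assms(1,2)] by simp
qed

lemma measurable_inj_avg [measurable]:
  assumes [measurable]: "f \<in> borel_measurable (DP m)"
  shows "inj_avg m n f \<in> borel_measurable (DP n)"
  unfolding inj_avg_def
  by (intro borel_measurable_divide borel_measurable_sum borel_measurable_const
        measurable_compose[OF measurable_select assms]) (auto dest: inj_tuples_less)

abbreviation avg_tail :: "nat \<Rightarrow> ((nat \<Rightarrow> 'b) \<Rightarrow> real) \<Rightarrow> nat \<Rightarrow> real \<Rightarrow> real" where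
  "avg_tail m f n a \<equiv> measure (DP n) {x \<in> space (DP n). inj_avg m n f x \<ge> a}"

lemma indep_coordinates: "prob_space.indep_vars (DP n) (\<lambda>_. D) (\<lambda>i x. x i) {..<n}"
\<comment> \<open>The characterisation of independence by the joint law is available for nonempty
  index sets only.\<close>
proof (cases "n = 0")
  case True
  interpret S: prob_space "DP n" by (rule prob_space_DP)
  show ?thesis
    unfolding S.indep_vars_def S.indep_sets_def using True by auto
next
  case False
  interpret S: prob_space "DP n" by (rule prob_space_DP)
  have d: "distr (DP n) D (\<lambda>x. x i) = D" if "i < n" for i
    using distr_PiM_component[of "{..<n}" "\<lambda>_. D" i] that prob_space_axioms by simp
  have "distr (DP n) (DP n) (\<lambda>x. \<lambda>i\<in>{..<n}. x i) = DP n"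
    using distr_select[of id n n] by simp
  also have "DP n = (\<Pi>\<^sub>M i\<in>{..<n}. distr (DP n) D (\<lambda>x. x i))"
    by (intro PiM_cong) (auto simp: d)
  finally show ?thesis
    using False by (subst S.indep_vars_iff_distr_eq_PiM') auto
qed

text \<open>Functions of disjoint sets of coordinates are independent, and an injective block of
  \<open>m\<close> coordinates has the law \<open>DP m\<close>. The bounds on \<open>f\<close> serve
  integrability.\<close>

lemma integral_disjoint_blocks:
  fixes f :: "(nat \<Rightarrow> 'b) \<Rightarrow> real"
  assumes f: "f \<in> borel_measurable (DP m)" and nonneg: "\<And>x. f x \<ge> 0" and bnd: "\<And>x. f x \<le> C"
    and less: "\<And>b j. b < k \<Longrightarrow> j < m \<Longrightarrow> e b j < n"
    and inj: "\<And>b. b < k \<Longrightarrow> inj_on (e b) {..<m}"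
    and disj: "disjoint_family_on (\<lambda>b. e b ` {..<m}) {..<k}"
  shows "(\<integral>x. (\<Prod>b<k. f (\<lambda>j\<in>{..<m}. x (e b j))) \<partial>DP n) = (\<integral>x. f x \<partial>DP m) ^ k"
proof (cases "k = 0")
  case True
  interpret S: prob_space "DP n" by (rule prob_space_DP)
  show ?thesis using True S.prob_space by simp
next
  case False
  interpret S: prob_space "DP n" by (rule prob_space_DP)
  let ?K = "\<lambda>b. e b ` {..<m}"
  have 1: "S.indep_vars (\<lambda>b. PiM (?K b) (\<lambda>_. D)) (\<lambda>b x. restrict (\<lambda>i. x i) (?K b)) {..<k}"
    by (rule S.indep_vars_restrict[OF indep_coordinates _ disj]) (auto dest: less)
  have 2: "S.indep_vars (\<lambda>_. borel) (\<lambda>b x. (\<lambda>y. f (\<lambda>j\<in>{..<m}. y (e b j))) (restrict (\<lambda>i. x i) (?K b))) {..<k}"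
    by (rule S.indep_vars_compose2[OF 1])
       (intro measurable_compose[OF _ f] measurable_restrict measurable_component_singleton, auto)
  have eq: "f (\<lambda>j\<in>{..<m}. (restrict (\<lambda>i. x i) (?K b)) (e b j)) = f (\<lambda>j\<in>{..<m}. x (e b j))" for b x
    by (rule arg_cong[where f=f]) (auto simp: fun_eq_iff)
  have 3: "S.indep_vars (\<lambda>_. borel) (\<lambda>b x. f (\<lambda>j\<in>{..<m}. x (e b j))) {..<k}"
    using 2 unfolding eq .
  have int: "integrable (DP n) (\<lambda>x. f (\<lambda>j\<in>{..<m}. x (e b j)))" if "b < k" for b
    by (rule S.integrable_const_bound[where B=C])
       (use nonneg bnd less[OF that] in \<open>auto intro!: measurable_compose[OF measurable_select f]\<close>)
  have "(\<integral>x. (\<Prod>b<k. f (\<lambda>j\<in>{..<m}. x (e b j))) \<partial>DP n) = (\<Prod>b<k. \<integral>x. f (\<lambda>j\<in>{..<m}. x (e b j)) \<partial>DP n)"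
    by (rule S.indep_vars_lebesgue_integral[OF _ 3]) (use int in auto)
  also have "\<dots> = (\<Prod>b<k. \<integral>x. f x \<partial>DP m)"
    using integral_select[OF inj less f] by (intro prod.cong) auto
  finally show ?thesis by simp
qed

text \<open>Hoeffding's device: a U-statistic is an average, over all permutations of the sample, of means
  over disjoint blocks.\<close>

lemma inj_avg_mgf:
  fixes f :: "(nat \<Rightarrow> 'b) \<Rightarrow> real"
  assumes f: "f \<in> borel_measurable (DP m)" and bnd: "\<And>x. \<bar>f x\<bar> \<le> C" and m: "m \<ge> 1" and k: "k * m \<le> n" "k \<ge> 1"
  shows "(\<integral>x. exp (real k * inj_avg m n f x) \<partial>DP n) \<le> (\<integral>x. exp (f x) \<partial>DP m) ^ k"
proof -
  interpret S: prob_space "DP n" by (rule prob_space_DP)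
  let ?P = "{\<pi>. \<pi> permutes {..<n}}"
  have finP: "finite ?P" by (simp add: finite_permutations)
  have cardP: "card ?P = fact n" by (simp add: card_permutations)
  \<comment> \<open>Block \<open>b\<close> consists of the \<open>m\<close> consecutive indices
    starting at \<open>b * m\<close>; \<open>k * m \<le> n\<close> keeps all blocks inside the
    sample.\<close>
  define e where "e b = (\<lambda>j\<in>{..<m}. b * m + j)" for b
  have e_less: "b * m + j < n" if "b < k" "j < m" for b j
  proof -
    have "b * m + j < b * m + m" using that by simp
    also have "\<dots> = Suc b * m" by simp
    also have "\<dots> \<le> k * m" using that by (intro mult_le_mono1) simp
    finally show ?thesis using k by simp
  qed
  have e_in: "e b \<in> inj_tuples m n" if "b < k" for b
    unfolding e_def using that e_less by (intro inj_tuplesI) (auto simp: inj_on_def)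
  define g where "g \<pi> b x = f (\<lambda>j\<in>{..<m}. x (\<pi> (e b j)))" for \<pi> :: "nat \<Rightarrow> nat" and b and x :: "nat \<Rightarrow> 'b"
  \<comment> \<open>Each of the \<open>k\<close> copies of the average is expanded from a different
    block, so that for a fixed permutation the summands \<open>g \<pi> b\<close> are
    independent.\<close>
  have avg: "real k * inj_avg m n f x = (\<Sum>\<pi>\<in>?P. (1 / fact n) *\<^sub>R (\<Sum>b<k. g \<pi> b x))" for x
  proof -
    have "real k * inj_avg m n f x = (\<Sum>b<k. inj_avg m n f x)" by simp
    also have "\<dots> = (\<Sum>b<k. (\<Sum>\<pi>\<in>?P. g \<pi> b x) / fact n)"
      using inj_avg_eq_permutation_average[OF e_in] by (intro sum.cong) (auto simp: g_def)
    also have "\<dots> = (\<Sum>\<pi>\<in>?P. \<Sum>b<k. g \<pi> b x / fact n)"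
      unfolding sum_divide_distrib by (rule sum.swap)
    finally show ?thesis by (simp add: sum_divide_distrib)
  qed
  have gm: "g \<pi> b \<in> borel_measurable (DP n)" if "\<pi> \<in> ?P" "b < k" for \<pi> b
    unfolding g_def using that inj_tuples_less[OF e_in] permutes_in_image[of \<pi> "{..<n}"]
    by (intro measurable_compose[OF measurable_select f]) auto
  have gb: "\<bar>\<Sum>b<k. g \<pi> b x\<bar> \<le> real k * C" for \<pi> x
    using sum_norm_bound[of "{..<k}" "\<lambda>b. g \<pi> b x" C] bnd by (simp add: g_def)
  have ig: "integrable (DP n) (\<lambda>x. exp (\<Sum>b<k. g \<pi> b x))" if "\<pi> \<in> ?P" for \<pi>
  proof (rule S.integrable_const_bound[where B="exp (real k * C)"])
    show "(\<lambda>x. exp (\<Sum>b<k. g \<pi> b x)) \<in> borel_measurable (DP n)"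
      using gm[OF that] by (intro measurable_compose[OF _ borel_measurable_exp] borel_measurable_sum) auto
    show "AE x in DP n. norm (exp (\<Sum>b<k. g \<pi> b x)) \<le> exp (real k * C)"
      using gb[of \<pi>] by (auto simp: abs_le_iff)
  qed
  have val: "(\<integral>x. exp (\<Sum>b<k. g \<pi> b x) \<partial>DP n) = (\<integral>x. exp (f x) \<partial>DP m) ^ k" if \<pi>: "\<pi> \<in> ?P" for \<pi>
  proof -
    have inj\<pi>: "inj \<pi>" using \<pi> permutes_inj by auto
    have "(\<integral>x. (\<Prod>b<k. exp (f (\<lambda>j\<in>{..<m}. x (\<pi> (e b j))))) \<partial>DP n) = (\<integral>x. exp (f x) \<partial>DP m) ^ k"
    proof (rule integral_disjoint_blocks)
      show "(\<lambda>x. exp (f x)) \<in> borel_measurable (DP m)" using f by simp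
      show "exp (f x) \<le> exp C" for x using bnd[of x] by simp
      show "\<pi> (e b j) < n" if "b < k" "j < m" for b j
        using inj_tuples_less[OF e_in[OF that(1)] that(2)] \<pi> permutes_in_image[of \<pi> "{..<n}"] by auto
      show "inj_on (\<lambda>j. \<pi> (e b j)) {..<m}" for b
        using inj\<pi> by (auto simp: inj_on_def e_def dest!: injD[OF inj\<pi>])
      show "disjoint_family_on (\<lambda>b. (\<lambda>j. \<pi> (e b j)) ` {..<m}) {..<k}"
      proof (clarsimp simp: disjoint_family_on_def set_eq_iff)
        fix b b' i j assume "b \<noteq> b'" "i < m" "j < m" "\<pi> (e b j) = \<pi> (e b' i)"
        then have "b * m + j = b' * m + i" using inj\<pi> by (auto simp: e_def dest: injD)
        then have "(b * m + j) div m = (b' * m + i) div m" by simp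
        then show False using \<open>i < m\<close> \<open>j < m\<close> \<open>b \<noteq> b'\<close> by simp
      qed
    qed auto
    then show ?thesis by (simp add: exp_sum g_def)
  qed
  have "(\<integral>x. exp (real k * inj_avg m n f x) \<partial>DP n)
      \<le> (\<integral>x. (\<Sum>\<pi>\<in>?P. (1 / fact n) * exp (\<Sum>b<k. g \<pi> b x)) \<partial>DP n)"
  proof (rule integral_mono)
    show "integrable (DP n) (\<lambda>x. \<Sum>\<pi>\<in>?P. 1 / fact n * exp (\<Sum>b<k. g \<pi> b x))"
      using ig by (intro Bochner_Integration.integrable_sum integrable_mult_right) auto
    \<comment> \<open>Jensen's inequality for \<open>exp\<close>, with equal weights
      \<open>1 / fact n\<close> on the permutations.\<close>
    show le: "exp (real k * inj_avg m n f x) \<le> (\<Sum>\<pi>\<in>?P. 1 / fact n * exp (\<Sum>b<k. g \<pi> b x))" for x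
      unfolding avg
      by (rule convex_on_sum[OF finP _ exp_convex])
         (auto simp: cardP permutes_id intro: exI[of _ id])
    show "integrable (DP n) (\<lambda>x. exp (real k * inj_avg m n f x))"
    proof (rule S.integrable_const_bound[where B="(\<Sum>\<pi>\<in>?P. 1 / fact n * exp (real k * C))"])
      show "(\<lambda>x. exp (real k * inj_avg m n f x)) \<in> borel_measurable (DP n)"
        using f by measurable
      show "AE x in DP n. norm (exp (real k * inj_avg m n f x)) \<le> (\<Sum>\<pi>\<in>?P. 1 / fact n * exp (real k * C))"
      proof (rule AE_I2)
        fix x
        have "(\<Sum>\<pi>\<in>?P. 1 / fact n * exp (\<Sum>b<k. g \<pi> b x)) \<le> (\<Sum>\<pi>\<in>?P. 1 / fact n * exp (real k * C))"
          using gb by (intro sum_mono mult_left_mono) (auto simp: abs_le_iff)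
        with le[of x] show "norm (exp (real k * inj_avg m n f x)) \<le> (\<Sum>\<pi>\<in>?P. 1 / fact n * exp (real k * C))"
          by simp
      qed
    qed
  qed
  also have "\<dots> = (\<Sum>\<pi>\<in>?P. (1 / fact n) * (\<integral>x. exp (\<Sum>b<k. g \<pi> b x) \<partial>DP n))"
    using ig by (subst Bochner_Integration.integral_sum) auto
  also have "\<dots> = (\<integral>x. exp (f x) \<partial>DP m) ^ k"
    using val by (simp add: cardP)
  finally show ?thesis .
qed

end

section \<open>Relative entropy of bounded densities\<close>

text \<open>The Fenchel-Young inequality for the conjugate pair \<open>x ln x - x\<close> and
  \<open>exp g\<close>, with equality at \<open>g = ln x\<close>. Both the Gibbs inequality and the
  convexity of entropy come from it.\<close>

lemma young_exp_ln:
  fixes x g :: real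
  assumes "x \<ge> 0"
  shows "x * g \<le> x * ln x - x + exp g"
proof (cases "x = 0")
  case False
  with assms have x: "x > 0" by simp
  have "1 + (g - ln x) \<le> exp (g - ln x)" by (rule exp_ge_add_one_self)
  then have "x * (1 + (g - ln x)) \<le> x * (exp g / x)"
    using x by (intro mult_left_mono) (auto simp: exp_diff)
  then show ?thesis using x by (simp add: algebra_simps)
qed simp

lemma xlnx_abs_le:
  fixes x u :: real
  assumes "0 \<le> x" "x \<le> u"
  shows "\<bar>x * ln x\<bar> \<le> 1 + u\<^sup>2"
proof -
  have "x * ln x \<ge> -1" using young_exp_ln[OF assms(1), of 0] assms(1) by simp
  moreover have "x * ln x \<le> u\<^sup>2"
  proof (cases "x = 0")
    case False
    then have "x * ln x \<le> x * x" using assms ln_le_minus_one[of x] by (intro mult_left_mono) auto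
    also have "\<dots> \<le> u\<^sup>2" using assms by (simp add: power2_eq_square mult_mono)
    finally show ?thesis .
  qed simp
  ultimately show ?thesis using zero_le_power2[of u] by linarith
qed

text \<open>Adding the Young inequalities of \<open>x\<close> and \<open>y\<close> with the common
  slope \<open>ln z\<close>, where \<open>z\<close> is the mixture, is the tangent-line proof of
  convexity; it covers the endpoint 0 without derivatives.\<close>

lemma xlnx_convex:
  fixes x y s :: real
  assumes "x \<ge> 0" "y \<ge> 0" "0 \<le> s" "s \<le> 1"
  shows "((1 - s) * x + s * y) * ln ((1 - s) * x + s * y) \<le> (1 - s) * (x * ln x) + s * (y * ln y)"
proof -
  define z where "z = (1 - s) * x + s * y"
  have z0: "z \<ge> 0" using assms by (simp add: z_def)
  show ?thesis
  proof (cases "z = 0")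
    case True
    then have "(1 - s) * x = 0" "s * y = 0"
      using assms by (auto simp: z_def add_nonneg_eq_0_iff)
    then show ?thesis using assms by auto
  next
    case False
    with z0 have z: "z > 0" by simp
    have "(1 - s) * (x * ln z) + s * (y * ln z) \<le> (1 - s) * (x * ln x - x + z) + s * (y * ln y - y + z)"
      using young_exp_ln[OF assms(1), of "ln z"] young_exp_ln[OF assms(2), of "ln z"] assms(3,4) z
      by (intro add_mono mult_left_mono) auto
    then have "z * ln z \<le> (1 - s) * (x * ln x) + s * (y * ln y)"
      by (simp add: z_def algebra_simps)
    then show ?thesis by (simp add: z_def)
  qed
qed

text \<open>Lagrange's remainder with \<open>exp 1 \<le> 3\<close>: the cubic coefficient is 3 /
  6.\<close>

lemma exp_le_cubic:
  fixes x :: real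
  assumes "\<bar>x\<bar> \<le> 1"
  shows "exp x \<le> 1 + x + x\<^sup>2 / 2 + \<bar>x\<bar> ^ 3 / 2"
proof -
  obtain t where t: "\<bar>t\<bar> \<le> \<bar>x\<bar>" "exp x = (\<Sum>k<3. x ^ k / fact k) + exp t / fact 3 * x ^ 3"
    using Maclaurin_exp_le[of x 3] by blast
  have "exp t \<le> exp 1" using t(1) assms by simp
  then have "exp t \<le> 3" using exp_le by linarith
  then have "exp t * \<bar>x\<bar> ^ 3 \<le> 3 * \<bar>x\<bar> ^ 3" by (intro mult_right_mono) auto
  moreover have "exp t * x ^ 3 \<le> exp t * \<bar>x\<bar> ^ 3"
    using abs_ge_self[of "x ^ 3"] by (intro mult_left_mono) (auto simp: power_abs)
  ultimately have "exp t * x ^ 3 \<le> 3 * \<bar>x\<bar> ^ 3" by linarith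
  moreover have "exp x = 1 + x + x\<^sup>2 / 2 + exp t * x ^ 3 / 6"
    using t(2) by (simp add: eval_nat_numeral)
  ultimately show ?thesis by linarith
qed

lemma exp_le_quadratic:
  fixes x :: real
  assumes "\<bar>x\<bar> \<le> 1"
  shows "exp x \<le> 1 + x + x\<^sup>2"
proof -
  have "\<bar>x\<bar> ^ 3 \<le> \<bar>x\<bar> ^ 2" using assms by (intro power_decreasing) auto
  then show ?thesis using exp_le_cubic[OF assms] by simp
qed

text \<open>The gap \<open>f\<close> in the third-order Taylor bound for \<open>ln (1 + y)\<close>
  has derivative \<open>y^3 / (1 + y)\<close>, of the sign of \<open>y\<close>, so \<open>f\<close>
  is least at 0. Multiplying by \<open>1 + y\<close> leaves a quartic term that the cubic one
  absorbs.\<close>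

lemma xlnx_le_cubic:
  fixes y :: real
  assumes "\<bar>y\<bar> \<le> 1 / 2"
  shows "(1 + y) * ln (1 + y) \<le> y + y\<^sup>2 / 2 + \<bar>y\<bar> ^ 3"
proof -
  define f where "f x = x - x\<^sup>2 / 2 + x ^ 3 / 3 - ln (1 + x)" for x :: real
  have d: "(f has_real_derivative x ^ 3 / (1 + x)) (at x)" if "x > -1" for x
  proof -
    have "(f has_real_derivative (1 - x + x\<^sup>2 - 1 / (1 + x))) (at x)"
      unfolding f_def using that by (auto intro!: derivative_eq_intros simp: power2_eq_square)
    moreover have "1 - x + x\<^sup>2 - 1 / (1 + x) = x ^ 3 / (1 + x)"
      using that by (simp add: field_simps power2_eq_square power3_eq_cube)
    ultimately show ?thesis by simp
  qed
  have "f y \<ge> f 0"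
  proof (cases "y \<ge> 0")
    case True
    show ?thesis
      by (rule DERIV_nonneg_imp_nondecreasing[OF True]) (use d in force)
  next
    case False
    show ?thesis
    proof (rule DERIV_nonpos_imp_nonincreasing[of y 0])
      fix x assume "y \<le> x" "x \<le> 0"
      with assms have "x > -1" by auto
      with d[of x] \<open>x \<le> 0\<close> show "\<exists>l. (f has_real_derivative l) (at x) \<and> l \<le> 0"
        by (intro exI[of _ "x ^ 3 / (1 + x)"] conjI divide_nonpos_pos) (auto simp: power_le_zero_eq)
    qed (use False in auto)
  qed
  then have "ln (1 + y) \<le> y - y\<^sup>2 / 2 + y ^ 3 / 3" by (simp add: f_def)
  then have "(1 + y) * ln (1 + y) \<le> (1 + y) * (y - y\<^sup>2 / 2 + y ^ 3 / 3)"
    using assms by (intro mult_left_mono) auto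
  also have "\<dots> = y + y\<^sup>2 / 2 - y ^ 3 / 6 + y ^ 4 / 3"
    by (simp add: field_simps power2_eq_square power3_eq_cube power4_eq_xxxx)
  also have "\<dots> \<le> y + y\<^sup>2 / 2 + \<bar>y\<bar> ^ 3"
  proof -
    have "\<bar>y\<bar> ^ 4 \<le> \<bar>y\<bar> ^ 3" using assms by (intro power_decreasing) auto
    moreover have "- (y ^ 3) \<le> \<bar>y\<bar> ^ 3" by (metis abs_ge_minus_self power_abs)
    moreover have "y ^ 4 = \<bar>y\<bar> ^ 4" by simp
    moreover have "\<bar>y\<bar> ^ 3 \<ge> 0" by simp
    ultimately show ?thesis by linarith
  qed
  finally show ?thesis .
qed

text \<open>Sign and bound hold everywhere, not just almost everywhere, so that pointwise estimates
  and integrability need no null sets.\<close>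

definition bounded_density :: "'b measure \<Rightarrow> ('b \<Rightarrow> real) \<Rightarrow> bool" where
  "bounded_density D w \<longleftrightarrow>
     w \<in> borel_measurable D \<and> (\<forall>x. 0 \<le> w x) \<and> (\<exists>u. \<forall>x. w x \<le> u) \<and> (\<integral>x. w x \<partial>D) = 1"

text \<open>The convention \<open>0 ln 0 = 0\<close> holds automatically.\<close>

definition rel_ent :: "'b measure \<Rightarrow> ('b \<Rightarrow> real) \<Rightarrow> real" where
  "rel_ent D w = (\<integral>x. w x * ln (w x) \<partial>D)"

lemma bounded_densityD:
  assumes "bounded_density D w"
  shows "w \<in> borel_measurable D" "\<And>x. 0 \<le> w x" "(\<integral>x. w x \<partial>D) = 1"
  using assms by (auto simp: bounded_density_def)

lemma bounded_density_bound:
  assumes "bounded_density D w"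
  obtains u where "\<And>x. \<bar>w x\<bar> \<le> u" "u \<ge> 1"
proof -
  obtain u where u: "\<And>x. w x \<le> u" using assms by (auto simp: bounded_density_def)
  have "\<bar>w x\<bar> \<le> max u 1" for x
    using u[of x] assms by (auto simp: bounded_density_def)
  then show ?thesis using that[of "max u 1"] by simp
qed

context prob_space
begin

lemma integrable_bounded:
  fixes f :: "'a \<Rightarrow> real"
  assumes "f \<in> borel_measurable M" "\<And>x. \<bar>f x\<bar> \<le> B"
  shows "integrable M f"
  using assms by (intro integrable_const_bound[where B=B]) auto

lemma integrable_bounded_density:
  assumes "bounded_density M w"
  shows "integrable M w"
  by (metis bounded_densityD(1) bounded_density_bound assms integrable_bounded)

lemma integrable_bounded_density_mult:
  fixes f :: "'a \<Rightarrow> real"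
  assumes "bounded_density M w" "f \<in> borel_measurable M" "\<And>x. \<bar>f x\<bar> \<le> B"
  shows "integrable M (\<lambda>x. w x * f x)"
proof -
  obtain u where u: "\<And>x. \<bar>w x\<bar> \<le> u" "u \<ge> 1" using assms(1) bounded_density_bound by blast
  have "\<bar>w x * f x\<bar> \<le> u * B" for x
    unfolding abs_mult using u assms(3) by (intro mult_mono) auto
  then show ?thesis
    using assms bounded_densityD(1)[OF assms(1)] by (intro integrable_bounded[where B="u * B"]) auto
qed

lemma integrable_rel_ent:
  assumes "bounded_density M w"
  shows "integrable M (\<lambda>x. w x * ln (w x))"
proof -
  obtain u where u: "\<And>x. \<bar>w x\<bar> \<le> u" "u \<ge> 1" using assms(1) bounded_density_bound by blast
  note [measurable] = bounded_densityD(1)[OF assms]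
  show ?thesis
    by (rule integrable_bounded[where B="1 + u\<^sup>2"], measurable)
       (intro xlnx_abs_le bounded_densityD[OF assms] abs_le_D1[OF u(1)])
qed

text \<open>Integrate \<open>young_exp_ln\<close> with \<open>x = w\<close>. The sharp
  Donsker-Varadhan form has the logarithm of the exponential moment; here stands the moment minus 1,
  which costs only a higher-order error when the moment is near 1 and a constant when it is
  bounded.\<close>

lemma gibbs:
  fixes g :: "'a \<Rightarrow> real"
  assumes w: "bounded_density M w" and g: "g \<in> borel_measurable M" "\<And>x. \<bar>g x\<bar> \<le> B"
  shows "(\<integral>x. w x * g x \<partial>M) \<le> rel_ent M w + ((\<integral>x. exp (g x) \<partial>M) - 1)"
proof -
  have ie: "integrable M (\<lambda>x. exp (g x))"
    using g by (intro integrable_bounded[where B="exp B"]) (auto simp: abs_le_iff)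
  have "(\<integral>x. w x * g x \<partial>M) \<le> (\<integral>x. w x * ln (w x) - w x + exp (g x) \<partial>M)"
    by (rule integral_mono)
       (auto intro!: integrable_bounded_density_mult[OF w g] integrable_rel_ent[OF w] ie
          integrable_bounded_density[OF w] young_exp_ln bounded_densityD(2)[OF w])
  also have "\<dots> = rel_ent M w - 1 + (\<integral>x. exp (g x) \<partial>M)"
    using integrable_rel_ent[OF w] ie integrable_bounded_density[OF w] bounded_densityD(3)[OF w]
    by (simp add: rel_ent_def)
  finally show ?thesis by simp
qed

lemma rel_ent_nonneg:
  assumes "bounded_density M w"
  shows "rel_ent M w \<ge> 0"
  using gibbs[OF assms, of "\<lambda>_. 0" 0] by (simp add: prob_space)

lemma bounded_density_mix:
  assumes w: "bounded_density M w" "bounded_density M r" and s: "0 \<le> s" "s \<le> 1"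
  shows "bounded_density M (\<lambda>x. (1 - s) * w x + s * r x)"
    and "rel_ent M (\<lambda>x. (1 - s) * w x + s * r x) \<le> (1 - s) * rel_ent M w + s * rel_ent M r"
proof -
  obtain u where u: "\<And>x. \<bar>w x\<bar> \<le> u" using w(1) bounded_density_bound by blast
  obtain v where v: "\<And>x. \<bar>r x\<bar> \<le> v" using w(2) bounded_density_bound by blast
  have "(1 - s) * w x + s * r x \<le> (1 - s) * u + s * v" for x
    using u v s by (intro add_mono mult_left_mono) (auto simp: abs_le_iff)
  then show 1: "bounded_density M (\<lambda>x. (1 - s) * w x + s * r x)"
    using w integrable_bounded_density[OF w(1)] integrable_bounded_density[OF w(2)] s
    by (auto simp: bounded_density_def)
  have "rel_ent M (\<lambda>x. (1 - s) * w x + s * r x) \<le> (\<integral>x. (1 - s) * (w x * ln (w x)) + s * (r x * ln (r x)) \<partial>M)"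
    unfolding rel_ent_def
    by (rule integral_mono)
       (use integrable_rel_ent[OF w(1)] integrable_rel_ent[OF w(2)] integrable_rel_ent[OF 1]
         in \<open>auto intro!: xlnx_convex bounded_densityD(2)[OF w(1)] bounded_densityD(2)[OF w(2)] s\<close>)
  also have "\<dots> = (1 - s) * rel_ent M w + s * rel_ent M r"
    using integrable_rel_ent[OF w(1)] integrable_rel_ent[OF w(2)] by (simp add: rel_ent_def)
  finally show "rel_ent M (\<lambda>x. (1 - s) * w x + s * r x) \<le> (1 - s) * rel_ent M w + s * rel_ent M r" .
qed

definition dist1 :: "('a \<Rightarrow> real) \<Rightarrow> ('a \<Rightarrow> real) \<Rightarrow> real" where
  "dist1 u w = (\<integral>x. \<bar>u x - w x\<bar> \<partial>M)"

lemma dist1_nonneg: "dist1 u w \<ge> 0"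
  by (simp add: dist1_def)

lemma dist1_commute: "dist1 u w = dist1 w u"
  by (simp add: dist1_def abs_minus_commute)

lemma dist1_triangle:
  assumes "integrable M u" "integrable M v" "integrable M w"
  shows "dist1 u w \<le> dist1 u v + dist1 v w"
proof -
  have "dist1 u w \<le> (\<integral>x. \<bar>u x - v x\<bar> + \<bar>v x - w x\<bar> \<partial>M)"
    unfolding dist1_def using assms by (intro integral_mono) auto
  also have "\<dots> = dist1 u v + dist1 v w"
    unfolding dist1_def using assms by (intro Bochner_Integration.integral_add) auto
  finally show ?thesis .
qed

end

section \<open>Product densities: additivity of entropy and first-order expansion\<close>

definition prod_density :: "nat \<Rightarrow> ('b \<Rightarrow> real) \<Rightarrow> (nat \<Rightarrow> 'b) \<Rightarrow> real" where
  "prod_density n w x = (\<Prod>j<n. w (x j))"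

lemma prod_density_restrict [simp]: "prod_density n w (restrict x {..<n}) = prod_density n w x"
  by (simp add: prod_density_def)

lemma prod_density_Suc: "prod_density (Suc n) w x = prod_density n w x * w (x n)"
  by (simp add: prod_density_def)

lemma prod_density_one [simp]: "prod_density n (\<lambda>_. 1) x = 1"
  by (simp add: prod_density_def)

context sample_law
begin

lemma measurable_prod_density [measurable]:
  assumes [measurable]: "w \<in> borel_measurable D"
  shows "prod_density n w \<in> borel_measurable (DP n)"
  unfolding prod_density_def by measurable

lemma bounded_density_one: "bounded_density D (\<lambda>_. 1)"
  by (auto simp: bounded_density_def prob_space)

lemma integral_prod:
  assumes "\<And>i. i < n \<Longrightarrow> f i \<in> borel_measurable D" "\<And>i x. i < n \<Longrightarrow> \<bar>f i x\<bar> \<le> (B i :: real)"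
  shows "(\<integral>x. (\<Prod>i<n. f i (x i)) \<partial>DP n) = (\<Prod>i<n. \<integral>x. f i x \<partial>D)"
  using assms by (intro P.product_integral_prod) (auto intro: integrable_bounded)

lemma bounded_density_prod:
  assumes w: "bounded_density D w"
  shows "bounded_density (DP n) (prod_density n w)"
  unfolding bounded_density_def
proof (intro conjI allI)
  obtain u where u: "\<And>x. \<bar>w x\<bar> \<le> u" using w bounded_density_bound by blast
  note [measurable] = bounded_densityD(1)[OF w]
  show "prod_density n w \<in> borel_measurable (DP n)" by measurable
  show "0 \<le> prod_density n w x" for x
    using bounded_densityD(2)[OF w] by (auto simp: prod_density_def intro: prod_nonneg)
  show "(\<integral>x. prod_density n w x \<partial>DP n) = 1"
    unfolding prod_density_def using integral_prod[of n "\<lambda>_. w" "\<lambda>_. u"] u bounded_densityD[OF w] by simp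
  have "prod_density n w x \<le> (\<Prod>j<n. u)" for x
    unfolding prod_density_def using bounded_densityD(2)[OF w] u
    by (intro prod_mono) (auto simp: abs_le_iff)
  then show "\<exists>u. \<forall>x. prod_density n w x \<le> u" by blast
qed

lemma rel_ent_prod:
  assumes w: "bounded_density D w"
  shows "rel_ent (DP n) (prod_density n w) = real n * rel_ent D w"
proof -
  obtain u where u: "\<And>x. \<bar>w x\<bar> \<le> u" "u \<ge> 1" using w bounded_density_bound by blast
  note [measurable] = bounded_densityD(1)[OF w]
  \<comment> \<open>The logarithm of the product is a sum over coordinates \<open>i\<close>, and the
    factor \<open>ln (w (x i))\<close> joins the factor with index \<open>i\<close>; so every
    summand is again a product over coordinates.\<close>
  define f where "f i j = (if j = i then (\<lambda>y. w y * ln (w y)) else w)" for i j :: nat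
  have f_meas: "f i j \<in> borel_measurable D" for i j
    by (simp add: f_def)
  have f_bound: "\<bar>f i j y\<bar> \<le> (if j = i then 1 + u\<^sup>2 else u)" for i j y
    using u(1)[of y] xlnx_abs_le[of "w y" u] bounded_densityD(2)[OF w] by (auto simp: f_def)
  have eq: "prod_density n w x * ln (prod_density n w x) = (\<Sum>i<n. \<Prod>j<n. f i j (x j))" for x
  proof (cases "prod_density n w x = 0")
    case True
    then obtain l where l: "l < n" "w (x l) = 0" by (auto simp: prod_density_def prod_zero_iff)
    have "(\<Prod>j<n. f i j (x j)) = 0" for i
      using l by (intro prod_zero) (auto simp: f_def intro!: bexI[of _ l])
    then have "(\<Sum>i<n. \<Prod>j<n. f i j (x j)) = 0" by (intro sum.neutral) auto
    then show ?thesis using True by simp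
  next
    case False
    then have nz: "w (x l) > 0" if "l < n" for l
      using that bounded_densityD(2)[OF w, of "x l"] by (auto simp: prod_density_def prod_zero_iff less_le)
    have "ln (prod_density n w x) = (\<Sum>i<n. ln (w (x i)))"
      unfolding prod_density_def using nz by (intro ln_prod) (auto dest: nz)
    then have "prod_density n w x * ln (prod_density n w x) = (\<Sum>i<n. prod_density n w x * ln (w (x i)))"
      by (simp add: sum_distrib_left)
    also have "\<dots> = (\<Sum>i<n. \<Prod>j<n. f i j (x j))"
    proof (rule sum.cong[OF refl])
      fix i assume i: "i \<in> {..<n}"
      have "(\<Prod>j\<in>{..<n} - {i}. f i j (x j)) = (\<Prod>j\<in>{..<n} - {i}. w (x j))"
        by (intro prod.cong) (auto simp: f_def)
      then show "prod_density n w x * ln (w (x i)) = (\<Prod>j<n. f i j (x j))"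
        using i by (simp add: prod_density_def prod.remove[OF _ i] f_def)
    qed
    finally show ?thesis .
  qed
  have "rel_ent (DP n) (prod_density n w) = (\<Sum>i<n. \<integral>x. (\<Prod>j<n. f i j (x j)) \<partial>DP n)"
    unfolding rel_ent_def eq using f_meas f_bound
    by (intro Bochner_Integration.integral_sum P.product_integrable_prod integrable_bounded) auto
  also have "\<dots> = (\<Sum>i<n. \<Prod>j<n. \<integral>y. f i j y \<partial>D)"
    using integral_prod[OF f_meas f_bound] by simp
  also have "\<dots> = (\<Sum>i<n. rel_ent D w)"
  proof (rule sum.cong[OF refl])
    fix i assume i: "i \<in> {..<n}"
    have "(\<Prod>j\<in>{..<n} - {i}. \<integral>y. f i j y \<partial>D) = 1"
      using bounded_densityD(3)[OF w] by (intro prod.neutral) (auto simp: f_def)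
    then show "(\<Prod>j<n. \<integral>y. f i j y \<partial>D) = rel_ent D w"
      using i by (simp add: prod.remove[OF _ i] f_def rel_ent_def)
  qed
  finally show ?thesis by simp
qed

text \<open>Fubini with the last coordinate split off, which drives the two inductions below;
  \<open>restrict\<close> turns a function on \<open>DP n\<close> into one on
  \<open>DP (Suc n)\<close>.\<close>

lemma integral_Suc:
  fixes f :: "(nat \<Rightarrow> 'b) \<Rightarrow> real" and g :: "'b \<Rightarrow> real"
  assumes [measurable]: "f \<in> borel_measurable (DP n)" "g \<in> borel_measurable D"
    and "\<And>x. \<bar>f x\<bar> \<le> B" "\<And>x. \<bar>g x\<bar> \<le> C"
  shows "(\<integral>x. f (restrict x {..<n}) * g (x n) \<partial>DP (Suc n)) = (\<integral>x. f x \<partial>DP n) * (\<integral>x. g x \<partial>D)"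
    and "integrable (DP (Suc n)) (\<lambda>x. f (restrict x {..<n}) * g (x n))"
proof -
  interpret S: prob_space "DP (Suc n)" by (rule prob_space_DP)
  have ins: "{..<Suc n} = insert n {..<n}" by auto
  have "\<bar>f (restrict x {..<n}) * g (x n)\<bar> \<le> B * C" for x
    unfolding abs_mult using assms(3,4) order_trans[OF abs_ge_zero assms(3)] by (intro mult_mono) auto
  moreover have "(\<lambda>x. f (restrict x {..<n}) * g (x n)) \<in> borel_measurable (DP (Suc n))"
  proof (rule borel_measurable_times)
    show "(\<lambda>x. f (restrict x {..<n})) \<in> borel_measurable (DP (Suc n))"
      by (rule measurable_compose[OF measurable_restrict_subset assms(1)]) auto
    show "(\<lambda>x. g (x n)) \<in> borel_measurable (DP (Suc n))"
      by (rule measurable_compose[OF measurable_component_singleton[of n "{..<Suc n}" "\<lambda>_. D"] assms(2)]) auto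
  qed
  ultimately show int: "integrable (DP (Suc n)) (\<lambda>x. f (restrict x {..<n}) * g (x n))"
    by (rule S.integrable_bounded[rotated])
  have "(\<integral>x. f (restrict x {..<n}) * g (x n) \<partial>DP (Suc n))
      = (\<integral>x. (\<integral>y. f (restrict (x(n := y)) {..<n}) * g y \<partial>D) \<partial>DP n)"
    using P.product_integral_insert[of "{..<n}" n "\<lambda>x. f (restrict x {..<n}) * g (x n)"] int
    unfolding ins by (simp del: integral_mult_left_zero integral_mult_right_zero restrict_fupd restrict_upd)
  also have "\<dots> = (\<integral>x. f x * (\<integral>y. g y \<partial>D) \<partial>DP n)"
  proof (rule Bochner_Integration.integral_cong[OF refl])
    fix x assume "x \<in> space (DP n)"
    then have "restrict (x(n := y)) {..<n} = x" for y
      by (auto simp: space_PiM PiE_def extensional_def fun_eq_iff)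
    then show "(\<integral>y. f (restrict (x(n := y)) {..<n}) * g y \<partial>D) = f x * (\<integral>y. g y \<partial>D)" by simp
  qed
  finally show "(\<integral>x. f (restrict x {..<n}) * g (x n) \<partial>DP (Suc n)) = (\<integral>x. f x \<partial>DP n) * (\<integral>x. g x \<partial>D)"
    by simp
qed

text \<open>Telescoping: exchanging one factor at a time costs \<open>dist1 u w\<close>, since the
  remaining factors integrate to 1.\<close>

lemma prod_density_dist:
  assumes u: "bounded_density D u" and w: "bounded_density D w"
  shows "(\<integral>x. \<bar>prod_density n u x - prod_density n w x\<bar> \<partial>DP n) \<le> real n * dist1 u w"
proof (induction n)
  case 0
  show ?case by (simp add: prod_density_def)
next
  case (Suc n)
  note [measurable] = bounded_densityD(1)[OF u] bounded_densityD(1)[OF w]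
  obtain bu where bu: "\<And>x. \<bar>u x\<bar> \<le> bu" using u bounded_density_bound by blast
  obtain bw where bw: "\<And>x. \<bar>w x\<bar> \<le> bw" using w bounded_density_bound by blast
  interpret S: prob_space "DP n" by (rule prob_space_DP)
  obtain pu where pu: "\<And>x. \<bar>prod_density n u x\<bar> \<le> pu"
    using bounded_density_prod[OF u, of n] S.integrable_bounded bounded_density_bound by blast
  obtain pw where pw: "\<And>x. \<bar>prod_density n w x\<bar> \<le> pw"
    using bounded_density_prod[OF w, of n] bounded_density_bound by blast
  have b1: "\<bar>\<bar>u x - w x\<bar>\<bar> \<le> bu + bw" for x using bu[of x] bw[of x] by linarith
  have b2: "\<bar>\<bar>prod_density n u x - prod_density n w x\<bar>\<bar> \<le> pu + pw" for x using pu[of x] pw[of x] by linarith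
  note A = integral_Suc[of "prod_density n u" n "\<lambda>x. \<bar>u x - w x\<bar>", OF _ _ pu b1]
  note B = integral_Suc[of "\<lambda>x. \<bar>prod_density n u x - prod_density n w x\<bar>" n w, OF _ _ b2 bw]
  have "(\<integral>x. \<bar>prod_density (Suc n) u x - prod_density (Suc n) w x\<bar> \<partial>DP (Suc n))
     \<le> (\<integral>x. prod_density n u x * \<bar>u (x n) - w (x n)\<bar>
           + \<bar>prod_density n u x - prod_density n w x\<bar> * w (x n) \<partial>DP (Suc n))"
  proof (rule integral_mono')
    show "integrable (DP (Suc n)) (\<lambda>x. prod_density n u x * \<bar>u (x n) - w (x n)\<bar>
           + \<bar>prod_density n u x - prod_density n w x\<bar> * w (x n))"
      using A(2) B(2) by (intro Bochner_Integration.integrable_add) auto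
    fix x
    have "prod_density (Suc n) u x - prod_density (Suc n) w x
       = prod_density n u x * (u (x n) - w (x n)) + (prod_density n u x - prod_density n w x) * w (x n)"
      by (simp add: prod_density_Suc algebra_simps)
    then show "\<bar>prod_density (Suc n) u x - prod_density (Suc n) w x\<bar> \<le> prod_density n u x * \<bar>u (x n) - w (x n)\<bar>
           + \<bar>prod_density n u x - prod_density n w x\<bar> * w (x n)"
      using abs_triangle_ineq[of "prod_density n u x * (u (x n) - w (x n))"
            "(prod_density n u x - prod_density n w x) * w (x n)"]
        bounded_densityD(2)[OF w, of "x n"] bounded_densityD(2)[OF bounded_density_prod[OF u], of n x]
      by (simp only: abs_mult abs_of_nonneg)
  qed (auto intro!: add_nonneg_nonneg mult_nonneg_nonneg bounded_densityD(2)[OF w]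
         bounded_densityD(2)[OF bounded_density_prod[OF u]])
  also have "\<dots> = dist1 u w + (\<integral>x. \<bar>prod_density n u x - prod_density n w x\<bar> \<partial>DP n)"
    using A B bounded_densityD(3)[OF w] bounded_densityD(3)[OF bounded_density_prod[OF u]]
    by (subst Bochner_Integration.integral_add) (auto simp: dist1_def)
  finally show ?case using Suc.IH by (simp add: algebra_simps)
qed

text \<open>First-order expansion around the constant density. The remainder keeps the factor
  \<open>dist1 u w\<close>, not just squared distances to 1; this makes the increment of the mean
  linear in a small mixing parameter.\<close>

lemma prod_density_expansion:
  assumes u: "bounded_density D u" and w: "bounded_density D w"
  shows "(\<integral>x. \<bar>prod_density n u x - prod_density n w x - (\<Sum>j<n. u (x j) - w (x j))\<bar> \<partial>DP n)
    \<le> (real n)\<^sup>2 * (dist1 u w * (dist1 u (\<lambda>_. 1) + dist1 w (\<lambda>_. 1)))"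
proof (induction n)
  case 0
  show ?case by (simp add: prod_density_def)
next
  case (Suc n)
  note [measurable] = bounded_densityD(1)[OF u] bounded_densityD(1)[OF w]
  obtain bu where bu: "\<And>x. \<bar>u x\<bar> \<le> bu" using u bounded_density_bound by blast
  obtain bw where bw: "\<And>x. \<bar>w x\<bar> \<le> bw" using w bounded_density_bound by blast
  obtain pu where pu: "\<And>x. \<bar>prod_density n u x\<bar> \<le> pu"
    using bounded_density_prod[OF u, of n] bounded_density_bound by blast
  obtain pw where pw: "\<And>x. \<bar>prod_density n w x\<bar> \<le> pw"
    using bounded_density_prod[OF w, of n] bounded_density_bound by blast
  let ?R = "\<lambda>x. \<bar>prod_density n u x - prod_density n w x - (\<Sum>j<n. u (x j) - w (x j))\<bar>"
  have b1: "\<bar>\<bar>u x - w x\<bar>\<bar> \<le> bu + bw" "\<bar>\<bar>u x - 1\<bar>\<bar> \<le> bu + 1" for x using bu[of x] bw[of x] by linarith+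
  have b2: "\<bar>\<bar>prod_density n u x - prod_density n w x\<bar>\<bar> \<le> pu + pw" "\<bar>\<bar>prod_density n w x - 1\<bar>\<bar> \<le> pw + 1" for x
    using pu[of x] pw[of x] by linarith+
  have b4: "\<bar>\<Sum>j<n. u (x j) - w (x j)\<bar> \<le> real n * (bu + bw)" for x :: "nat \<Rightarrow> 'b"
    using sum_norm_bound[of "{..<n}" "\<lambda>j. u (x j) - w (x j)" "bu + bw"] b1(1) by simp
  have b3: "\<bar>?R x\<bar> \<le> pu + pw + real n * (bu + bw)" for x
    using b4[of x] pu[of x] pw[of x] by linarith
  have one: "\<bar>1::real\<bar> \<le> 1" by simp
  note A = integral_Suc[of ?R n "\<lambda>_. 1", OF _ _ b3 one]
  note B = integral_Suc[of "\<lambda>x. \<bar>prod_density n u x - prod_density n w x\<bar>" n "\<lambda>x. \<bar>u x - 1\<bar>", OF _ _ b2(1) b1(2)]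
  note C = integral_Suc[of "\<lambda>x. \<bar>prod_density n w x - 1\<bar>" n "\<lambda>x. \<bar>u x - w x\<bar>", OF _ _ b2(2) b1(1)]
  let ?S = "\<lambda>x. ?R x + \<bar>prod_density n u x - prod_density n w x\<bar> * \<bar>u (x n) - 1\<bar>
                  + \<bar>prod_density n w x - 1\<bar> * \<bar>u (x n) - w (x n)\<bar>"
  have iA: "integrable (DP (Suc n)) ?R" and eA: "(\<integral>x. ?R x \<partial>DP (Suc n)) = (\<integral>x. ?R x \<partial>DP n)"
    using A by (simp_all add: prob_space)
  have iB: "integrable (DP (Suc n)) (\<lambda>x. \<bar>prod_density n u x - prod_density n w x\<bar> * \<bar>u (x n) - 1\<bar>)"
    and eB: "(\<integral>x. \<bar>prod_density n u x - prod_density n w x\<bar> * \<bar>u (x n) - 1\<bar> \<partial>DP (Suc n))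
        = (\<integral>x. \<bar>prod_density n u x - prod_density n w x\<bar> \<partial>DP n) * dist1 u (\<lambda>_. 1)"
    using B by (simp_all add: dist1_def)
  have iC: "integrable (DP (Suc n)) (\<lambda>x. \<bar>prod_density n w x - 1\<bar> * \<bar>u (x n) - w (x n)\<bar>)"
    and eC: "(\<integral>x. \<bar>prod_density n w x - 1\<bar> * \<bar>u (x n) - w (x n)\<bar> \<partial>DP (Suc n))
        = (\<integral>x. \<bar>prod_density n w x - 1\<bar> \<partial>DP n) * dist1 u w"
    using C by (simp_all add: dist1_def)
  have "(\<integral>x. \<bar>prod_density (Suc n) u x - prod_density (Suc n) w x - (\<Sum>j<Suc n. u (x j) - w (x j))\<bar> \<partial>DP (Suc n))
     \<le> (\<integral>x. ?S x \<partial>DP (Suc n))"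
  proof (rule integral_mono')
    show "integrable (DP (Suc n)) ?S"
      using iA iB iC by (intro Bochner_Integration.integrable_add) auto
    fix x
    \<comment> \<open>Besides the inductive remainder there are only products of two small factors
      in disjoint coordinates.\<close>
    have "prod_density (Suc n) u x - prod_density (Suc n) w x - (\<Sum>j<Suc n. u (x j) - w (x j))
       = (prod_density n u x - prod_density n w x - (\<Sum>j<n. u (x j) - w (x j)))
         + (prod_density n u x - prod_density n w x) * (u (x n) - 1)
         + (prod_density n w x - 1) * (u (x n) - w (x n))"
      by (simp add: prod_density_Suc algebra_simps)
    then show "\<bar>prod_density (Suc n) u x - prod_density (Suc n) w x - (\<Sum>j<Suc n. u (x j) - w (x j))\<bar> \<le> ?S x"
      unfolding abs_mult[symmetric] by linarith
  qed simp
  also have "\<dots> = (\<integral>x. ?R x \<partial>DP n) + (\<integral>x. \<bar>prod_density n u x - prod_density n w x\<bar> \<partial>DP n) * dist1 u (\<lambda>_. 1)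
      + (\<integral>x. \<bar>prod_density n w x - 1\<bar> \<partial>DP n) * dist1 u w"
    using iA iB iC by (simp add: eA eB eC)
  also have "\<dots> \<le> (real n)\<^sup>2 * (dist1 u w * (dist1 u (\<lambda>_. 1) + dist1 w (\<lambda>_. 1)))
      + (real n * dist1 u w) * dist1 u (\<lambda>_. 1) + (real n * dist1 w (\<lambda>_. 1)) * dist1 u w"
    using Suc.IH prod_density_dist[OF u w, of n] prod_density_dist[OF w bounded_density_one, of n]
    by (intro add_mono mult_right_mono) (auto simp: dist1_nonneg)
  also have "\<dots> = ((real n)\<^sup>2 + real n) * (dist1 u w * (dist1 u (\<lambda>_. 1) + dist1 w (\<lambda>_. 1)))"
    by (simp add: algebra_simps)
  also have "\<dots> \<le> (real (Suc n))\<^sup>2 * (dist1 u w * (dist1 u (\<lambda>_. 1) + dist1 w (\<lambda>_. 1)))"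
    by (intro mult_right_mono mult_nonneg_nonneg add_nonneg_nonneg dist1_nonneg) (simp add: power2_eq_square algebra_simps)
  finally show ?case .
qed

text \<open>A form of Pinsker's inequality, with 4 in place of the optimal 2, from testing
  \<open>gibbs\<close> with a multiple of the sign of \<open>w - 1\<close>. The constant enters
  error terms only.\<close>

lemma dist1_rel_ent:
  assumes w: "bounded_density D w"
  shows "(dist1 w (\<lambda>_. 1))\<^sup>2 \<le> 4 * rel_ent D w"
proof -
  note [measurable] = bounded_densityD(1)[OF w]
  define t where "t = dist1 w (\<lambda>_. 1)"
  have iw: "integrable D w" by (rule integrable_bounded_density[OF w])
  have t0: "0 \<le> t" by (simp add: t_def dist1_nonneg)
  have "t \<le> dist1 w (\<lambda>_. 0) + dist1 (\<lambda>_. 0) (\<lambda>_. 1)"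
    unfolding t_def using iw by (intro dist1_triangle) auto
  also have "\<dots> = 2" using bounded_densityD[OF w] by (simp add: dist1_def prob_space)
  finally have t2: "t \<le> 2" .
  \<comment> \<open>The multiplier \<open>t / 2\<close> maximises \<open>l * t - l^2\<close> over
    \<open>l\<close>; as \<open>t \<le> 2\<close>, it stays within the range of
    \<open>exp_le_quadratic\<close>.\<close>
  define g where "g x = (t / 2) * sgn (w x - 1)" for x
  have g_le: "\<bar>g x\<bar> \<le> t / 2" for x using t0 by (auto simp: g_def sgn_if)
  have [measurable]: "g \<in> borel_measurable D" unfolding g_def by measurable
  have ig: "integrable D g" by (rule integrable_bounded[OF _ g_le]) measurable
  have iwg: "integrable D (\<lambda>x. w x * g x)" by (rule integrable_bounded_density_mult[OF w _ g_le]) measurable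
  have ie: "integrable D (\<lambda>x. exp (g x))"
    using abs_le_D1[OF g_le] by (intro integrable_bounded[where B="exp (t/2)"]) auto
  have "(\<integral>x. exp (g x) \<partial>D) \<le> (\<integral>x. 1 + g x + (t / 2)\<^sup>2 \<partial>D)"
  proof (rule integral_mono[OF ie])
    show "integrable D (\<lambda>x. 1 + g x + (t / 2)\<^sup>2)" using ig by simp
    fix x
    have "exp (g x) \<le> 1 + g x + (g x)\<^sup>2" using g_le[of x] t2 by (intro exp_le_quadratic) auto
    moreover have "(g x)\<^sup>2 \<le> (t/2)\<^sup>2" using g_le[of x] by (simp add: abs_le_square_iff[symmetric])
    ultimately show "exp (g x) \<le> 1 + g x + (t / 2)\<^sup>2" by simp
  qed
  also have "\<dots> = 1 + (\<integral>x. g x \<partial>D) + (t/2)\<^sup>2" using ig by (simp add: prob_space)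
  finally have "(\<integral>x. w x * g x \<partial>D) \<le> rel_ent D w + ((\<integral>x. g x \<partial>D) + (t/2)\<^sup>2)"
    using gibbs[of w g "t / 2"] w g_le by simp
  moreover have "(\<integral>x. w x * g x \<partial>D) - (\<integral>x. g x \<partial>D) = (\<integral>x. (t / 2) * \<bar>w x - 1\<bar> \<partial>D)"
  proof -
    have eq: "w x * g x - g x = (t / 2) * \<bar>w x - 1\<bar>" for x
      by (auto simp: g_def sgn_if algebra_simps abs_if)
    show ?thesis using Bochner_Integration.integral_diff[OF iwg ig, symmetric] unfolding eq .
  qed
  moreover have "(\<integral>x. (t / 2) * \<bar>w x - 1\<bar> \<partial>D) = t / 2 * t" by (simp add: t_def dist1_def)
  ultimately have "t / 2 * t \<le> rel_ent D w + (t / 2)\<^sup>2" by linarith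
  then show ?thesis by (simp add: t_def[symmetric] power2_eq_square)
qed

section \<open>Tilting and the lower bound\<close>

abbreviation tilt :: "('b \<Rightarrow> real) \<Rightarrow> 'b measure" where
  "tilt w \<equiv> density D (\<lambda>x. ennreal (w x))"

lemma tilt_sample_law:
  assumes w: "bounded_density D w"
  shows "sample_law (tilt w)"
proof -
  note [measurable] = bounded_densityD(1)[OF w]
  have "(\<integral>\<^sup>+x. ennreal (w x) \<partial>D) = ennreal 1"
    using nn_integral_eq_integral[OF integrable_bounded_density[OF w]] bounded_densityD[OF w] by simp
  then have "emeasure (tilt w) (space (tilt w)) = 1"
    by (subst emeasure_density) (auto cong: nn_integral_cong)
  then show ?thesis by (simp add: sample_law_def prob_spaceI)
qed

lemma PiM_tilt:
  assumes w: "bounded_density D w"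
  shows "PiM {..<n} (\<lambda>_. tilt w) = density (DP n) (\<lambda>x. ennreal (prod_density n w x))"
proof -
  note [measurable] = bounded_densityD(1)[OF w]
  interpret Q: sample_law "tilt w" by (rule tilt_sample_law[OF w])
  show ?thesis
  proof (rule Q.P.PiM_eqI[symmetric])
    have "sets (PiM {..<n} (\<lambda>_. tilt w)) = sets (DP n)" by (intro sets_PiM_cong) auto
    then show "sets (density (DP n) (\<lambda>x. ennreal (prod_density n w x))) = sets (PiM {..<n} (\<lambda>_. tilt w))"
      by simp
    fix A :: "nat \<Rightarrow> 'b set" assume A: "\<And>i. i \<in> {..<n} \<Longrightarrow> A i \<in> sets (tilt w)"
    then have A': "\<And>i. i < n \<Longrightarrow> A i \<in> sets D" by simp
    have "emeasure (density (DP n) (\<lambda>x. ennreal (prod_density n w x))) (Pi\<^sub>E {..<n} A)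
        = (\<integral>\<^sup>+x. ennreal (prod_density n w x) * indicator (Pi\<^sub>E {..<n} A) x \<partial>DP n)"
      using A' by (intro emeasure_density sets_PiM_I_finite) auto
    also have "\<dots> = (\<integral>\<^sup>+x. (\<Prod>i<n. ennreal (w (x i)) * indicator (A i) (x i)) \<partial>DP n)"
    proof (rule nn_integral_cong)
      fix x assume x: "x \<in> space (DP n)"
      have "(indicator (Pi\<^sub>E {..<n} A) x :: ennreal) = (\<Prod>i<n. indicator (A i) (x i))"
        using x by (auto simp: indicator_def space_PiM PiE_iff prod_zero_iff)
      then show "ennreal (prod_density n w x) * indicator (Pi\<^sub>E {..<n} A) x
          = (\<Prod>i<n. ennreal (w (x i)) * indicator (A i) (x i))"
        using bounded_densityD(2)[OF w] by (simp add: prod_density_def prod.distrib prod_ennreal)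
    qed
    also have "\<dots> = (\<Prod>i<n. \<integral>\<^sup>+x. ennreal (w x) * indicator (A i) x \<partial>D)"
      using A' by (intro P.product_nn_integral_prod) auto
    also have "\<dots> = (\<Prod>i<n. emeasure (tilt w) (A i))"
      using A' by (intro prod.cong refl emeasure_density[symmetric]) auto
    finally show "emeasure (density (DP n) (\<lambda>x. ennreal (prod_density n w x))) (Pi\<^sub>E {..<n} A)
        = (\<Prod>i<n. emeasure (tilt w) (A i))" .
  qed simp
qed

lemma markov_exp:
  fixes g :: "(nat \<Rightarrow> 'b) \<Rightarrow> real"
  assumes [measurable]: "g \<in> borel_measurable (DP n)" and "integrable (DP n) (\<lambda>x. exp (g x))"
  shows "measure (DP n) {x \<in> space (DP n). g x \<ge> c} \<le> exp (- c) * (\<integral>x. exp (g x) \<partial>DP n)"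
proof -
  interpret S: prob_space "DP n" by (rule prob_space_DP)
  have "measure (DP n) {x \<in> space (DP n). exp (g x) \<ge> exp c} \<le> (\<integral>x. exp (g x) \<partial>DP n) / exp c"
    using assms by (intro integral_Markov_inequality_measure[where A="{}"]) auto
  then show ?thesis by (simp add: exp_minus field_simps)
qed

lemma inj_avg_bound:
  fixes f :: "(nat \<Rightarrow> 'b) \<Rightarrow> real"
  assumes "\<And>x. \<bar>f x\<bar> \<le> B"
  shows "\<bar>inj_avg m n f x\<bar> \<le> B"
proof (cases "inj_tuples m n = {}")
  \<comment> \<open>Without injective tuples the average is \<open>0 / 0 = 0\<close>, and
    \<open>B\<close> is nonnegative.\<close>
  case True
  then show ?thesis using order_trans[OF abs_ge_zero assms] by (simp add: inj_avg_def)
next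
  case False
  then have c: "real (card (inj_tuples m n)) > 0" by (simp add: card_gt_0_iff)
  have "\<bar>\<Sum>i\<in>inj_tuples m n. f (\<lambda>j\<in>{..<m}. x (i j))\<bar> \<le> real (card (inj_tuples m n)) * B"
    using sum_norm_bound[of "inj_tuples m n" "\<lambda>i. f (\<lambda>j\<in>{..<m}. x (i j))" B] assms by simp
  then show ?thesis using c by (simp add: inj_avg_def field_simps)
qed

text \<open>Chernoff's bound through \<open>inj_avg_mgf\<close>. The exponent is the number of
  blocks, at most \<open>n / m\<close>, so the rate is not sharp; it serves where some exponential
  decay, or an arbitrarily fast one, is wanted.\<close>

lemma inj_avg_tail:
  fixes f :: "(nat \<Rightarrow> 'b) \<Rightarrow> real"
  assumes f[measurable]: "f \<in> borel_measurable (DP m)" and bnd: "\<And>x. \<bar>f x\<bar> \<le> B"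
    and m: "m \<ge> 1" and k: "k * m \<le> n" "k \<ge> 1" and lam: "r \<ge> 0"
  shows "avg_tail m f n c
      \<le> (exp (- (r * c)) * (\<integral>x. exp (r * f x) \<partial>DP m)) ^ k"
proof -
  interpret S: prob_space "DP n" by (rule prob_space_DP)
  let ?g = "\<lambda>x. real k * inj_avg m n (\<lambda>x. r * f x) x"
  have g_eq: "inj_avg m n (\<lambda>x. r * f x) x = r * inj_avg m n f x" for x
    by (simp add: inj_avg_def sum_distrib_left)
  have b2: "\<bar>r * f x\<bar> \<le> r * B" for x using bnd lam by (simp add: abs_mult mult_left_mono)
  have fm: "(\<lambda>x. r * f x) \<in> borel_measurable (DP m)" by measurable
  have "avg_tail m f n c
     \<le> measure (DP n) {x \<in> space (DP n). ?g x \<ge> real k * (r * c)}"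
    using lam by (intro S.finite_measure_mono) (auto simp: g_eq mult_left_mono)
  also have "\<dots> \<le> exp (- (real k * (r * c))) * (\<integral>x. exp (?g x) \<partial>DP n)"
  proof (rule markov_exp)
    show "?g \<in> borel_measurable (DP n)" by measurable
    have "?g x \<le> real k * (r * B)" for x
      using abs_le_D1[OF inj_avg_bound[OF b2]] by (intro mult_left_mono) auto
    then show "integrable (DP n) (\<lambda>x. exp (?g x))"
      by (intro S.integrable_bounded[where B="exp (real k * (r * B))"]) auto
  qed
  also have "\<dots> \<le> exp (- (real k * (r * c))) * (\<integral>x. exp (r * f x) \<partial>DP m) ^ k"
    by (intro mult_left_mono inj_avg_mgf[OF fm b2 m k]) auto
  also have "\<dots> = (exp (- (r * c)) * (\<integral>x. exp (r * f x) \<partial>DP m)) ^ k"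
    by (simp add: power_mult_distrib exp_of_nat_mult[symmetric] algebra_simps)
  finally show ?thesis .
qed

text \<open>The law of large numbers for U-statistics, with an exponential rate:
  \<open>inj_avg_tail\<close> applied to \<open>\<mu> - f\<close>. It is applied to the tilted law,
  under which the constraint holds with a margin.\<close>

lemma inj_avg_lln:
  fixes f :: "(nat \<Rightarrow> 'b) \<Rightarrow> real"
  assumes f[measurable]: "f \<in> borel_measurable (DP m)" and bnd: "\<And>x. \<bar>f x\<bar> \<le> 1"
    and m: "m \<ge> 1" and a: "a < (\<integral>x. f x \<partial>DP m)"
  shows "(\<lambda>n. avg_tail m f n a) \<longlonglongrightarrow> 1"
proof -
  interpret S: prob_space "DP m" by (rule prob_space_DP)
  define \<mu> where "\<mu> = (\<integral>x. f x \<partial>DP m)"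
  have i_f: "integrable (DP m) f" by (rule S.integrable_bounded[OF f bnd])
  have mu: "\<bar>\<mu>\<bar> \<le> 1"
    using S.integral_le_const[OF i_f, of 1] S.integral_ge_const[OF i_f, of "-1"] bnd
    by (auto simp: \<mu>_def abs_le_iff minus_le_iff)
  define \<eta> where "\<eta> = min 1 (\<mu> - a)"
  have \<eta>: "\<eta> > 0" "\<eta> \<le> 1" "\<eta> \<le> \<mu> - a" using a by (auto simp: \<eta>_def \<mu>_def)
  \<comment> \<open>With \<open>l = \<eta> / 8\<close> the exponent
    \<open>4 * l^2 - l * \<eta>\<close> is \<open>- \<eta>^2 / 16\<close>; the cap
    \<open>\<eta> \<le> 1\<close> keeps \<open>l * (\<mu> - f)\<close> in the range of
    \<open>exp_le_quadratic\<close>.\<close>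
  define l where "l = \<eta> / 8"
  have l: "l > 0" "2 * l \<le> 1" using \<eta> by (auto simp: l_def)
  let ?g = "\<lambda>x. \<mu> - f x"
  have gb: "\<bar>?g x\<bar> \<le> 2" for x using mu bnd[of x] by linarith
  have ig: "integrable (DP m) ?g" using i_f by simp
  have mgf: "(\<integral>x. exp (l * ?g x) \<partial>DP m) \<le> exp (4 * l\<^sup>2)"
  proof -
    have lg: "\<bar>l * ?g x\<bar> \<le> l * 2" for x using gb[of x] l by (simp add: abs_mult)
    have "(\<integral>x. exp (l * ?g x) \<partial>DP m) \<le> (\<integral>x. 1 + l * ?g x + 4 * l\<^sup>2 \<partial>DP m)"
    proof (rule integral_mono)
      show "integrable (DP m) (\<lambda>x. exp (l * ?g x))"
        using abs_le_D1[OF lg] by (intro S.integrable_bounded[where B="exp (l * 2)"]) auto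
      show "integrable (DP m) (\<lambda>x. 1 + l * ?g x + 4 * l\<^sup>2)" using ig by simp
      fix x
      have "(l * ?g x)\<^sup>2 \<le> (l * 2)\<^sup>2" using lg[of x] l by (intro abs_le_square_iff[THEN iffD1]) auto
      also have "\<dots> = 4 * l\<^sup>2" by (simp add: power_mult_distrib)
      finally show "exp (l * ?g x) \<le> 1 + l * ?g x + 4 * l\<^sup>2"
        using exp_le_quadratic[of "l * ?g x"] lg[of x] l by linarith
    qed
    also have "\<dots> = 1 + 4 * l\<^sup>2" using i_f by (simp add: S.prob_space \<mu>_def)
    also have "\<dots> \<le> exp (4 * l\<^sup>2)" by (rule exp_ge_add_one_self)
    finally show ?thesis .
  qed
  define q where "q = exp (- (l * \<eta>)) * exp (4 * l\<^sup>2)"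
  have q: "0 < q" "q < 1"
    using \<eta> by (auto simp: q_def mult_exp_exp l_def power2_eq_square)
  have bound: "avg_tail m f n a \<ge> 1 - q ^ (n div m)" if n: "n \<ge> m" for n
  proof -
    interpret N: prob_space "DP n" by (rule prob_space_DP)
    have avg: "inj_avg m n ?g x = \<mu> - inj_avg m n f x" for x
    proof -
      have "real (card (inj_tuples m n)) \<noteq> 0" using card_inj_tuples_pos[OF n] by linarith
      then show ?thesis by (simp only: inj_avg_def sum_subtractf diff_divide_distrib sum_constant) simp
    qed
    have "{x \<in> space (DP n). \<not> inj_avg m n f x \<ge> a} \<subseteq> {x \<in> space (DP n). inj_avg m n ?g x \<ge> \<eta>}"
      using \<eta> by (auto simp: avg)
    then have "measure (DP n) {x \<in> space (DP n). \<not> inj_avg m n f x \<ge> a}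
       \<le> avg_tail m ?g n \<eta>"
      by (intro N.finite_measure_mono) measurable
    also have "\<dots> \<le> (exp (- (l * \<eta>)) * (\<integral>x. exp (l * ?g x) \<partial>DP m)) ^ (n div m)"
      using n m l by (intro inj_avg_tail[OF _ gb]) (auto simp: Suc_le_eq div_greater_zero_iff)
    also have "\<dots> \<le> q ^ (n div m)"
      unfolding q_def using mgf by (intro power_mono mult_left_mono) auto
    finally have "measure (DP n) {x \<in> space (DP n). \<not> inj_avg m n f x \<ge> a} \<le> q ^ (n div m)" .
    moreover have "measure (DP n) {x \<in> space (DP n). \<not> inj_avg m n f x \<ge> a}
        = 1 - avg_tail m f n a"
      by (rule N.prob_neg) measurable
    ultimately show ?thesis by simp
  qed
  have div: "filterlim (\<lambda>n. n div m) at_top sequentially"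
    using m by (intro filterlim_at_top_div_const_nat) auto
  have "(\<lambda>k. q ^ k) \<longlonglongrightarrow> 0" by (rule LIMSEQ_realpow_zero) (use q in auto)
  from filterlim_compose[OF this div] have "(\<lambda>n. q ^ (n div m)) \<longlonglongrightarrow> 0" .
  from tendsto_diff[OF tendsto_const[of 1] this]
  have "(\<lambda>n. 1 - q ^ (n div m)) \<longlonglongrightarrow> 1" by simp
  then show ?thesis
  proof (rule tendsto_sandwich[OF _ _ _ tendsto_const[of 1], rotated 2])
    show "\<forall>\<^sub>F n in sequentially. 1 - q ^ (n div m) \<le> avg_tail m f n a"
      using eventually_ge_at_top[of m] by eventually_elim (rule bound)
    show "\<forall>\<^sub>F n in sequentially. avg_tail m f n a \<le> 1"
      using prob_space.prob_le_1[OF prob_space_DP] by auto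
  qed
qed

text \<open>The Gibbs inequality, applied to a multiple of an indicator, shows that an event of probability
  close to 1 under the tilted law has probability at least about \<open>exp (- n H)\<close>
  under the original law.\<close>

lemma inj_avg_lower_bound:
  fixes f :: "(nat \<Rightarrow> 'b) \<Rightarrow> real"
  assumes f[measurable]: "f \<in> borel_measurable (DP m)" and bnd: "\<And>x. \<bar>f x\<bar> \<le> 1"
    and m: "m \<ge> 1" and w: "bounded_density D w"
    and a: "a < (\<integral>x. prod_density m w x * f x \<partial>DP m)" and eps: "\<epsilon> > 0"
  shows "\<forall>\<^sub>F n in sequentially.
    avg_tail m f n a \<ge> exp (- (real n * (rel_ent D w + \<epsilon>)))"
proof -
  note [measurable] = bounded_densityD(1)[OF w]
  interpret Q: sample_law "tilt w" by (rule tilt_sample_law[OF w])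
  define H where "H = rel_ent D w"
  have H0: "H \<ge> 0" by (simp add: H_def rel_ent_nonneg[OF w])
  let ?A = "\<lambda>n. {x \<in> space (DP n). inj_avg m n f x \<ge> a}"
  have meas_eq: "measurable (Q.DP n) borel = measurable (DP n) (borel :: real measure)" for n
    by (intro measurable_cong_sets sets_PiM_cong) auto
  have space_eq: "space (Q.DP n) = space (DP n)" for n by (simp add: space_PiM)
  have "(\<integral>x. f x \<partial>Q.DP m) = (\<integral>x. prod_density m w x * f x \<partial>DP m)"
    unfolding PiM_tilt[OF w] using bounded_densityD(2)[OF bounded_density_prod[OF w]]
    by (subst integral_density) auto
  then have lim: "(\<lambda>n. measure (Q.DP n) (?A n)) \<longlonglongrightarrow> 1"
    using Q.inj_avg_lln[of f m a] f bnd m a by (simp add: meas_eq space_eq)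
  have QA: "measure (Q.DP n) (?A n) = (\<integral>x. prod_density n w x * indicator (?A n) x \<partial>DP n)" for n
  proof -
    interpret N: prob_space "DP n" by (rule prob_space_DP)
    have "measure (Q.DP n) (?A n) = (\<integral>x. indicator (?A n) x \<partial>Q.DP n)"
      by (simp add: PiM_tilt[OF w])
    also have "\<dots> = (\<integral>x. prod_density n w x * indicator (?A n) x \<partial>DP n)"
      unfolding PiM_tilt[OF w] using bounded_densityD(2)[OF bounded_density_prod[OF w]]
      by (subst integral_density) auto
    finally show ?thesis .
  qed
  have key: "c * measure (Q.DP n) (?A n) \<le> real n * H + measure (DP n) (?A n) * (exp c - 1)" if "c \<ge> 0" for c n
  proof -
    interpret N: prob_space "DP n" by (rule prob_space_DP)
    have "(\<integral>x. prod_density n w x * (c * indicator (?A n) x) \<partial>DP n)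
       \<le> rel_ent (DP n) (prod_density n w) + ((\<integral>x. exp (c * indicator (?A n) x) \<partial>DP n) - 1)"
      using that by (intro N.gibbs[OF bounded_density_prod[OF w], where B=c]) (auto simp: indicator_def)
    moreover have "(\<integral>x. prod_density n w x * (c * indicator (?A n) x) \<partial>DP n) = c * measure (Q.DP n) (?A n)"
      unfolding QA by (simp add: mult.left_commute)
    moreover have "(\<integral>x. exp (c * indicator (?A n) x) \<partial>DP n) = 1 + (exp c - 1) * measure (DP n) (?A n)"
    proof -
      have "exp (c * indicator (?A n) x) = 1 + (exp c - 1) * indicator (?A n) x" for x
        by (simp add: indicator_def)
      then have "(\<integral>x. exp (c * indicator (?A n) x) \<partial>DP n) = (\<integral>x. 1 + (exp c - 1) * indicator (?A n) x \<partial>DP n)"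
        by simp
      also have "\<dots> = 1 + (exp c - 1) * measure (DP n) (?A n)"
        using N.integrable_bounded[of "indicat_real (?A n)" 1]
        by (subst Bochner_Integration.integral_add) (auto simp: N.prob_space)
      finally show ?thesis .
    qed
    ultimately show ?thesis by (simp add: rel_ent_prod[OF w] H_def mult.commute)
  qed
  \<comment> \<open>Prepares a contradiction: for \<open>c = n (H + \<epsilon>)\<close>, an original
    probability below \<open>exp (- c)\<close> would by \<open>key\<close> force
    \<open>(H + \<epsilon>) * Q(A) \<le> H + 1 / n\<close>, whereas \<open>Q(A)\<close> tends to
    1.\<close>
  have lim2: "(\<lambda>n. (H + \<epsilon>) * measure (Q.DP n) (?A n) - H - 1 / real n) \<longlonglongrightarrow> (H + \<epsilon>) * 1 - H - 0"
    by (intro tendsto_diff tendsto_mult tendsto_const lim lim_1_over_n)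
  have "\<forall>\<^sub>F n in sequentially. (H + \<epsilon>) * measure (Q.DP n) (?A n) - H - 1 / real n > 0"
    using order_tendstoD(1)[OF lim2, of 0] eps by simp
  then have "\<forall>\<^sub>F n in sequentially. exp (- (real n * (H + \<epsilon>))) \<le> measure (DP n) (?A n)"
    using eventually_gt_at_top[of 0]
  proof eventually_elim
    case (elim n)
    show ?case
    proof (rule ccontr)
      assume neg: "\<not> ?thesis"
      let ?c = "real n * (H + \<epsilon>)"
      have "measure (DP n) (?A n) * (exp ?c - 1) \<le> exp (- ?c) * exp ?c"
        using neg H0 eps by (intro mult_mono) auto
      then have "?c * measure (Q.DP n) (?A n) \<le> real n * H + 1"
        using key[of ?c n] H0 eps by (simp add: exp_minus)
      then have "(H + \<epsilon>) * measure (Q.DP n) (?A n) \<le> H + 1 / real n"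
        using elim(2) by (simp add: field_simps)
      then show False using elim(1) by simp
    qed
  qed
  then show ?thesis by (simp add: H_def)
qed

section \<open>Step kernels\<close>

text \<open>A finite measurable partition given by its label function. The labels are natural
  numbers so that \<open>prod_encode\<close> can label common refinements.\<close>

definition coding :: "('b \<Rightarrow> nat) \<Rightarrow> bool" where
  "coding c \<longleftrightarrow> c \<in> measurable D (count_space UNIV) \<and> finite (range c)"

definition step_fun :: "nat \<Rightarrow> ((nat \<Rightarrow> 'b) \<Rightarrow> real) \<Rightarrow> bool" where
  "step_fun m f \<longleftrightarrow> (\<exists>c g. coding c \<and> (\<forall>x. f x = g (\<lambda>j\<in>{..<m}. c (x j))))"

lemma coding_prob_measurable [measurable]:
  assumes "coding c"
  shows "(\<lambda>y. of_bool (c y = l) :: real) \<in> borel_measurable D"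
proof -
  have [measurable]: "c \<in> measurable D (count_space UNIV)" using assms by (simp add: coding_def)
  show ?thesis by measurable
qed

text \<open>Exactly one \<open>v\<close> matches the cells of \<open>x\<close>. The expansion into
  products of one-coordinate indicators gives measurability and lets integrals factorise.\<close>

lemma step_fun_expand:
  fixes g :: "(nat \<Rightarrow> nat) \<Rightarrow> real"
  assumes "coding c"
  shows "g (\<lambda>j\<in>{..<m}. c (x j)) = (\<Sum>v\<in>{..<m} \<rightarrow>\<^sub>E range c. g v * (\<Prod>j<m. of_bool (c (x j) = v j)))"
proof -
  let ?v = "\<lambda>j\<in>{..<m}. c (x j)"
  have fin: "finite ({..<m} \<rightarrow>\<^sub>E range c)" using assms by (auto simp: coding_def intro: finite_PiE)
  have "(\<Sum>v\<in>{..<m} \<rightarrow>\<^sub>E range c. g v * (\<Prod>j<m. of_bool (c (x j) = v j)))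
     = (\<Sum>v\<in>{..<m} \<rightarrow>\<^sub>E range c. if v = ?v then g v else 0)"
  proof (rule sum.cong[OF refl])
    fix v assume v: "v \<in> {..<m} \<rightarrow>\<^sub>E range c"
    have "(\<Prod>j<m. of_bool (c (x j) = v j) :: real) = of_bool (\<forall>j<m. c (x j) = v j)"
      by (auto simp: of_bool_def prod_zero_iff)
    also have "(\<forall>j<m. c (x j) = v j) \<longleftrightarrow> v = ?v"
      using v by (auto simp: fun_eq_iff PiE_def extensional_def)
    finally show "g v * (\<Prod>j<m. of_bool (c (x j) = v j)) = (if v = ?v then g v else 0)" by simp
  qed
  also have "\<dots> = g ?v"
  proof -
    have "?v \<in> {..<m} \<rightarrow>\<^sub>E range c" by (rule PiE_I) simp_all
    then show ?thesis by (simp only: sum.delta[OF fin] if_True)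
  qed
  finally show ?thesis by simp
qed

lemma step_fun_measurable:
  assumes "step_fun m f"
  shows "f \<in> borel_measurable (DP m)"
proof -
  obtain c g where c: "coding c" and f: "f = (\<lambda>x. g (\<lambda>j\<in>{..<m}. c (x j)))"
    using assms by (auto simp: step_fun_def)
  note [measurable] = coding_prob_measurable[OF c]
  show ?thesis
    unfolding f step_fun_expand[OF c] by measurable
qed

lemma step_fun_bounded:
  assumes "step_fun m f"
  obtains B where "\<And>x. \<bar>f x\<bar> \<le> B"
proof -
  obtain c g where c: "coding c" and f: "\<And>x. f x = g (\<lambda>j\<in>{..<m}. c (x j))"
    using assms by (auto simp: step_fun_def)
  have fin: "finite ({..<m} \<rightarrow>\<^sub>E range c)" using c by (auto simp: coding_def intro: finite_PiE)
  have "\<bar>f x\<bar> \<le> (\<Sum>v\<in>{..<m} \<rightarrow>\<^sub>E range c. \<bar>g v\<bar>)" for x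
  proof -
    have "(\<lambda>j\<in>{..<m}. c (x j)) \<in> {..<m} \<rightarrow>\<^sub>E range c" by (rule PiE_I) simp_all
    then show ?thesis unfolding f by (rule member_le_sum[OF _ _ fin]) auto
  qed
  then show ?thesis using that by blast
qed

lemma step_fun_integrable: "step_fun m f \<Longrightarrow> integrable (DP m) f"
  using prob_space.integrable_bounded[OF prob_space_DP step_fun_measurable] step_fun_bounded by metis

text \<open>The common refinement of two partitions: two step functions become functions of one
  coding, hence so does any combination of them.\<close>

lemma coding_pair:
  assumes "coding c" "coding d"
  shows "coding (\<lambda>y. prod_encode (c y, d y))"
  unfolding coding_def
proof
  have [measurable]: "c \<in> measurable D (count_space UNIV)" "d \<in> measurable D (count_space UNIV)"
    using assms by (auto simp: coding_def)
  show "(\<lambda>y. prod_encode (c y, d y)) \<in> measurable D (count_space UNIV)"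
    by (rule measurable_compose_countable[where f="\<lambda>i y. prod_encode (i, d y)" and g=c]) measurable
  have "range (\<lambda>y. prod_encode (c y, d y)) \<subseteq> prod_encode ` (range c \<times> range d)" by auto
  then show "finite (range (\<lambda>y. prod_encode (c y, d y)))"
    using assms by (elim finite_subset) (auto simp: coding_def)
qed

lemma step_fun_binary:
  assumes "step_fun m f1" "step_fun m f2"
  shows "step_fun m (\<lambda>x. F (f1 x) (f2 x))"
proof -
  obtain c g where c: "coding c" and f1: "\<And>x. f1 x = g (\<lambda>j\<in>{..<m}. c (x j))"
    using assms(1) by (auto simp: step_fun_def)
  obtain d k where d: "coding d" and f2: "\<And>x. f2 x = k (\<lambda>j\<in>{..<m}. d (x j))"
    using assms(2) by (auto simp: step_fun_def)
  define G where "G v = F (g (\<lambda>j\<in>{..<m}. fst (prod_decode (v j)))) (k (\<lambda>j\<in>{..<m}. snd (prod_decode (v j))))" for v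
  have "F (f1 x) (f2 x) = G (\<lambda>j\<in>{..<m}. prod_encode (c (x j), d (x j)))" for x
    unfolding G_def f1 f2 by (simp cong: restrict_cong)
  with coding_pair[OF c d] show ?thesis unfolding step_fun_def by blast
qed

lemma step_fun_const: "step_fun m (\<lambda>_. C)"
  unfolding step_fun_def by (intro exI[of _ "\<lambda>_. 0"] exI[of _ "\<lambda>_. C"]) (simp add: coding_def)

lemma step_fun_indicator_coordinate:
  assumes "E \<in> sets D" "i < m"
  shows "step_fun m (\<lambda>x. indicator E (x i))"
  unfolding step_fun_def
proof (intro exI conjI allI)
  show "coding (\<lambda>y. of_bool (y \<in> E))"
    using assms(1) by (auto simp: coding_def intro: finite_subset[of _ "{0, 1}"])
  show "indicator E (x i) = (\<lambda>v. real (v i)) (\<lambda>j\<in>{..<m}. of_bool (x j \<in> E))" for x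
    using assms(2) by (simp add: indicator_def)
qed

lemma step_fun_rectangle:
  assumes "\<And>i. i < n \<Longrightarrow> E i \<in> sets D" "n \<le> m"
  shows "step_fun m (\<lambda>x. \<Prod>i<n. indicator (E i) (x i))"
  using assms
proof (induction n)
  case 0
  show ?case using step_fun_const[of m 1] by simp
next
  case (Suc n)
  show ?case
    unfolding prod.lessThan_Suc
    by (rule step_fun_binary[where F="(*)", OF Suc.IH step_fun_indicator_coordinate]) (use Suc.prems in auto)
qed

text \<open>The L1 closure of the step functions.\<close>

definition step_approximable :: "nat \<Rightarrow> ((nat \<Rightarrow> 'b) \<Rightarrow> real) \<Rightarrow> bool" where
  "step_approximable m f \<longleftrightarrow> integrable (DP m) f \<and>
     (\<forall>e>0. \<exists>g. step_fun m g \<and> (\<integral>x. \<bar>f x - g x\<bar> \<partial>DP m) < e)"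

lemma step_approximable_step: "step_fun m f \<Longrightarrow> step_approximable m f"
  unfolding step_approximable_def using step_fun_integrable by (auto intro!: exI[of _ f])

lemma step_approximable_limit:
  assumes f: "integrable (DP m) f"
    and lim: "\<And>e. e > 0 \<Longrightarrow> \<exists>f'. step_approximable m f' \<and> (\<integral>x. \<bar>f x - f' x\<bar> \<partial>DP m) < e"
  shows "step_approximable m f"
  unfolding step_approximable_def
proof (intro conjI allI impI f)
  fix e :: real assume "e > 0"
  then obtain f' where f': "step_approximable m f'" "(\<integral>x. \<bar>f x - f' x\<bar> \<partial>DP m) < e / 2"
    using lim[of "e / 2"] by auto
  then obtain g where g: "step_fun m g" "(\<integral>x. \<bar>f' x - g x\<bar> \<partial>DP m) < e / 2"
    using \<open>e > 0\<close> unfolding step_approximable_def by (meson half_gt_zero)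
  have "(\<integral>x. \<bar>f x - g x\<bar> \<partial>DP m) \<le> (\<integral>x. \<bar>f x - f' x\<bar> \<partial>DP m) + (\<integral>x. \<bar>f' x - g x\<bar> \<partial>DP m)"
    using prob_space.dist1_triangle[OF prob_space_DP f, of f' g] f'(1) step_fun_integrable[OF g(1)]
    by (simp add: prob_space.dist1_def[OF prob_space_DP] step_approximable_def)
  then show "\<exists>g. step_fun m g \<and> (\<integral>x. \<bar>f x - g x\<bar> \<partial>DP m) < e"
    using f'(2) g by (intro exI[of _ g]) auto
qed

lemma step_approximable_add:
  assumes f: "step_approximable m f1" "step_approximable m f2"
  shows "step_approximable m (\<lambda>x. f1 x + f2 x)"
  unfolding step_approximable_def
proof (intro conjI allI impI)
  have i: "integrable (DP m) f1" "integrable (DP m) f2" using f by (auto simp: step_approximable_def)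
  then show "integrable (DP m) (\<lambda>x. f1 x + f2 x)" by simp
  fix e :: real assume "e > 0"
  then obtain g1 g2 where g: "step_fun m g1" "(\<integral>x. \<bar>f1 x - g1 x\<bar> \<partial>DP m) < e / 2"
      "step_fun m g2" "(\<integral>x. \<bar>f2 x - g2 x\<bar> \<partial>DP m) < e / 2"
    using f unfolding step_approximable_def by (meson half_gt_zero)
  note ig = step_fun_integrable[OF g(1)] step_fun_integrable[OF g(3)]
  have "(\<integral>x. \<bar>(f1 x + f2 x) - (g1 x + g2 x)\<bar> \<partial>DP m) \<le> (\<integral>x. \<bar>f1 x - g1 x\<bar> + \<bar>f2 x - g2 x\<bar> \<partial>DP m)"
    using i ig by (intro integral_mono) auto
  also have "\<dots> = (\<integral>x. \<bar>f1 x - g1 x\<bar> \<partial>DP m) + (\<integral>x. \<bar>f2 x - g2 x\<bar> \<partial>DP m)"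
    using i ig by (intro Bochner_Integration.integral_add) auto
  finally show "\<exists>g. step_fun m g \<and> (\<integral>x. \<bar>(f1 x + f2 x) - g x\<bar> \<partial>DP m) < e"
    using g step_fun_binary[OF g(1) g(3), of "(+)"] by (intro exI[of _ "\<lambda>x. g1 x + g2 x"]) auto
qed

lemma step_approximable_cmult:
  assumes f: "step_approximable m f"
  shows "step_approximable m (\<lambda>x. C * f x)"
  unfolding step_approximable_def
proof (intro conjI allI impI)
  have i: "integrable (DP m) f" using f by (auto simp: step_approximable_def)
  then show "integrable (DP m) (\<lambda>x. C * f x)" by simp
  fix e :: real assume "e > 0"
  then have "e / (\<bar>C\<bar> + 1) > 0" by simp
  then obtain g where g: "step_fun m g" "(\<integral>x. \<bar>f x - g x\<bar> \<partial>DP m) < e / (\<bar>C\<bar> + 1)"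
    using f unfolding step_approximable_def by meson
  have "(\<integral>x. \<bar>C * f x - C * g x\<bar> \<partial>DP m) = \<bar>C\<bar> * (\<integral>x. \<bar>f x - g x\<bar> \<partial>DP m)"
    by (simp add: right_diff_distrib[symmetric] abs_mult)
  also have "\<dots> \<le> (\<bar>C\<bar> + 1) * (\<integral>x. \<bar>f x - g x\<bar> \<partial>DP m)" by (intro mult_right_mono) auto
  also have "\<dots> < e" using g(2) by (simp add: field_simps)
  finally show "\<exists>g. step_fun m g \<and> (\<integral>x. \<bar>C * f x - g x\<bar> \<partial>DP m) < e"
    using step_fun_binary[OF step_fun_const g(1), of "(*)" C] by (intro exI[of _ "\<lambda>x. C * g x"]) auto
qed

lemma step_approximable_sum:
  assumes "finite I" "\<And>i. i \<in> I \<Longrightarrow> step_approximable m (f i)"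
  shows "step_approximable m (\<lambda>x. \<Sum>i\<in>I. f i x)"
  using assms
proof (induction I rule: finite_induct)
  case empty
  then show ?case using step_approximable_step[OF step_fun_const, of m 0] by simp
next
  case (insert i I)
  then show ?case by (auto intro: step_approximable_add)
qed

text \<open>Dynkin's argument: rectangles form an intersection-stable generator and their indicators
  are step functions; approximability passes to complements, and to countable disjoint unions
  because the finite partial unions exhaust the measure.\<close>

lemma step_approximable_indicator:
  assumes "A \<in> sets (DP m)"
  shows "step_approximable m (indicator A)"
proof -
  interpret S: prob_space "DP m" by (rule prob_space_DP)
  have sub: "prod_algebra {..<m} (\<lambda>_. D) \<subseteq> Pow (space (DP m))"
    using prod_algebra_sets_into_space[of "{..<m}" "\<lambda>_. D"] by (simp add: space_PiM)
  have "A \<in> sigma_sets (space (DP m)) (prod_algebra {..<m} (\<lambda>_. D))"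
    using assms by (simp add: sets_PiM space_PiM)
  with Int_stable_prod_algebra sub show ?thesis
  proof (induction rule: sigma_sets_induct_disjoint)
    case (basic A)
    then obtain E where E: "A = Pi\<^sub>E {..<m} E" "\<And>i. i < m \<Longrightarrow> E i \<in> sets D"
      by (auto elim!: prod_algebraE_all)
    have "step_approximable m (\<lambda>x. \<Prod>i<m. indicator (E i) (x i))"
      by (rule step_approximable_step, rule step_fun_rectangle) (use E in auto)
    \<comment> \<open>Elements of \<open>A\<close> are extensional, so the two indicators need to
      agree only on \<open>space (DP m)\<close>.\<close>
    moreover have "AE x in DP m. \<bar>indicator A x - (\<Prod>i<m. indicator (E i) (x i))\<bar> = (0::real)"
      by (rule AE_I2) (auto simp: E(1) indicator_def space_PiM PiE_iff prod_zero_iff)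
    then have "(\<integral>x. \<bar>indicator A x - (\<Prod>i<m. indicator (E i) (x i))\<bar> \<partial>DP m) = (0::real)"
      by (rule integral_eq_zero_AE)
    moreover have "A \<in> sets (DP m)" unfolding E(1) using E(2) by (intro sets_PiM_I_finite) auto
    ultimately show ?case
      by (intro step_approximable_limit) (auto intro!: S.integrable_bounded[where B=1] exI[of _ "\<lambda>x. \<Prod>i<m. indicator (E i) (x i)"])
  next
    case empty
    then show ?case using step_approximable_step[OF step_fun_const, of m 0] by simp
  next
    case (compl A)
    have "step_approximable m (\<lambda>x. 1 + (-1) * indicator A x)"
      by (intro step_approximable_add step_approximable_cmult compl step_approximable_step step_fun_const)
    moreover have "AE x in DP m. \<bar>indicator (space (DP m) - A) x - (1 + (-1) * indicator A x)\<bar> = (0::real)"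
      by (rule AE_I2) (auto simp: indicator_def)
    then have "(\<integral>x. \<bar>indicator (space (DP m) - A) x - (1 + (-1) * indicator A x)\<bar> \<partial>DP m) = (0::real)"
      by (rule integral_eq_zero_AE)
    moreover have "A \<in> sets (DP m)" using compl(1) by (simp add: sets_PiM space_PiM)
    ultimately show ?case
      by (intro step_approximable_limit) (auto intro!: S.integrable_bounded[where B=1] exI[of _ "\<lambda>x. 1 + (-1) * indicator A x"])
  next
    case (union A)
    have A: "A i \<in> sets (DP m)" for i using union(2) by (auto simp: sets_PiM space_PiM)
    show ?case
    proof (rule step_approximable_limit)
      show "integrable (DP m) (indicat_real (\<Union> (range A)))"
        using A by (intro S.integrable_bounded[where B=1]) auto
      fix e :: real assume e: "e > 0"
      have "(\<lambda>n. \<Sum>i<n. measure (DP m) (A i)) \<longlonglongrightarrow> measure (DP m) (\<Union> (range A))"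
        using S.finite_measure_UNION[of A] A union(1) by (auto simp: sums_def)
      then have "\<forall>\<^sub>F n in sequentially. measure (DP m) (\<Union> (range A)) - e < (\<Sum>i<n. measure (DP m) (A i))"
        using e by (intro order_tendstoD(1)) auto
      then obtain n where n: "measure (DP m) (\<Union> (range A)) - e < (\<Sum>i<n. measure (DP m) (A i))"
        by (auto simp: eventually_sequentially)
      let ?f = "\<lambda>x. \<Sum>i<n. indicat_real (A i) x"
      have f_eq: "?f x = indicat_real (\<Union>i<n. A i) x" for x
        by (rule indicator_UN_disjoint[symmetric])
           (use union(1) in \<open>auto intro: disjoint_family_on_mono\<close>)
      have "\<bar>indicat_real (\<Union> (range A)) x - ?f x\<bar> = indicat_real (\<Union> (range A)) x - ?f x" for x
        unfolding f_eq by (auto simp: indicator_def)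
      then have "(\<integral>x. \<bar>indicat_real (\<Union> (range A)) x - ?f x\<bar> \<partial>DP m)
          = (\<integral>x. indicat_real (\<Union> (range A)) x \<partial>DP m) - (\<integral>x. ?f x \<partial>DP m)"
        using A by (simp add: Bochner_Integration.integral_diff S.integrable_bounded[where B=1]
            Bochner_Integration.integrable_sum)
      also have "\<dots> = measure (DP m) (\<Union> (range A)) - (\<Sum>i<n. measure (DP m) (A i))"
        using A by (subst Bochner_Integration.integral_sum) (auto intro!: S.integrable_bounded[where B=1])
      finally have "(\<integral>x. \<bar>indicat_real (\<Union> (range A)) x - ?f x\<bar> \<partial>DP m) < e" using n by simp
      moreover have "step_approximable m ?f"
        using union(3) by (intro step_approximable_sum) auto
      ultimately show "\<exists>f'. step_approximable m f' \<and> (\<integral>x. \<bar>indicat_real (\<Union> (range A)) x - f' x\<bar> \<partial>DP m) < e"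
        by blast
    qed
  qed
qed

text \<open>Rounding \<open>f\<close> down to multiples of \<open>1 / N\<close> moves it by at most
  \<open>1 / N\<close> and, as \<open>f\<close> is bounded, leaves finitely many values.\<close>

lemma step_approximable_bounded:
  fixes f :: "(nat \<Rightarrow> 'b) \<Rightarrow> real"
  assumes [measurable]: "f \<in> borel_measurable (DP m)" and bnd: "\<And>x. \<bar>f x\<bar> \<le> 1"
  shows "step_approximable m f"
proof (rule step_approximable_limit)
  interpret S: prob_space "DP m" by (rule prob_space_DP)
  show i_f: "integrable (DP m) f" by (rule S.integrable_bounded[OF assms])
  fix e :: real assume "e > 0"
  then obtain N :: nat where N: "1 / real (Suc N) < e" using reals_Archimedean by (auto simp: inverse_eq_divide)
  let ?N = "real (Suc N)"
  let ?A = "\<lambda>k. {x \<in> space (DP m). \<lfloor>?N * f x\<rfloor> = k}"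
  let ?f = "\<lambda>x. \<Sum>k\<in>{- int (Suc N)..int (Suc N)}. (of_int k / ?N) * indicator (?A k) x"
  have eq: "?f x = of_int \<lfloor>?N * f x\<rfloor> / ?N" if "x \<in> space (DP m)" for x
  proof -
    have "\<bar>y\<bar> \<le> real k \<Longrightarrow> \<lfloor>y\<rfloor> \<in> {- int k..int k}" for y :: real and k
      by (simp add: le_floor_iff floor_le_iff abs_le_iff)
    moreover have "\<bar>?N * f x\<bar> \<le> ?N" using bnd[of x] by (simp add: abs_mult mult_left_le)
    ultimately have "\<lfloor>?N * f x\<rfloor> \<in> {- int (Suc N)..int (Suc N)}" by blast
    moreover have "?f x = (\<Sum>k\<in>{- int (Suc N)..int (Suc N)}. if \<lfloor>?N * f x\<rfloor> = k then of_int k / ?N else 0)"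
      using that by (intro sum.cong) (auto simp: indicator_def)
    ultimately show ?thesis by (simp add: sum.delta)
  qed
  have app: "step_approximable m ?f"
    by (intro step_approximable_sum step_approximable_cmult step_approximable_indicator) auto
  then have i_f': "integrable (DP m) ?f" by (simp add: step_approximable_def)
  have "(\<integral>x. \<bar>f x - ?f x\<bar> \<partial>DP m) \<le> (\<integral>x. 1 / ?N \<partial>DP m)"
  proof (rule integral_mono)
    show "integrable (DP m) (\<lambda>x. \<bar>f x - ?f x\<bar>)" using i_f i_f' by simp
    fix x assume x: "x \<in> space (DP m)"
    have "of_int \<lfloor>?N * f x\<rfloor> \<le> ?N * f x" "?N * f x < of_int \<lfloor>?N * f x\<rfloor> + 1" by linarith+
    then have "\<bar>?N * f x - of_int \<lfloor>?N * f x\<rfloor>\<bar> \<le> 1" by linarith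
    moreover have "f x - of_int \<lfloor>?N * f x\<rfloor> / ?N = (?N * f x - of_int \<lfloor>?N * f x\<rfloor>) / ?N"
      by (simp add: diff_divide_distrib)
    ultimately show "\<bar>f x - ?f x\<bar> \<le> 1 / ?N"
      unfolding eq[OF x] by (simp only: abs_divide) (simp add: divide_right_mono)
  qed simp
  also have "\<dots> < e" using N by (simp add: S.prob_space)
  finally show "\<exists>f'. step_approximable m f' \<and> (\<integral>x. \<bar>f x - f' x\<bar> \<partial>DP m) < e"
    using app by blast
qed

text \<open>Since \<open>f\<close> takes values in [-1, 1], truncating the approximating step
  function to this interval does not increase the distance; the bound is what the method of types
  needs.\<close>

lemma step_approximation:
  fixes f :: "(nat \<Rightarrow> 'b) \<Rightarrow> real"
  assumes f: "f \<in> borel_measurable (DP m)" "\<And>x. \<bar>f x\<bar> \<le> 1" and e: "e > 0"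
  shows "\<exists>c g. coding c \<and> (\<forall>v. \<bar>g v\<bar> \<le> 1) \<and>
    (\<integral>x. \<bar>f x - g (\<lambda>j\<in>{..<m}. c (x j))\<bar> \<partial>DP m) < e"
proof -
  obtain f' where f': "step_fun m f'" "(\<integral>x. \<bar>f x - f' x\<bar> \<partial>DP m) < e"
    using step_approximable_bounded[OF f] e by (auto simp: step_approximable_def)
  then obtain c g where c: "coding c" and g: "\<And>x. f' x = g (\<lambda>j\<in>{..<m}. c (x j))"
    by (auto simp: step_fun_def)
  define k where "k v = max (-1) (min 1 (g v))" for v
  interpret S: prob_space "DP m" by (rule prob_space_DP)
  have i_f: "integrable (DP m) f" by (rule S.integrable_bounded[OF f])
  have "step_fun m (\<lambda>x. k (\<lambda>j\<in>{..<m}. c (x j)))" unfolding step_fun_def using c by blast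
  then have ik: "integrable (DP m) (\<lambda>x. k (\<lambda>j\<in>{..<m}. c (x j)))" by (rule step_fun_integrable)
  have "(\<integral>x. \<bar>f x - k (\<lambda>j\<in>{..<m}. c (x j))\<bar> \<partial>DP m) \<le> (\<integral>x. \<bar>f x - f' x\<bar> \<partial>DP m)"
  proof (rule integral_mono)
    show "\<bar>f x - k (\<lambda>j\<in>{..<m}. c (x j))\<bar> \<le> \<bar>f x - f' x\<bar>" for x
      using f(2)[of x] unfolding g k_def by (auto simp: abs_if max_def min_def split: if_splits)
  qed (use i_f ik step_fun_integrable[OF f'(1)] in auto)
  with f'(2) have "(\<integral>x. \<bar>f x - k (\<lambda>j\<in>{..<m}. c (x j))\<bar> \<partial>DP m) < e" by simp
  moreover have "\<bar>k v\<bar> \<le> 1" for v by (auto simp: k_def)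
  ultimately show ?thesis using c by blast
qed

section \<open>Types and the upper bound\<close>

definition cell_prob :: "('b \<Rightarrow> nat) \<Rightarrow> nat \<Rightarrow> real" where
  "cell_prob c l = (\<integral>y. of_bool (c y = l) \<partial>D)"

definition cell_count :: "nat \<Rightarrow> ('b \<Rightarrow> nat) \<Rightarrow> (nat \<Rightarrow> 'b) \<Rightarrow> nat \<Rightarrow> nat" where
  "cell_count n c x l = card {i. i < n \<and> c (x i) = l}"

text \<open>For a distribution \<open>q\<close> on the labels, this is the density of the law with
  cell distribution \<open>q\<close> that agrees with \<open>D\<close> conditionally on each cell.
  Division by 0 gives 0 on null cells.\<close>

definition cell_density :: "('b \<Rightarrow> nat) \<Rightarrow> (nat \<Rightarrow> real) \<Rightarrow> 'b \<Rightarrow> real" where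
  "cell_density c q y = q (c y) / cell_prob c (c y)"

lemma cell_count_sum: "real (cell_count n c x l) = (\<Sum>i<n. of_bool (c (x i) = l))"
  by (simp add: cell_count_def lessThan_def Int_def flip: sum.inter_filter)

lemma sum_over_cells:
  fixes F :: "nat \<Rightarrow> real"
  assumes "coding c"
  shows "F (c y) = (\<Sum>l\<in>range c. F l * of_bool (c y = l))"
  using assms by (subst sum.remove[of _ "c y"]) (auto simp: coding_def intro!: sum.neutral)

lemma integral_cells:
  fixes F :: "nat \<Rightarrow> real"
  assumes c: "coding c"
  shows "(\<integral>y. F (c y) \<partial>D) = (\<Sum>l\<in>range c. F l * cell_prob c l)"
proof -
  note [measurable] = coding_prob_measurable[OF c]
  have "(\<integral>y. F (c y) \<partial>D) = (\<Sum>l\<in>range c. (\<integral>y. F l * of_bool (c y = l) \<partial>D))"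
    unfolding sum_over_cells[OF c, of F]
    by (intro Bochner_Integration.integral_sum integrable_mult_right integrable_bounded[where B=1]) auto
  then show ?thesis by (simp add: cell_prob_def)
qed

lemma cell_prob_nonneg: "cell_prob c l \<ge> 0"
  by (simp add: cell_prob_def)

lemma cell_prob_measurable:
  assumes c: "coding c"
  shows "(\<lambda>y. cell_prob c (c y)) \<in> borel_measurable D"
proof -
  note [measurable] = coding_prob_measurable[OF c]
  show ?thesis unfolding sum_over_cells[OF c, of "cell_prob c"] by measurable
qed

text \<open>The last condition says that \<open>q\<close> charges no null cell; it is what allows
  the division in \<open>cell_density\<close> to be undone.\<close>

context
  fixes c q
  assumes c: "coding c" and q0: "\<And>l. q l \<ge> (0::real)" and q1: "(\<Sum>l\<in>range c. q l) = 1"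
    and qp: "\<And>l. q l > 0 \<Longrightarrow> cell_prob c l > 0"
begin

lemma cell_q_cancel: "q l / cell_prob c l * cell_prob c l = q l"
  using qp[of l] q0[of l] by (cases "q l = 0") auto

lemma bounded_density_cell: "bounded_density D (cell_density c q)"
  unfolding bounded_density_def
proof (intro conjI allI)
  note [measurable] = coding_prob_measurable[OF c]
  show "cell_density c q \<in> borel_measurable D"
    unfolding cell_density_def sum_over_cells[OF c, of "\<lambda>l. q l / cell_prob c l"] by measurable
  show "0 \<le> cell_density c q y" for y
    using q0 cell_prob_nonneg by (simp add: cell_density_def)
  have "cell_density c q y \<le> (\<Sum>l\<in>range c. q l / cell_prob c l)" for y
    unfolding cell_density_def using c q0 cell_prob_nonneg
    by (intro member_le_sum) (auto simp: coding_def)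
  then show "\<exists>u. \<forall>y. cell_density c q y \<le> u" by blast
  show "(\<integral>y. cell_density c q y \<partial>D) = 1"
    unfolding cell_density_def using integral_cells[OF c, of "\<lambda>l. q l / cell_prob c l"] q1
    by (simp only: cell_q_cancel)
qed

lemma rel_ent_cell: "rel_ent D (cell_density c q) = (\<Sum>l\<in>range c. q l * ln (q l / cell_prob c l))"
  unfolding rel_ent_def cell_density_def
  using integral_cells[OF c, of "\<lambda>l. q l / cell_prob c l * ln (q l / cell_prob c l)"] cell_q_cancel
  by (simp only: mult.assoc[of _ "ln _"] mult.commute[of "ln _"] mult.assoc[symmetric])

text \<open>The mean of a step kernel is a polynomial in \<open>q\<close>. The same polynomial in
  the cell frequencies appears in \<open>full_average_step\<close>, which ties the type of a sample
  to a density satisfying the constraint.\<close>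

lemma step_integral_cell:
  fixes g :: "(nat \<Rightarrow> nat) \<Rightarrow> real"
  shows "(\<integral>x. prod_density m (cell_density c q) x * g (\<lambda>j\<in>{..<m}. c (x j)) \<partial>DP m)
    = (\<Sum>v\<in>{..<m} \<rightarrow>\<^sub>E range c. g v * (\<Prod>j<m. q (v j)))"
proof -
  let ?w = "cell_density c q"
  note [measurable] = coding_prob_measurable[OF c] bounded_densityD(1)[OF bounded_density_cell]
  obtain u where u: "\<And>y. \<bar>?w y\<bar> \<le> u" "u \<ge> 1" using bounded_density_bound[OF bounded_density_cell] by blast
  have b: "\<bar>?w y * of_bool (c y = l)\<bar> \<le> u" for y l using u by (auto simp: of_bool_def)
  have one: "(\<integral>y. ?w y * of_bool (c y = l) \<partial>D) = q l" for l
  proof -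
    have "?w y * of_bool (c y = l) = q l / cell_prob c l * of_bool (c y = l)" for y
      by (auto simp: cell_density_def of_bool_def)
    then have "(\<integral>y. ?w y * of_bool (c y = l) \<partial>D) = q l / cell_prob c l * cell_prob c l"
      by (simp add: cell_prob_def)
    then show ?thesis by (simp only: cell_q_cancel)
  qed
  have "(\<integral>x. prod_density m ?w x * g (\<lambda>j\<in>{..<m}. c (x j)) \<partial>DP m)
      = (\<integral>x. (\<Sum>v\<in>{..<m} \<rightarrow>\<^sub>E range c. g v * (\<Prod>j<m. ?w (x j) * of_bool (c (x j) = v j))) \<partial>DP m)"
    unfolding step_fun_expand[OF c, of g] sum_distrib_left prod_density_def prod.distrib
    by (simp add: mult_ac)
  also have "\<dots> = (\<Sum>v\<in>{..<m} \<rightarrow>\<^sub>E range c. (\<integral>x. g v * (\<Prod>j<m. ?w (x j) * of_bool (c (x j) = v j)) \<partial>DP m))"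
    using b by (intro Bochner_Integration.integral_sum integrable_mult_right P.product_integrable_prod
      integrable_bounded[where B=u]) auto
  also have "\<dots> = (\<Sum>v\<in>{..<m} \<rightarrow>\<^sub>E range c. g v * (\<Prod>j<m. q (v j)))"
    using integral_prod[of m "\<lambda>j y. ?w y * of_bool (c y = v j)" "\<lambda>_. u" for v] b one by simp
  finally show ?thesis .
qed

text \<open>The likelihood of a sample depends on its cell counts alone, and with \<open>q\<close>
  the sample's own type the log-likelihood is \<open>n\<close> times the entropy.\<close>

lemma prod_density_type:
  assumes type: "\<And>l. q l = real (cell_count n c x l) / real n" and n: "n > 0"
  shows "prod_density n (cell_density c q) x = exp (real n * rel_ent D (cell_density c q))"
proof -
  have pos: "cell_density c q (x i) > 0" if "i < n" for i
  proof -
    have "i \<in> {i'. i' < n \<and> c (x i') = c (x i)}" using that by auto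
    then have "cell_count n c x (c (x i)) > 0" unfolding cell_count_def by (auto simp: card_gt_0_iff)
    then have "q (c (x i)) > 0" using n by (simp add: type)
    then show ?thesis using qp by (simp add: cell_density_def)
  qed
  have "ln (prod_density n (cell_density c q) x) = (\<Sum>i<n. ln (cell_density c q (x i)))"
    unfolding prod_density_def using pos by (intro ln_prod) (auto dest: pos)
  also have "\<dots> = (\<Sum>i<n. \<Sum>l\<in>range c. ln (q l / cell_prob c l) * of_bool (c (x i) = l))"
    unfolding cell_density_def by (intro sum.cong refl sum_over_cells[OF c])
  also have "\<dots> = (\<Sum>l\<in>range c. \<Sum>i<n. ln (q l / cell_prob c l) * of_bool (c (x i) = l))"
    by (rule sum.swap)
  also have "\<dots> = (\<Sum>l\<in>range c. real n * (q l * ln (q l / cell_prob c l)))"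
    using n by (intro sum.cong refl) (simp add: sum_distrib_left[symmetric] cell_count_sum[symmetric] type)
  also have "\<dots> = real n * rel_ent D (cell_density c q)"
    by (simp add: rel_ent_cell sum_distrib_left)
  finally have "ln (prod_density n (cell_density c q) x) = real n * rel_ent D (cell_density c q)" .
  moreover have "prod_density n (cell_density c q) x > 0"
    unfolding prod_density_def using pos by (intro prod_pos) auto
  ultimately show ?thesis by (metis exp_ln)
qed

end

lemma cell_count_measurable [measurable]:
  assumes "coding c"
  shows "(\<lambda>x. real (cell_count n c x l)) \<in> borel_measurable (DP n)"
proof -
  note [measurable] = coding_prob_measurable[OF assms]
  show ?thesis unfolding cell_count_sum by measurable
qed

lemma type_sets:
  assumes c: "coding c"
  shows "{x \<in> space (DP n). \<forall>l\<in>range c. cell_count n c x l = k l} \<in> sets (DP n)"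
proof (rule sets.sets_Collect_finite_All)
  fix l
  have "{x \<in> space (DP n). cell_count n c x l = k l}
      = (\<lambda>x. real (cell_count n c x l)) -` {real (k l)} \<inter> space (DP n)" by auto
  then show "{x \<in> space (DP n). cell_count n c x l = k l} \<in> sets (DP n)"
    using measurable_sets[OF cell_count_measurable[OF c]] by simp
qed (use c in \<open>simp add: coding_def\<close>)

text \<open>The law with density \<open>cell_density c q\<close> gives every sample of type \<open>q\<close> the likelihood
  ratio \<open>exp (n H)\<close>, so the original law gives that type at most the probability \<open>exp (- n H)\<close>.\<close>

lemma type_prob_bound:
  assumes c: "coding c" and n: "n > 0"
    and k1: "(\<Sum>l\<in>range c. k l) = n" and kp: "\<And>l. k l > 0 \<Longrightarrow> cell_prob c l > 0" and k0: "\<And>l. l \<notin> range c \<Longrightarrow> k l = 0"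
  defines "q \<equiv> \<lambda>l. real (k l) / real n"
  shows "measure (DP n) {x \<in> space (DP n). \<forall>l\<in>range c. cell_count n c x l = k l}
    \<le> exp (- (real n * rel_ent D (cell_density c q)))"
proof -
  let ?w = "cell_density c q"
  let ?A = "{x \<in> space (DP n). \<forall>l\<in>range c. cell_count n c x l = k l}"
  have q: "\<And>l. q l \<ge> 0" "(\<Sum>l\<in>range c. q l) = 1" "\<And>l. q l > 0 \<Longrightarrow> cell_prob c l > 0"
    using n k1 kp by (auto simp: q_def sum_divide_distrib[symmetric] of_nat_sum[symmetric] zero_less_divide_iff simp del: of_nat_sum)
  note w = bounded_density_cell[OF c q]
  interpret N: prob_space "DP n" by (rule prob_space_DP)
  have [measurable]: "?A \<in> sets (DP n)" by (rule type_sets[OF c])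
  have type: "q l = real (cell_count n c x l) / real n" if "x \<in> ?A" for x l
  proof (cases "l \<in> range c")
    case False
    then have "cell_count n c x l = 0" by (auto simp: cell_count_def)
    then show ?thesis using k0[OF False] by (simp add: q_def)
  qed (use that in \<open>auto simp: q_def\<close>)
  have "r * measure (DP n) A = (\<integral>x. r * indicator A x \<partial>DP n)" if "A \<in> sets (DP n)" for A r
    using that by (simp add: Int_absorb2 sets.sets_into_space)
  then have "exp (real n * rel_ent D ?w) * measure (DP n) ?A = (\<integral>x. exp (real n * rel_ent D ?w) * indicator ?A x \<partial>DP n)"
    by this measurable
  also have "\<dots> \<le> (\<integral>x. prod_density n ?w x \<partial>DP n)"
  proof (rule integral_mono)
    fix x
    show "exp (real n * rel_ent D ?w) * indicator ?A x \<le> prod_density n ?w x"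
    proof (cases "x \<in> ?A")
      case True
      then show ?thesis using prod_density_type[OF c q type[OF True] n] by simp
    next
      case False
      then have "indicat_real ?A x = 0" by (rule indicator_simps)
      then show ?thesis using bounded_densityD(2)[OF bounded_density_prod[OF w]] by (simp only: mult_zero_right)
    qed
  next
    have "integrable (DP n) (\<lambda>x. r * indicat_real A x)" if "A \<in> sets (DP n)" for A r
      using that by (intro integrable_mult_right N.integrable_bounded[where B=1]) auto
    then show "integrable (DP n) (\<lambda>x. exp (real n * rel_ent D ?w) * indicat_real ?A x)"
      by this measurable
  qed (rule N.integrable_bounded_density[OF bounded_density_prod[OF w]])
  also have "\<dots> = 1" using bounded_densityD(3)[OF bounded_density_prod[OF w]] .
  finally show ?thesis by (simp add: exp_minus field_simps)
qed

text \<open>The proportion of tuples with a repeated index enters twice: through the omitted terms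
  and through the changed normalisation.\<close>

lemma inj_avg_vs_full_average:
  fixes f :: "(nat \<Rightarrow> 'b) \<Rightarrow> real"
  assumes bnd: "\<And>x. \<bar>f x\<bar> \<le> 1" and n: "n \<ge> m" "n > 0"
  shows "\<bar>inj_avg m n f x - (\<Sum>i\<in>{..<m} \<rightarrow>\<^sub>E {..<n}. f (\<lambda>j\<in>{..<m}. x (i j))) / real n ^ m\<bar>
    \<le> 2 * (1 - real (card (inj_tuples m n)) / real n ^ m)"
proof -
  let ?F = "\<lambda>i. f (\<lambda>j\<in>{..<m}. x (i j))"
  let ?E = "{..<m} \<rightarrow>\<^sub>E {..<n}"
  let ?I = "inj_tuples m n"
  let ?N = "real (card ?I)" and ?T = "real n ^ m"
  have sub: "?I \<subseteq> ?E" by (auto simp: inj_tuples_def)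
  have fin: "finite ?E" by (intro finite_PiE) auto
  have cE: "real (card ?E) = ?T" by (simp add: card_funcsetE)
  have N: "?N > 0" using card_inj_tuples_pos[OF n(1)] by simp
  have T: "?T > 0" using n by simp
  have "card ?I \<le> card ?E" by (rule card_mono[OF fin sub])
  then have NT: "?N \<le> ?T" using cE by linarith
  have rest: "\<bar>\<Sum>i\<in>?E - ?I. ?F i\<bar> \<le> ?T - ?N"
  proof -
    have "\<bar>\<Sum>i\<in>?E - ?I. ?F i\<bar> \<le> real (card (?E - ?I)) * 1"
      using sum_norm_bound[of "?E - ?I" ?F 1] bnd by simp
    also have "real (card (?E - ?I)) = ?T - ?N"
      using card_mono[OF fin sub] cE by (simp add: card_Diff_subset[OF _ sub] of_nat_diff)
    finally show ?thesis by (simp only: mult_1_right)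
  qed
  have split: "(\<Sum>i\<in>?E. ?F i) = (\<Sum>i\<in>?E - ?I. ?F i) + (\<Sum>i\<in>?I. ?F i)"
    by (rule sum.subset_diff[OF sub fin])
  have S: "\<bar>\<Sum>i\<in>?I. ?F i\<bar> \<le> ?N"
    using sum_norm_bound[of "?I" ?F 1] bnd by simp
  have "inj_avg m n f x - (\<Sum>i\<in>?E. ?F i) / ?T = (\<Sum>i\<in>?I. ?F i) / ?N * (1 - ?N / ?T) - (\<Sum>i\<in>?E - ?I. ?F i) / ?T"
  proof -
    have "S / ?N - (R + S) / ?T = S / ?N * (1 - ?N / ?T) - R / ?T" for S R :: real
      using card_inj_tuples_pos[OF n(1)] by (simp only: right_diff_distrib add_divide_distrib) auto
    then show ?thesis unfolding split inj_avg_def .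
  qed
  moreover have "\<bar>(\<Sum>i\<in>?I. ?F i) / ?N * (1 - ?N / ?T)\<bar> \<le> 1 * (1 - ?N / ?T)"
    unfolding abs_mult using S N T NT by (intro mult_mono) auto
  moreover have "\<bar>(\<Sum>i\<in>?E - ?I. ?F i) / ?T\<bar> \<le> 1 - ?N / ?T"
    using rest T by (simp add: field_simps)
  moreover have "\<bar>d\<bar> \<le> 2 * e" if "d = p - r" "\<bar>p\<bar> \<le> 1 * e" "\<bar>r\<bar> \<le> e" for d p r e :: real
    using that by linarith
  ultimately show ?thesis by blast
qed

lemma full_average_step:
  fixes g :: "(nat \<Rightarrow> nat) \<Rightarrow> real"
  assumes c: "coding c" and n: "n > 0"
  shows "(\<Sum>i\<in>{..<m} \<rightarrow>\<^sub>E {..<n}. g (\<lambda>j\<in>{..<m}. c ((\<lambda>j\<in>{..<m}. x (i j)) j))) / real n ^ m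
    = (\<Sum>v\<in>{..<m} \<rightarrow>\<^sub>E range c. g v * (\<Prod>j<m. real (cell_count n c x (v j)) / real n))"
proof -
  have "(\<Sum>i\<in>{..<m} \<rightarrow>\<^sub>E {..<n}. g (\<lambda>j\<in>{..<m}. c ((\<lambda>j\<in>{..<m}. x (i j)) j)))
     = (\<Sum>i\<in>{..<m} \<rightarrow>\<^sub>E {..<n}. \<Sum>v\<in>{..<m} \<rightarrow>\<^sub>E range c. g v * (\<Prod>j<m. of_bool (c (x (i j)) = v j)))"
    unfolding step_fun_expand[OF c, of g] by simp
  also have "\<dots> = (\<Sum>v\<in>{..<m} \<rightarrow>\<^sub>E range c. g v * (\<Sum>i\<in>{..<m} \<rightarrow>\<^sub>E {..<n}. \<Prod>j<m. of_bool (c (x (i j)) = v j)))"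
    by (subst sum.swap) (simp add: sum_distrib_left)
  also have "\<dots> = (\<Sum>v\<in>{..<m} \<rightarrow>\<^sub>E range c. g v * (\<Prod>j<m. real (cell_count n c x (v j))))"
    unfolding cell_count_sum by (subst prod_sum_PiE) auto
  finally show ?thesis
    by (simp add: sum_divide_distrib prod_dividef)
qed

end

text \<open>Absorbs a polynomial number of terms into an arbitrarily small loss of rate; the factor
  2 leaves room for one more summand of the same size.\<close>

lemma poly_times_exp_tendsto_0:
  fixes \<epsilon> :: real
  assumes "\<epsilon> > 0"
  shows "(\<lambda>n. 2 * real (n + 1) ^ k * exp (- (real n * \<epsilon>))) \<longlonglongrightarrow> 0"
proof -
  have "filterlim (\<lambda>n. \<epsilon> * real (n + 1)) at_top sequentially" using assms by real_asymp
  from filterlim_compose[OF tendsto_power_div_exp_0[of k] this]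
  have "(\<lambda>n. 2 * exp \<epsilon> / \<epsilon> ^ k * ((\<epsilon> * real (n + 1)) ^ k / exp (\<epsilon> * real (n + 1)))) \<longlonglongrightarrow> 2 * exp \<epsilon> / \<epsilon> ^ k * 0"
    by (intro tendsto_mult tendsto_const)
  moreover have "2 * exp \<epsilon> / \<epsilon> ^ k * ((\<epsilon> * real (n + 1)) ^ k / exp (\<epsilon> * real (n + 1)))
      = 2 * real (n + 1) ^ k * exp (- (real n * \<epsilon>))" for n
  proof -
    have "exp (\<epsilon> * real (n + 1)) = exp \<epsilon> * exp (real n * \<epsilon>)"
      by (simp add: exp_add[symmetric] algebra_simps)
    then show ?thesis using assms by (simp only: power_mult_distrib exp_minus) (simp add: field_simps)
  qed
  ultimately show ?thesis by simp
qed

context sample_law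
begin

lemma inj_avg_mono_add:
  assumes "\<And>x. f x \<le> g x + h x"
  shows "inj_avg m n f x \<le> inj_avg m n g x + inj_avg m n h x"
  unfolding inj_avg_def add_divide_distrib[symmetric] sum.distrib[symmetric]
  by (intro divide_right_mono sum_mono assms) auto

text \<open>A type that charges a null cell has no cell density; such samples are discarded at no
  cost.\<close>

lemma null_cells:
  assumes c: "coding c"
  shows "measure (DP n) {x \<in> space (DP n). \<exists>i<n. cell_prob c (c (x i)) = 0} = 0"
proof -
  interpret N: prob_space "DP n" by (rule prob_space_DP)
  note [measurable] = cell_prob_measurable[OF c]
  have null: "AE y in D. cell_prob c (c y) \<noteq> 0"
  proof -
    have "(\<integral>y. of_bool (cell_prob c (c y) = 0) \<partial>D) = (\<Sum>l\<in>range c. of_bool (cell_prob c l = 0) * cell_prob c l)"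
      by (rule integral_cells[OF c])
    also have "\<dots> = 0" by (intro sum.neutral) auto
    finally have "AE y in D. of_bool (cell_prob c (c y) = 0) = (0::real)"
      by (subst (asm) integral_nonneg_eq_0_iff_AE) (auto intro!: integrable_bounded[where B=1])
    then show ?thesis by eventually_elim auto
  qed
  have "AE x in DP n. \<forall>i\<in>{..<n}. cell_prob c (c (x i)) \<noteq> 0"
    by (intro AE_finite_allI AE_PiM_component[OF prob_space_axioms _ null]) auto
  then have "AE x in DP n. \<not> (\<exists>i<n. cell_prob c (c (x i)) = 0)"
    by eventually_elim auto
  then show ?thesis
    by (intro N.prob_eq_0[THEN iffD2] ; (simp | measurable)?)
qed

text \<open>The method of types: there are at most \<open>(n + 1) ^ card (range c)\<close> vectors
  of cell counts, and each one compatible with the event has a cell density meeting the relaxed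
  constraint, so \<open>type_prob_bound\<close> applies with entropy at least \<open>K\<close>. The
  slack \<open>e\<close> pays for repeated indices.\<close>

lemma step_upper_bound:
  fixes g :: "(nat \<Rightarrow> nat) \<Rightarrow> real"
  assumes c: "coding c" and g: "\<And>v. \<bar>g v\<bar> \<le> 1" and n: "n > 0" "n \<ge> m"
    and e: "2 * (1 - real (card (inj_tuples m n)) / real n ^ m) \<le> e"
    and H: "\<And>q. (\<And>l. q l \<ge> 0) \<Longrightarrow> (\<Sum>l\<in>range c. q l) = 1 \<Longrightarrow> (\<And>l. q l > 0 \<Longrightarrow> cell_prob c l > 0) \<Longrightarrow>
       (\<integral>x. prod_density m (cell_density c q) x * g (\<lambda>j\<in>{..<m}. c (x j)) \<partial>DP m) \<ge> a - e \<Longrightarrow>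
       rel_ent D (cell_density c q) \<ge> K"
  shows "measure (DP n) {x \<in> space (DP n). inj_avg m n (\<lambda>x. g (\<lambda>j\<in>{..<m}. c (x j))) x \<ge> a}
    \<le> real (n + 1) ^ card (range c) * exp (- (real n * K))"
proof -
  interpret N: prob_space "DP n" by (rule prob_space_DP)
  have fin: "finite (range c)" using c by (simp add: coding_def)
  let ?f = "\<lambda>x. g (\<lambda>j\<in>{..<m}. c (x j))"
  let ?A = "{x \<in> space (DP n). inj_avg m n ?f x \<ge> a}"
  let ?B = "{x \<in> space (DP n). \<exists>i<n. cell_prob c (c (x i)) = 0}"
  let ?T = "\<lambda>k. {x \<in> space (DP n). \<forall>l\<in>range c. cell_count n c x l = k l}"
  \<comment> \<open>Members of the function space are \<open>undefined\<close> outside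
    \<open>range c\<close>; the count there is 0, as \<open>type_prob_bound\<close>
    requires.\<close>
  define ext where "ext k l = (if l \<in> range c then k l else 0)" for k :: "nat \<Rightarrow> nat" and l
  define good where "good k \<longleftrightarrow> (\<Sum>l\<in>range c. k l) = n \<and> (\<forall>l. ext k l > 0 \<longrightarrow> cell_prob c l > 0) \<and>
     (\<integral>x. prod_density m (cell_density c (\<lambda>l. real (ext k l) / real n)) x * ?f x \<partial>DP m) \<ge> a - e" for k
  define G where "G = {k \<in> range c \<rightarrow>\<^sub>E {..n}. good k}"
  note [measurable] = cell_prob_measurable[OF c]
  have finE: "finite (range c \<rightarrow>\<^sub>E {..n})" using fin by (intro finite_PiE) auto
  then have finG: "finite G" by (simp add: G_def)
  have T_meas: "?T k \<in> sets (DP n)" for k by (rule type_sets[OF c])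
  have sub: "?A \<subseteq> ?B \<union> (\<Union>k\<in>G. ?T k)"
  proof
    fix x assume x: "x \<in> ?A"
    show "x \<in> ?B \<union> (\<Union>k\<in>G. ?T k)"
    proof (cases "x \<in> ?B")
      case False
      then have pos: "cell_prob c (c (x i)) > 0" if "i < n" for i
        using that x cell_prob_nonneg[of c "c (x i)"] by (auto simp: less_le)
      define k where "k = restrict (cell_count n c x) (range c)"
      have ext_eq: "ext k l = cell_count n c x l" for l
        by (auto simp: ext_def k_def cell_count_def)
      have "(\<Sum>l\<in>range c. real (cell_count n c x l)) = (\<Sum>i<n. \<Sum>l\<in>range c. 1 * of_bool (c (x i) = l))"
        unfolding cell_count_sum by (subst sum.swap) simp
      also have "\<dots> = real n" unfolding sum_over_cells[OF c, of "\<lambda>_. 1", symmetric] by simp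
      finally have sum_real: "(\<Sum>l\<in>range c. real (cell_count n c x l)) = real n" .
      then have sumk: "(\<Sum>l\<in>range c. k l) = n"
        by (simp add: k_def flip: of_nat_sum)
      have posk: "cell_prob c l > 0" if "ext k l > 0" for l
      proof -
        have "{i. i < n \<and> c (x i) = l} \<noteq> {}"
          using that by (auto simp: ext_eq cell_count_def card_gt_0_iff)
        then show ?thesis using pos by auto
      qed
      have "(\<integral>x. prod_density m (cell_density c (\<lambda>l. real (ext k l) / real n)) x * ?f x \<partial>DP m)
         = (\<Sum>v\<in>{..<m} \<rightarrow>\<^sub>E range c. g v * (\<Prod>j<m. real (ext k (v j)) / real n))"
      proof (rule step_integral_cell[OF c])
        show "(\<Sum>l\<in>range c. real (ext k l) / real n) = 1"
          using sum_real n by (simp add: ext_eq sum_divide_distrib[symmetric])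
        show "cell_prob c l > 0" if "real (ext k l) / real n > 0" for l
          using that posk by (simp add: zero_less_divide_iff)
      qed simp
      also have "\<dots> = (\<Sum>i\<in>{..<m} \<rightarrow>\<^sub>E {..<n}. ?f (\<lambda>j\<in>{..<m}. x (i j))) / real n ^ m"
        unfolding ext_eq using full_average_step[OF c n(1), where m=m and g=g and x=x] by (simp cong: restrict_cong)
      also have "\<dots> \<ge> inj_avg m n ?f x - e"
        using inj_avg_vs_full_average[of ?f m n x, OF g n(2,1)] e by linarith
      finally have "(\<integral>x. prod_density m (cell_density c (\<lambda>l. real (ext k l) / real n)) x * ?f x \<partial>DP m)
          \<ge> inj_avg m n ?f x - e" .
      moreover have "inj_avg m n ?f x \<ge> a" using x by blast
      ultimately have "(\<integral>x. prod_density m (cell_density c (\<lambda>l. real (ext k l) / real n)) x * ?f x \<partial>DP m) \<ge> a - e"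
        by linarith
      then have "good k"
        unfolding good_def using sumk posk by blast
      moreover have "k \<in> range c \<rightarrow>\<^sub>E {..n}"
      proof -
        have "cell_count n c x l \<le> n" for l
          unfolding cell_count_def using card_mono[of "{..<n}" "{i. i < n \<and> c (x i) = l}"] by auto
        then show ?thesis by (auto simp: k_def)
      qed
      ultimately have "k \<in> G" by (simp add: G_def)
      moreover have "x \<in> ?T k" using x by (auto simp: k_def)
      ultimately show ?thesis by blast
    qed simp
  qed
  have B_meas: "?B \<in> sets (DP n)" by measurable
  have U_meas: "(\<Union>k\<in>G. ?T k) \<in> sets (DP n)" by (rule sets.finite_UN[OF finG T_meas])
  have "measure (DP n) ?A \<le> measure (DP n) (?B \<union> (\<Union>k\<in>G. ?T k))"
    by (rule N.finite_measure_mono[OF sub sets.Un[OF B_meas U_meas]])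
  also have "\<dots> \<le> measure (DP n) ?B + measure (DP n) (\<Union>k\<in>G. ?T k)"
    by (rule measure_Un_le[OF B_meas U_meas])
  also have "\<dots> \<le> 0 + (\<Sum>k\<in>G. measure (DP n) (?T k))"
    using null_cells[OF c] by (intro add_mono measure_UNION_le[OF finG T_meas]) simp
  also have "\<dots> \<le> 0 + (\<Sum>k\<in>G. exp (- (real n * K)))"
  proof (intro add_mono sum_mono order_refl)
    fix k assume "k \<in> G"
    then have k: "good k" by (simp add: G_def)
    have "?T k = ?T (ext k)" by (auto simp: ext_def)
    also have "measure (DP n) \<dots> \<le> exp (- (real n * rel_ent D (cell_density c (\<lambda>l. real (ext k l) / real n))))"
      by (rule type_prob_bound[OF c n(1)]) (use k in \<open>auto simp: good_def ext_def cong: sum.cong\<close>)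
    also have "\<dots> \<le> exp (- (real n * K))"
    proof -
      have "rel_ent D (cell_density c (\<lambda>l. real (ext k l) / real n)) \<ge> K"
      proof (rule H)
        have "(\<Sum>l\<in>range c. ext k l) = n" using k by (simp add: good_def ext_def)
        then show "(\<Sum>l\<in>range c. real (ext k l) / real n) = 1"
          using n by (simp add: sum_divide_distrib[symmetric] flip: of_nat_sum)
      qed (use k n in \<open>auto simp: good_def zero_less_divide_iff\<close>)
      then show ?thesis by (simp add: mult_left_mono)
    qed
    finally show "measure (DP n) (?T k) \<le> exp (- (real n * K))" .
  qed
  also have "\<dots> \<le> real (n + 1) ^ card (range c) * exp (- (real n * K))"
  proof -
    have "card G \<le> card (range c \<rightarrow>\<^sub>E {..n})" by (rule card_mono[OF finE]) (auto simp: G_def)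
    also have "\<dots> = (n + 1) ^ card (range c)" using fin by (simp add: card_funcsetE)
    finally have "real (card G) \<le> real ((n + 1) ^ card (range c))" by (rule of_nat_mono)
    then show ?thesis by (simp add: mult_right_mono)
  qed
  finally show ?thesis .
qed

text \<open>There are at least \<open>n / (2 m)\<close> blocks, and each contributes a factor at
  most \<open>exp (- 2 m L)\<close>; the summand 1 in the condition on \<open>r\<close> absorbs the
  moment bound, as \<open>2 \<le> exp 1\<close>.\<close>

lemma inj_avg_superexp_tail:
  fixes f :: "(nat \<Rightarrow> 'b) \<Rightarrow> real"
  assumes f: "f \<in> borel_measurable (DP m)" "\<And>x. \<bar>f x\<bar> \<le> B" and m: "m \<ge> 1" "m \<le> n"
    and r: "r \<ge> 0" "r * c \<ge> 2 * real m * L + 1" and mgf: "(\<integral>x. exp (r * f x) \<partial>DP m) \<le> 2" and L: "L \<ge> 0"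
  shows "avg_tail m f n c \<le> exp (- (real n * L))"
proof -
  define k where "k = n div m"
  have k: "k * m \<le> n" "k \<ge> 1"
    using m by (auto simp: k_def Suc_le_eq div_greater_zero_iff)
  have "n < (k + 1) * m"
    using m dividend_less_div_times[of m n] by (simp add: k_def algebra_simps)
  also have "\<dots> \<le> 2 * k * m" using k by (intro mult_right_mono) auto
  finally have "real n \<le> real (2 * k * m)" by linarith
  then have nk: "real n \<le> 2 * real m * real k" by (simp add: mult_ac)
  have "avg_tail m f n c
      \<le> (exp (- (r * c)) * (\<integral>x. exp (r * f x) \<partial>DP m)) ^ k"
    by (rule inj_avg_tail[OF f m(1) k r(1)])
  also have "\<dots> \<le> (exp (- (2 * real m * L))) ^ k"
  proof (rule power_mono)
    have "exp (- (r * c)) * (\<integral>x. exp (r * f x) \<partial>DP m) \<le> exp (- (2 * real m * L) - 1) * exp 1"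
      using r mgf exp_ge_add_one_self[of 1] by (intro mult_mono) auto
    then show "exp (- (r * c)) * (\<integral>x. exp (r * f x) \<partial>DP m) \<le> exp (- (2 * real m * L))"
      by (simp add: mult_exp_exp)
  qed simp
  also have "\<dots> = exp (- (2 * real m * real k * L))"
    by (simp add: exp_of_nat_mult[symmetric] mult_ac)
  also have "\<dots> \<le> exp (- (real n * L))"
    using mult_right_mono[OF nk L] by simp
  finally show ?thesis .
qed

text \<open>From \<open>exp y \<le> 1 + y exp y\<close>: for a bounded kernel, smallness in L1 alone
  permits an arbitrarily large \<open>r\<close>. Hence an L1 approximation error has tails of any
  prescribed exponential rate.\<close>

lemma exp_integral_le_2:
  fixes f :: "(nat \<Rightarrow> 'b) \<Rightarrow> real"
  assumes f: "f \<in> borel_measurable (DP m)" "\<And>x. \<bar>f x\<bar> \<le> B" and r: "r \<ge> 0" "r * B \<le> b"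
    and small: "r * exp b * (\<integral>x. \<bar>f x\<bar> \<partial>DP m) \<le> 1"
  shows "(\<integral>x. exp (r * f x) \<partial>DP m) \<le> 2"
proof -
  interpret S: prob_space "DP m" by (rule prob_space_DP)
  note [measurable] = f(1)
  have i: "integrable (DP m) (\<lambda>x. \<bar>f x\<bar>)" using S.integrable_bounded[OF f] by simp
  have le: "r * f x \<le> b" for x
    using mult_left_mono[OF abs_le_D1[OF f(2)] r(1)] r(2) order_trans by blast
  have "(\<integral>x. exp (r * f x) \<partial>DP m) \<le> (\<integral>x. 1 + r * exp b * \<bar>f x\<bar> \<partial>DP m)"
  proof (rule integral_mono)
    show "integrable (DP m) (\<lambda>x. exp (r * f x))"
      using le by (intro S.integrable_bounded[where B="exp b"]) auto
    show "integrable (DP m) (\<lambda>x. 1 + r * exp b * \<bar>f x\<bar>)" using i by simp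
    fix x
    let ?y = "r * f x"
    have "1 - ?y \<le> exp (- ?y)" using exp_ge_add_one_self[of "- ?y"] by simp
    then have "(1 - ?y) * exp ?y \<le> exp (- ?y) * exp ?y" by (rule mult_right_mono) simp
    then have "exp ?y \<le> 1 + ?y * exp ?y" by (simp add: mult_exp_exp algebra_simps)
    also have "?y * exp ?y \<le> \<bar>?y\<bar> * exp b" using le[of x] by (intro mult_mono) auto
    finally show "exp (r * f x) \<le> 1 + r * exp b * \<bar>f x\<bar>" using r by (simp add: abs_mult mult_ac)
  qed
  also have "\<dots> = 1 + r * exp b * (\<integral>x. \<bar>f x\<bar> \<partial>DP m)" using i by (simp add: S.prob_space)
  finally show ?thesis using small by simp
qed

text \<open>The slack \<open>d\<close> is spent in thirds: on the approximation error in the sample,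
  on repeated indices, and on the approximation error under the tilted law.\<close>

lemma inj_avg_upper_bound:
  fixes f :: "(nat \<Rightarrow> 'b) \<Rightarrow> real"
  assumes f: "f \<in> borel_measurable (DP m)" "\<And>x. \<bar>f x\<bar> \<le> 1" and m: "m \<ge> 1" and d: "d > 0"
    and H: "\<And>w. bounded_density D w \<Longrightarrow> (\<integral>x. prod_density m w x * f x \<partial>DP m) \<ge> a - d \<Longrightarrow> rel_ent D w \<ge> K"
    and eps: "\<epsilon> > 0"
  shows "\<forall>\<^sub>F n in sequentially.
    avg_tail m f n a \<le> exp (- (real n * (K - \<epsilon>)))"
proof -
  interpret S: prob_space "DP m" by (rule prob_space_DP)
  define L where "L = max K 1"
  have L: "L \<ge> 1" "K \<le> L" by (auto simp: L_def)
  \<comment> \<open>\<open>r\<close> gives the approximation error the rate \<open>L\<close> at the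
    level \<open>d / 3\<close>; \<open>e0\<close> is then so small that its exponential moment at
    this \<open>r\<close> is at most 2.\<close>
  define r where "r = 3 * (2 * real m * L + 1) / d"
  have r: "r > 0" "r * (d / 3) = 2 * real m * L + 1" using d L m by (auto simp: r_def add_pos_pos)
  define e0 where "e0 = 1 / (r * exp (2 * r))"
  have e0: "e0 > 0" using r by (simp add: e0_def)
  obtain c g where c: "coding c" and g: "\<And>v. \<bar>g v\<bar> \<le> 1"
    and close: "(\<integral>x. \<bar>f x - g (\<lambda>j\<in>{..<m}. c (x j))\<bar> \<partial>DP m) < e0"
    using step_approximation[OF f e0] by blast
  let ?g = "\<lambda>x. g (\<lambda>j\<in>{..<m}. c (x j))"
  let ?h = "\<lambda>x. \<bar>f x - ?g x\<bar>"
  have "step_fun m ?g" unfolding step_fun_def using c by blast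
  then have gm[measurable]: "?g \<in> borel_measurable (DP m)" by (rule step_fun_measurable)
  note [measurable] = f(1)
  have hm: "?h \<in> borel_measurable (DP m)" by measurable
  have hb: "\<bar>?h x\<bar> \<le> 2" for x using f(2)[of x] g[of "\<lambda>j\<in>{..<m}. c (x j)"] by linarith
  have mgf: "(\<integral>x. exp (r * ?h x) \<partial>DP m) \<le> 2"
  proof (rule exp_integral_le_2[OF hm hb])
    show "r * exp (2 * r) * (\<integral>x. \<bar>?h x\<bar> \<partial>DP m) \<le> 1"
      using close r by (simp add: e0_def field_simps)
  qed (use r in auto)
  have tail: "avg_tail m ?h n (d / 3) \<le> exp (- (real n * L))" if "n \<ge> m" for n
    by (rule inj_avg_superexp_tail[OF hm hb m that _ _ mgf]) (use r L in auto)
  have K_cell: "rel_ent D w \<ge> K" if w: "bounded_density D w"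
    and ge: "(\<integral>x. prod_density m w x * ?g x \<partial>DP m) \<ge> (a - d / 3) - d / 3" for w
  \<comment> \<open>A density of entropy above \<open>L\<close> has entropy above \<open>K\<close>
    as well. Otherwise the Gibbs inequality bounds the mean of \<open>?h\<close> under the tilted
    law by \<open>d / 3\<close>.\<close>
  proof (cases "rel_ent D w \<le> L")
    case True
    note pw = bounded_density_prod[OF w, of m]
    have "(\<integral>x. prod_density m w x * (r * ?h x) \<partial>DP m)
       \<le> rel_ent (DP m) (prod_density m w) + ((\<integral>x. exp (r * ?h x) \<partial>DP m) - 1)"
      using hb r by (intro S.gibbs[OF pw, where B="r * 2"]) (auto simp: abs_mult mult_left_mono)
    also have "\<dots> \<le> real m * L + 1"
      using mgf True by (simp add: rel_ent_prod[OF w] add_mono mult_left_mono)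
    also have "\<dots> \<le> r * (d / 3)" using L unfolding r(2) by (simp add: mult_right_mono)
    finally have "r * (\<integral>x. prod_density m w x * ?h x \<partial>DP m) \<le> r * (d / 3)"
      by (simp add: mult.left_commute)
    then have h3: "(\<integral>x. prod_density m w x * ?h x \<partial>DP m) \<le> d / 3" using r(1) by simp
    have "(\<integral>x. prod_density m w x * ?g x \<partial>DP m)
       \<le> (\<integral>x. prod_density m w x * f x + prod_density m w x * ?h x \<partial>DP m)"
    proof (rule integral_mono)
      show "integrable (DP m) (\<lambda>x. prod_density m w x * ?g x)"
        by (rule S.integrable_bounded_density_mult[OF pw gm]) (rule g)
      show "integrable (DP m) (\<lambda>x. prod_density m w x * f x + prod_density m w x * ?h x)"
        by (intro Bochner_Integration.integrable_add S.integrable_bounded_density_mult[OF pw f]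
              S.integrable_bounded_density_mult[OF pw hm hb])
      fix x
      show "prod_density m w x * ?g x \<le> prod_density m w x * f x + prod_density m w x * ?h x"
        unfolding distrib_left[symmetric] by (intro mult_left_mono bounded_densityD(2)[OF pw]) linarith
    qed
    also have "\<dots> = (\<integral>x. prod_density m w x * f x \<partial>DP m) + (\<integral>x. prod_density m w x * ?h x \<partial>DP m)"
      by (intro Bochner_Integration.integral_add S.integrable_bounded_density_mult[OF pw f]
            S.integrable_bounded_density_mult[OF pw hm hb])
    finally have "(\<integral>x. prod_density m w x * f x \<partial>DP m) \<ge> a - d" using ge h3 by linarith
    then show ?thesis by (rule H[OF w])
  qed (use L in auto)
  have "(\<lambda>n. 2 * (1 - real (card (inj_tuples m n)) / real n ^ m)) \<longlonglongrightarrow> 2 * (1 - 1)"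
    by (intro tendsto_intros card_inj_tuples_ratio)
  then have ev1: "\<forall>\<^sub>F n in sequentially. 2 * (1 - real (card (inj_tuples m n)) / real n ^ m) < d / 3"
    using d by (intro order_tendstoD(2)) auto
  let ?R = "card (range c)"
  have "(\<lambda>n. 2 * real (n + 1) ^ ?R * exp (- (real n * \<epsilon>))) \<longlonglongrightarrow> 0"
    using eps by (rule poly_times_exp_tendsto_0)
  then have ev2: "\<forall>\<^sub>F n in sequentially. 2 * real (n + 1) ^ ?R * exp (- (real n * \<epsilon>)) < 1"
    by (intro order_tendstoD(2)) auto
  show ?thesis
    using ev1 ev2 eventually_ge_at_top[of m]
  proof eventually_elim
    case (elim n)
    interpret N: prob_space "DP n" by (rule prob_space_DP)
    have n: "n > 0" using elim(3) m by simp
    have step: "avg_tail m ?g n (a - d / 3)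
        \<le> real (n + 1) ^ ?R * exp (- (real n * K))"
    proof (rule step_upper_bound[OF c g n elim(3), where e="d / 3"])
      fix q :: "nat \<Rightarrow> real"
      assume q: "\<And>l. q l \<ge> 0" "(\<Sum>l\<in>range c. q l) = 1" "\<And>l. q l > 0 \<Longrightarrow> cell_prob c l > 0"
        and ge: "(\<integral>x. prod_density m (cell_density c q) x * ?g x \<partial>DP m) \<ge> a - d / 3 - d / 3"
      show "rel_ent D (cell_density c q) \<ge> K"
        by (rule K_cell[OF bounded_density_cell[OF c q] ge])
    qed (use elim(1) in auto)
    have "{x \<in> space (DP n). inj_avg m n f x \<ge> a}
       \<subseteq> {x \<in> space (DP n). inj_avg m n ?h x \<ge> d / 3} \<union> {x \<in> space (DP n). inj_avg m n ?g x \<ge> a - d / 3}"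
    proof
      fix x assume x: "x \<in> {x \<in> space (DP n). inj_avg m n f x \<ge> a}"
      have "inj_avg m n f x \<le> inj_avg m n ?g x + inj_avg m n ?h x"
        by (rule inj_avg_mono_add) linarith
      with x show "x \<in> {x \<in> space (DP n). inj_avg m n ?h x \<ge> d / 3} \<union> {x \<in> space (DP n). inj_avg m n ?g x \<ge> a - d / 3}"
        by auto
    qed
    then have "avg_tail m f n a
       \<le> measure (DP n) ({x \<in> space (DP n). inj_avg m n ?h x \<ge> d / 3} \<union> {x \<in> space (DP n). inj_avg m n ?g x \<ge> a - d / 3})"
      by (intro N.finite_measure_mono) measurable
    also have "\<dots> \<le> avg_tail m ?h n (d / 3)
        + avg_tail m ?g n (a - d / 3)"
      by (intro measure_Un_le) measurable
    also have "\<dots> \<le> exp (- (real n * L)) + real (n + 1) ^ ?R * exp (- (real n * K))"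
      by (intro add_mono tail step elim)
    also have "\<dots> \<le> real (n + 1) ^ ?R * exp (- (real n * K)) + real (n + 1) ^ ?R * exp (- (real n * K))"
    proof (rule add_right_mono)
      have "exp (- (real n * L)) \<le> 1 * exp (- (real n * K))" using L by (simp add: mult_left_mono)
      also have "\<dots> \<le> real (n + 1) ^ ?R * exp (- (real n * K))"
        by (intro mult_right_mono one_le_power) auto
      finally show "exp (- (real n * L)) \<le> real (n + 1) ^ ?R * exp (- (real n * K))" .
    qed
    also have "\<dots> = (2 * real (n + 1) ^ ?R * exp (- (real n * \<epsilon>))) * exp (- (real n * (K - \<epsilon>)))"
      by (simp add: mult.assoc mult_exp_exp algebra_simps)
    also have "\<dots> \<le> 1 * exp (- (real n * (K - \<epsilon>)))"
      using elim(2) by (intro mult_right_mono) auto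
    finally show ?case by simp
  qed
qed

section \<open>Projections and small deviations\<close>

definition admissible :: "nat \<Rightarrow> ((nat \<Rightarrow> 'b) \<Rightarrow> real) \<Rightarrow> bool" where
  "admissible m f \<longleftrightarrow> m \<ge> 1 \<and> f \<in> borel_measurable (DP m) \<and> (\<forall>x. \<bar>f x\<bar> \<le> 1) \<and>
     (\<forall>\<pi> x. \<pi> permutes {..<m} \<and> x \<in> {..<m} \<rightarrow>\<^sub>E UNIV \<longrightarrow> f (x \<circ> \<pi>) = f x) \<and> (\<integral>x. f x \<partial>DP m) = 0"

text \<open>The coordinates of \<open>PiM {1..<m}\<close> are the arguments that are integrated out, so \<open>kproj m f s\<close> is the
  conditional expectation of \<open>f\<close> given that the first argument is \<open>s\<close>.\<close>

definition kproj :: "nat \<Rightarrow> ((nat \<Rightarrow> 'b) \<Rightarrow> real) \<Rightarrow> 'b \<Rightarrow> real" where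
  "kproj m f s = (\<integral>x. f (x(0 := s)) \<partial>PiM {1..<m} (\<lambda>_. D))"

definition kvar :: "nat \<Rightarrow> ((nat \<Rightarrow> 'b) \<Rightarrow> real) \<Rightarrow> real" where
  "kvar m f = (\<integral>s. (kproj m f s)\<^sup>2 \<partial>D)"

definition tilted_mean :: "nat \<Rightarrow> ((nat \<Rightarrow> 'b) \<Rightarrow> real) \<Rightarrow> ('b \<Rightarrow> real) \<Rightarrow> real" where
  "tilted_mean m f w = (\<integral>x. prod_density m w x * f x \<partial>DP m)"

context
  fixes m f
  assumes m: "m \<ge> 1" and f: "f \<in> borel_measurable (DP m)" and bnd: "\<And>x. \<bar>f x\<bar> \<le> (1::real)"
begin

lemma insert_zero: "{..<m} = insert 0 {1..<m}"
  using m by auto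

lemma measurable_insert_zero:
  "(\<lambda>p. f ((snd p)(0 := fst p))) \<in> borel_measurable (D \<Otimes>\<^sub>M PiM {1..<m} (\<lambda>_. D))"
proof -
  have "(\<lambda>p. (snd p)(0 := fst p)) \<in> measurable (D \<Otimes>\<^sub>M PiM {1..<m} (\<lambda>_. D)) (PiM (insert 0 {1..<m}) (\<lambda>_. D))"
    by (intro measurable_fun_upd[where J="{1..<m}"]) auto
  then show ?thesis using measurable_compose[OF _ f] unfolding insert_zero by blast
qed

lemma kproj_measurable [measurable]: "kproj m f \<in> borel_measurable D"
proof -
  interpret R: prob_space "PiM {1..<m} (\<lambda>_. D)" by (intro prob_space_PiM prob_space_axioms)
  show ?thesis
    unfolding kproj_def
    using R.borel_measurable_lebesgue_integral[of "\<lambda>s x. f (x(0 := s))" D] measurable_insert_zero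
    by (simp add: case_prod_beta')
qed

lemma kproj_bound: "\<bar>kproj m f s\<bar> \<le> 1"
proof -
  interpret R: prob_space "PiM {1..<m} (\<lambda>_. D)" by (intro prob_space_PiM prob_space_axioms)
  have "\<bar>kproj m f s\<bar> \<le> (\<integral>x. \<bar>f (x(0 := s))\<bar> \<partial>PiM {1..<m} (\<lambda>_. D))"
    unfolding kproj_def by (rule integral_abs_bound)
  also have "\<dots> \<le> (\<integral>x. 1 \<partial>PiM {1..<m} (\<lambda>_. D))"
    by (rule integral_mono'[OF R.integrable_const]) (use bnd in auto)
  finally have "\<bar>kproj m f s\<bar> \<le> (\<integral>x. 1 \<partial>PiM {1..<m} (\<lambda>_. D))" .
  also have "\<dots> = 1" using R.prob_space by (simp del: One_nat_def)
  finally show ?thesis .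
qed

text \<open>Fubini. Testing against functions of the first argument is what later identifies
  \<open>kproj\<close> with the conditional expectation.\<close>

lemma integral_kproj:
  fixes g :: "'b \<Rightarrow> real"
  assumes g[measurable]: "g \<in> borel_measurable D" "\<And>s. \<bar>g s\<bar> \<le> B"
  shows "(\<integral>x. f x * g (x 0) \<partial>DP m) = (\<integral>s. kproj m f s * g s \<partial>D)"
proof -
  interpret R: prob_space "PiM {1..<m} (\<lambda>_. D)" by (intro prob_space_PiM prob_space_axioms)
  interpret S: prob_space "DP m" by (rule prob_space_DP)
  interpret Q: pair_prob_space D "PiM {1..<m} (\<lambda>_. D)" ..
  have b: "\<bar>f x * g s\<bar> \<le> 1 * B" for x s
    unfolding abs_mult using bnd g(2) by (intro mult_mono) auto
  have "0 < m" using m by simp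
  have i1: "integrable (DP m) (\<lambda>x. f x * g (x 0))"
    using f g(1) b \<open>0 < m\<close>
    by (intro S.integrable_bounded[where B="1 * B"] borel_measurable_times
        measurable_compose[OF measurable_component_singleton[of 0 "{..<m}" "\<lambda>_. D"]]) auto
  have i2: "integrable (D \<Otimes>\<^sub>M PiM {1..<m} (\<lambda>_. D)) (\<lambda>(s, x). f (x(0 := s)) * g s)"
    using measurable_insert_zero g(1) b
    by (intro Q.integrable_bounded[where B="1 * B"]) (auto simp: case_prod_beta')
  have "(\<integral>x. f x * g (x 0) \<partial>DP m) = (\<integral>x. (\<integral>s. f (x(0 := s)) * g s \<partial>D) \<partial>PiM {1..<m} (\<lambda>_. D))"
    using P.product_integral_insert[of "{1..<m}" 0 "\<lambda>x. f x * g (x 0)"] i1 unfolding insert_zero by simp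
  also have "\<dots> = (\<integral>s. (\<integral>x. f (x(0 := s)) * g s \<partial>PiM {1..<m} (\<lambda>_. D)) \<partial>D)"
    by (rule Q.Fubini_integral[OF i2])
  finally show ?thesis by (simp add: kproj_def)
qed

end

lemma admissibleD:
  assumes "admissible m f"
  shows "m \<ge> 1" "f \<in> borel_measurable (DP m)" "\<And>x. \<bar>f x\<bar> \<le> 1" "(\<integral>x. f x \<partial>DP m) = 0"
  using assms by (auto simp: admissible_def)

lemma kvar_bounds:
  assumes f: "admissible m f"
  shows "0 \<le> kvar m f" "kvar m f \<le> 1"
proof -
  note [measurable] = kproj_measurable[OF admissibleD(1-3)[OF f]]
  show "0 \<le> kvar m f" by (simp add: kvar_def)
  have "kvar m f \<le> (\<integral>s. 1 \<partial>D)"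
    unfolding kvar_def using kproj_bound[OF admissibleD(1-3)[OF f]]
    by (intro integral_mono') (auto simp: abs_square_le_1)
  then show "kvar m f \<le> 1" by (simp add: prob_space)
qed

lemma kproj_centred:
  assumes "admissible m f"
  shows "(\<integral>s. kproj m f s \<partial>D) = 0"
  using integral_kproj[OF admissibleD(1-3)[OF assms], of "\<lambda>_. 1" 1] admissibleD(4)[OF assms] by simp

text \<open>Symmetry of \<open>f\<close> under the transposition of 0 and \<open>j\<close> carries
  \<open>integral_kproj\<close> to every coordinate.\<close>

lemma integral_kproj_coordinate:
  fixes g :: "'b \<Rightarrow> real"
  assumes f: "admissible m f" and g[measurable]: "g \<in> borel_measurable D" "\<And>s. \<bar>g s\<bar> \<le> B" and j: "j < m"
  shows "(\<integral>x. f x * g (x j) \<partial>DP m) = (\<integral>s. kproj m f s * g s \<partial>D)"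
proof -
  let ?t = "Transposition.transpose 0 j"
  have t: "?t permutes {..<m}" using j by (intro permutes_swap_id) auto
  have m0: "0 < m" using j by simp
  have meas: "(\<lambda>x. f x * g (x 0)) \<in> borel_measurable (DP m)"
    using admissibleD(2)[OF f] g(1) m0
    by (intro borel_measurable_times measurable_compose[OF measurable_component_singleton[of 0 "{..<m}" "\<lambda>_. D"]]) auto
  have "(\<integral>x. f x * g (x 0) \<partial>DP m) = (\<integral>x. f (\<lambda>i\<in>{..<m}. x (?t i)) * g ((\<lambda>i\<in>{..<m}. x (?t i)) 0) \<partial>DP m)"
    using permutes_in_image[OF t] permutes_inj_on[OF t]
    by (intro integral_select[symmetric, OF _ _ meas]) auto
  also have "\<dots> = (\<integral>x. f x * g (x j) \<partial>DP m)"
  proof (rule Bochner_Integration.integral_cong[OF refl])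
    fix x assume x: "x \<in> space (DP m)"
    have "(\<lambda>i\<in>{..<m}. x (?t i)) = x \<circ> ?t"
      using x permutes_in_image[OF t] by (auto simp: fun_eq_iff space_PiM PiE_def extensional_def)
    moreover have "f (x \<circ> ?t) = f x"
      using f t x by (auto simp: admissible_def space_PiM PiE_def)
    ultimately show "f (\<lambda>i\<in>{..<m}. x (?t i)) * g ((\<lambda>i\<in>{..<m}. x (?t i)) 0) = f x * g (x j)"
      using m0 by simp
  qed
  finally show ?thesis using integral_kproj[OF admissibleD(1-3)[OF f] g] by simp
qed

text \<open>Integrate \<open>prod_density_expansion\<close> against \<open>f\<close>, bounded by 1;
  by symmetry the \<open>m\<close> linear terms coincide.\<close>

lemma tilted_mean_expansion:
  assumes f: "admissible m f" and u: "bounded_density D u" and w: "bounded_density D w"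
  shows "\<bar>tilted_mean m f u - tilted_mean m f w - real m * (\<integral>s. kproj m f s * (u s - w s) \<partial>D)\<bar>
    \<le> (real m)\<^sup>2 * (dist1 u w * (dist1 u (\<lambda>_. 1) + dist1 w (\<lambda>_. 1)))"
proof -
  interpret S: prob_space "DP m" by (rule prob_space_DP)
  note fm[measurable] = admissibleD(2)[OF f] and fb = admissibleD(3)[OF f]
  note [measurable] = bounded_densityD(1)[OF u] bounded_densityD(1)[OF w]
  note pu = bounded_density_prod[OF u, of m] and pw = bounded_density_prod[OF w, of m]
  obtain bu where bu: "\<And>x. \<bar>u x\<bar> \<le> bu" using u bounded_density_bound by blast
  obtain bw where bw: "\<And>x. \<bar>w x\<bar> \<le> bw" using w bounded_density_bound by blast
  have uw: "\<bar>u x - w x\<bar> \<le> bu + bw" for x using bu[of x] bw[of x] by linarith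
  let ?s = "\<lambda>x. \<Sum>j<m. u (x j) - w (x j)"
  let ?R = "\<lambda>x. prod_density m u x - prod_density m w x - ?s x"
  have iu: "integrable (DP m) (\<lambda>x. prod_density m u x * f x)"
    and iw: "integrable (DP m) (\<lambda>x. prod_density m w x * f x)"
    by (rule S.integrable_bounded_density_mult[OF pu fm fb], rule S.integrable_bounded_density_mult[OF pw fm fb])
  have ij: "integrable (DP m) (\<lambda>x. f x * (u (x j) - w (x j)))" if "j < m" for j
  proof (rule S.integrable_bounded[where B="1 * (bu + bw)"])
    show "(\<lambda>x. f x * (u (x j) - w (x j))) \<in> borel_measurable (DP m)" using that fm
      by (intro borel_measurable_times borel_measurable_diff
          measurable_compose[OF measurable_component_singleton[of j "{..<m}" "\<lambda>_. D"]]
          bounded_densityD(1)[OF u] bounded_densityD(1)[OF w]) auto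
    show "\<bar>f x * (u (x j) - w (x j))\<bar> \<le> 1 * (bu + bw)" for x
      unfolding abs_mult using fb uw by (intro mult_mono) auto
  qed
  have isum: "integrable (DP m) (\<lambda>x. f x * ?s x)"
    unfolding sum_distrib_left using ij by (intro Bochner_Integration.integrable_sum) auto
  have es: "(\<integral>x. f x * ?s x \<partial>DP m) = real m * (\<integral>s. kproj m f s * (u s - w s) \<partial>D)"
  proof -
    have "(\<integral>x. f x * ?s x \<partial>DP m) = (\<Sum>j<m. \<integral>x. f x * (u (x j) - w (x j)) \<partial>DP m)"
      unfolding sum_distrib_left using ij by (intro Bochner_Integration.integral_sum) auto
    also have "\<dots> = (\<Sum>j<m. \<integral>s. kproj m f s * (u s - w s) \<partial>D)"
      by (intro sum.cong refl integral_kproj_coordinate[OF f _ uw]) auto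
    finally show ?thesis by simp
  qed
  have s_int: "integrable (DP m) ?s"
    using uw by (intro Bochner_Integration.integrable_sum S.integrable_bounded[where B="bu + bw"]) auto
  have iR: "integrable (DP m) ?R"
    using S.integrable_bounded_density[OF pu] S.integrable_bounded_density[OF pw] s_int
    by (intro Bochner_Integration.integrable_diff)
  have "tilted_mean m f u - tilted_mean m f w - real m * (\<integral>s. kproj m f s * (u s - w s) \<partial>D)
     = (\<integral>x. prod_density m u x * f x - prod_density m w x * f x - f x * ?s x \<partial>DP m)"
    unfolding tilted_mean_def es[symmetric] using iu iw isum by simp
  also have "\<dots> = (\<integral>x. f x * ?R x \<partial>DP m)"
    by (simp add: algebra_simps)
  also have "\<bar>\<dots>\<bar> \<le> (\<integral>x. \<bar>?R x\<bar> \<partial>DP m)"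
  proof -
    have "\<bar>f x * ?R x\<bar> \<le> \<bar>?R x\<bar>" for x
      using mult_right_mono[OF fb abs_ge_zero[of "?R x"]] by (simp add: abs_mult)
    then have "(\<integral>x. \<bar>f x * ?R x\<bar> \<partial>DP m) \<le> (\<integral>x. \<bar>?R x\<bar> \<partial>DP m)"
      using iR by (intro integral_mono') auto
    then show ?thesis using integral_abs_bound[of "DP m" "\<lambda>x. f x * ?R x"] by linarith
  qed
  also have "\<dots> \<le> (real m)\<^sup>2 * (dist1 u w * (dist1 u (\<lambda>_. 1) + dist1 w (\<lambda>_. 1)))"
    by (rule prod_density_expansion[OF u w])
  finally show ?thesis .
qed

lemma tilted_mean_linearization:
  assumes f: "admissible m f" and u: "bounded_density D u"
  shows "\<bar>tilted_mean m f u - real m * (\<integral>s. kproj m f s * u s \<partial>D)\<bar> \<le> (real m)\<^sup>2 * (dist1 u (\<lambda>_. 1))\<^sup>2"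
proof -
  have "(\<integral>s. kproj m f s * (u s - 1) \<partial>D) = (\<integral>s. u s * kproj m f s - kproj m f s \<partial>D)"
    by (simp add: algebra_simps)
  also have "\<dots> = (\<integral>s. kproj m f s * u s \<partial>D)"
    using integrable_bounded_density_mult[OF u kproj_measurable[OF admissibleD(1-3)[OF f]] kproj_bound[OF admissibleD(1-3)[OF f]]]
      integrable_bounded[OF kproj_measurable[OF admissibleD(1-3)[OF f]] kproj_bound[OF admissibleD(1-3)[OF f]]]
      kproj_centred[OF f] by (simp add: mult.commute)
  finally show ?thesis
    using tilted_mean_expansion[OF f u bounded_density_one] admissibleD(4)[OF f]
    by (simp add: tilted_mean_def dist1_def power2_eq_square)
qed

lemma kproj_int:
  assumes f: "admissible m f"
  shows "integrable D (kproj m f)" "integrable D (\<lambda>s. (kproj m f s)\<^sup>2)"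
proof -
  note [measurable] = kproj_measurable[OF admissibleD(1-3)[OF f]]
  note b = kproj_bound[OF admissibleD(1-3)[OF f]]
  show "integrable D (kproj m f)" by (rule integrable_bounded[OF _ b]) measurable
  show "integrable D (\<lambda>s. (kproj m f s)\<^sup>2)"
    using b by (intro integrable_bounded[where B=1]) (auto simp: abs_square_le_1)
qed

text \<open>The Gibbs inequality with test function \<open>l * phi\<close> bounds the linear part of
  the mean, and the quadratic remainder is at most \<open>4 m^2\<close> times the entropy. The
  variance enters through an upper bound \<open>s\<close>, so that one estimate serves a whole
  family: \<open>s = V\<close> on \<open>T\<close> and \<open>s = V / 2\<close> off it.\<close>

lemma rel_ent_lower:
  assumes f: "admissible m f" and s: "kvar m f \<le> s" "0 < s" and a: "0 < a" "a \<le> s"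
    and w: "bounded_density D w" "tilted_mean m f w \<ge> a"
  shows "a\<^sup>2 * (1 - a / s) \<le> 2 * (real m)\<^sup>2 * (s + 4 * a) * rel_ent D w"
proof -
  define H where "H = rel_ent D w"
  define M where "M = real m"
  have M: "M \<ge> 1" using admissibleD(1)[OF f] by (simp add: M_def)
  have H0: "H \<ge> 0" by (simp add: H_def rel_ent_nonneg[OF w(1)])
  note [measurable] = kproj_measurable[OF admissibleD(1-3)[OF f]]
  note b = kproj_bound[OF admissibleD(1-3)[OF f]]
  \<comment> \<open>The maximiser of \<open>l * a / M - l^2 * s / 2\<close>.\<close>
  define l where "l = a / (M * s)"
  have l: "0 < l" "l \<le> a / s" "a / s \<le> 1" "l \<le> 1"
  proof -
    show "0 < l" using M s a by (simp add: l_def)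
    show "l \<le> a / s" using M s a by (simp add: l_def frac_le)
    show "a / s \<le> 1" using s a by simp
    then show "l \<le> 1" using \<open>l \<le> a / s\<close> by simp
  qed
  have lb: "\<bar>l * kproj m f x\<bar> \<le> l" for x using b[of x] l by (simp add: abs_mult)
  define E where "E = (\<integral>x. w x * kproj m f x \<partial>D)"
  have mgf: "(\<integral>x. exp (l * kproj m f x) \<partial>D) \<le> 1 + l\<^sup>2 / 2 * (1 + l) * kvar m f"
  proof -
    have "(\<integral>x. exp (l * kproj m f x) \<partial>D) \<le> (\<integral>x. 1 + l * kproj m f x + l\<^sup>2 / 2 * (1 + l) * (kproj m f x)\<^sup>2 \<partial>D)"
    proof (rule integral_mono)
      show "integrable D (\<lambda>x. exp (l * kproj m f x))"
        using abs_le_D1[OF lb] by (intro integrable_bounded[where B="exp l"]) auto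
      show "integrable D (\<lambda>x. 1 + l * kproj m f x + l\<^sup>2 / 2 * (1 + l) * (kproj m f x)\<^sup>2)"
        using kproj_int[OF f] by simp
      fix x
      let ?y = "l * kproj m f x"
      have "\<bar>?y\<bar> ^ 3 = \<bar>?y\<bar> * ?y\<^sup>2" by (simp add: power3_eq_cube power2_eq_square)
      also have "\<dots> \<le> l * ?y\<^sup>2" using lb by (intro mult_right_mono) auto
      finally have "exp ?y \<le> 1 + ?y + ?y\<^sup>2 / 2 + l * ?y\<^sup>2 / 2"
        using exp_le_cubic[of ?y] lb[of x] l by simp
      also have "\<dots> = 1 + ?y + l\<^sup>2 / 2 * (1 + l) * (kproj m f x)\<^sup>2"
        by (simp add: power_mult_distrib field_simps)
      finally show "exp ?y \<le> 1 + ?y + l\<^sup>2 / 2 * (1 + l) * (kproj m f x)\<^sup>2" .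
    qed
    also have "\<dots> = 1 + l\<^sup>2 / 2 * (1 + l) * kvar m f"
      using kproj_int[OF f] kproj_centred[OF f] by (simp add: kvar_def prob_space)
    finally show ?thesis .
  qed
  have "l * E = (\<integral>x. w x * (l * kproj m f x) \<partial>D)" by (simp add: E_def mult.left_commute)
  also have "\<dots> \<le> H + ((\<integral>x. exp (l * kproj m f x) \<partial>D) - 1)"
    unfolding H_def by (rule gibbs[OF w(1) _ lb]) measurable
  also have "\<dots> \<le> H + l\<^sup>2 / 2 * (1 + l) * s"
  proof -
    have "l\<^sup>2 / 2 * (1 + l) * kvar m f \<le> l\<^sup>2 / 2 * (1 + l) * s"
      using s l by (intro mult_left_mono) auto
    with mgf show ?thesis by linarith
  qed
  finally have 1: "l * E \<le> H + l\<^sup>2 / 2 * (1 + l) * s" .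
  have "a \<le> M * E + M\<^sup>2 * (dist1 w (\<lambda>_. 1))\<^sup>2"
    using tilted_mean_linearization[OF f w(1)] w(2) by (simp add: E_def M_def mult.commute)
  also have "\<dots> \<le> M * E + M\<^sup>2 * (4 * H)"
    using dist1_rel_ent[OF w(1)] by (intro add_left_mono mult_left_mono) (auto simp: H_def)
  finally have 2: "a \<le> M * E + M\<^sup>2 * (4 * H)" .
  have aE: "a = l * (M * s)" using M s by (simp add: l_def)
  have "2 * a * (M * E) = 2 * M\<^sup>2 * s * (l * E)" by (simp add: aE power2_eq_square)
  also have "\<dots> \<le> 2 * M\<^sup>2 * s * (H + l\<^sup>2 / 2 * (1 + l) * s)"
    using 1 s by (intro mult_left_mono) auto
  also have "\<dots> = 2 * M\<^sup>2 * s * H + a\<^sup>2 * (1 + l)"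
    by (simp add: aE power2_eq_square algebra_simps)
  also have "\<dots> \<le> 2 * M\<^sup>2 * s * H + a\<^sup>2 * (1 + a / s)"
    using l by (intro add_left_mono mult_left_mono) auto
  finally have 3: "2 * a * (M * E) \<le> 2 * M\<^sup>2 * s * H + a\<^sup>2 * (1 + a / s)" .
  have "2 * a * a \<le> 2 * a * (M * E + M\<^sup>2 * (4 * H))"
    using 2 a by (intro mult_left_mono) auto
  with 3 have "2 * a * a \<le> 2 * M\<^sup>2 * s * H + a\<^sup>2 * (1 + a / s) + 8 * a * M\<^sup>2 * H"
    by (simp add: algebra_simps)
  then show ?thesis by (simp add: H_def[symmetric] M_def[symmetric] power2_eq_square algebra_simps)
qed

text \<open>To first order \<open>1 + c * phi\<close> is the exponential tilt in the direction of
  the gradient, and centring makes it a density without normalisation. The bound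
  \<open>c \<le> 1 / 2\<close> keeps it positive and within the range of
  \<open>xlnx_le_cubic\<close>.\<close>

lemma linear_density:
  assumes f: "admissible m f" and c: "0 \<le> c" "c \<le> 1 / 2"
  defines "r \<equiv> \<lambda>s. 1 + c * kproj m f s"
  shows "bounded_density D r" "rel_ent D r \<le> c\<^sup>2 * kvar m f / 2 * (1 + 2 * c)"
    "dist1 r (\<lambda>_. 1) \<le> c" "(\<integral>s. kproj m f s * r s \<partial>D) = c * kvar m f"
    "tilted_mean m f r \<ge> real m * c * kvar m f - (real m)\<^sup>2 * c\<^sup>2"
proof -
  note [measurable] = kproj_measurable[OF admissibleD(1-3)[OF f]]
  note b = kproj_bound[OF admissibleD(1-3)[OF f]]
  have cb: "\<bar>c * kproj m f x\<bar> \<le> c" for x using b[of x] c by (simp add: abs_mult mult_left_le)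
  show r: "bounded_density D r"
    unfolding bounded_density_def r_def
  proof (intro conjI allI exI)
    show "0 \<le> 1 + c * kproj m f x" "1 + c * kproj m f x \<le> 2" for x
      using cb[of x] c by auto
  qed (use kproj_int[OF f] kproj_centred[OF f] in \<open>auto simp: prob_space\<close>)
  have "rel_ent D r \<le> (\<integral>x. c * kproj m f x + c\<^sup>2 / 2 * (1 + 2 * c) * (kproj m f x)\<^sup>2 \<partial>D)"
    unfolding rel_ent_def
  proof (rule integral_mono[OF integrable_rel_ent[OF r]])
    show "integrable D (\<lambda>x. c * kproj m f x + c\<^sup>2 / 2 * (1 + 2 * c) * (kproj m f x)\<^sup>2)"
      using kproj_int[OF f] by simp
    fix x
    let ?y = "c * kproj m f x"
    have "\<bar>?y\<bar> ^ 3 = \<bar>?y\<bar> * ?y\<^sup>2" by (simp add: power3_eq_cube power2_eq_square)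
    also have "\<dots> \<le> c * ?y\<^sup>2" using cb by (intro mult_right_mono) auto
    finally have "r x * ln (r x) \<le> ?y + ?y\<^sup>2 / 2 + c * ?y\<^sup>2"
      using xlnx_le_cubic[of ?y] cb[of x] c by (simp add: r_def)
    also have "\<dots> = ?y + c\<^sup>2 / 2 * (1 + 2 * c) * (kproj m f x)\<^sup>2"
      by (simp add: power_mult_distrib field_simps)
    finally show "r x * ln (r x) \<le> ?y + c\<^sup>2 / 2 * (1 + 2 * c) * (kproj m f x)\<^sup>2" .
  qed
  also have "\<dots> = c\<^sup>2 * kvar m f / 2 * (1 + 2 * c)"
    using kproj_int[OF f] kproj_centred[OF f] by (simp add: kvar_def)
  finally show "rel_ent D r \<le> c\<^sup>2 * kvar m f / 2 * (1 + 2 * c)" .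
  have "dist1 r (\<lambda>_. 1) \<le> (\<integral>x. c \<partial>D)"
    unfolding dist1_def r_def using cb c by (intro integral_mono') auto
  then show d: "dist1 r (\<lambda>_. 1) \<le> c" by (simp add: prob_space)
  have "(\<integral>s. kproj m f s * r s \<partial>D) = (\<integral>s. kproj m f s + c * (kproj m f s)\<^sup>2 \<partial>D)"
    by (simp add: r_def algebra_simps power2_eq_square)
  also have "\<dots> = c * kvar m f"
    using kproj_int[OF f] kproj_centred[OF f] by (simp add: kvar_def)
  finally show e: "(\<integral>s. kproj m f s * r s \<partial>D) = c * kvar m f" .
  have "(dist1 r (\<lambda>_. 1))\<^sup>2 \<le> c\<^sup>2" using d dist1_nonneg by (intro power_mono) auto
  then have "(real m)\<^sup>2 * (dist1 r (\<lambda>_. 1))\<^sup>2 \<le> (real m)\<^sup>2 * c\<^sup>2" by (rule mult_left_mono) simp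
  then show "tilted_mean m f r \<ge> real m * c * kvar m f - (real m)\<^sup>2 * c\<^sup>2"
    using tilted_mean_linearization[OF f r] unfolding e by (simp add: abs_le_iff mult.assoc)
qed

text \<open>The excess over the leading term in \<open>rel_ent_upper\<close>: the square comes from
  enlarging \<open>c\<close> to offset the quadratic loss in the mean, the second factor from the
  cubic term of the entropy. It tends to 1 with \<open>a\<close>.\<close>

definition upper_factor :: "real \<Rightarrow> real \<Rightarrow> real" where
  "upper_factor V a = (1 + 16 / V\<^sup>2 * a)\<^sup>2 * (1 + 8 * a / V)"

lemma rel_ent_upper:
  assumes f: "admissible m f" and V: "0 < V" "V \<le> 1" "V / 2 < kvar m f" and a: "0 < a" "a \<le> V\<^sup>2 / 16"
  shows "\<exists>w. bounded_density D w \<and> tilted_mean m f w \<ge> a \<and>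
     rel_ent D w \<le> a\<^sup>2 / (2 * (real m)\<^sup>2 * kvar m f) * upper_factor V a"
proof -
  define v where "v = kvar m f"
  define M where "M = real m"
  define \<kappa> where "\<kappa> = 16 / V\<^sup>2"
  \<comment> \<open>The leading choice \<open>a / (M v)\<close> misses the mean \<open>a\<close> by
    the remainder \<open>M^2 * c^2 \<le> \<kappa> * a^2\<close>; the factor
    \<open>1 + \<kappa> * a\<close> makes up for it.\<close>
  define c where "c = a / (M * v) * (1 + \<kappa> * a)"
  have M: "M \<ge> 1" using admissibleD(1)[OF f] by (simp add: M_def)
  have v: "V / 2 < v" "0 < v" using V by (auto simp: v_def)
  have ka: "0 \<le> \<kappa> * a" "\<kappa> * a \<le> 1" using a V by (auto simp: \<kappa>_def field_simps)
  have "V\<^sup>2 \<le> V" using V by (simp add: power2_eq_square mult_left_le)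
  then have aV: "a \<le> V / 16" using a by simp
  have c0: "0 \<le> c" using M v a ka by (simp add: c_def)
  have "c \<le> a / (1 * (V / 2)) * 2"
    unfolding c_def using M v a ka V by (intro mult_mono divide_left_mono mult_pos_pos) auto
  then have c1: "c \<le> 4 * a / V" by simp
  also have "\<dots> \<le> 1 / 2" using aV V by (simp add: field_simps)
  finally have c2: "c \<le> 1 / 2" .
  let ?r = "\<lambda>s. 1 + c * kproj m f s"
  note L = linear_density[OF f c0 c2]
  have Mc: "M * c * v = a * (1 + \<kappa> * a)" using M v by (simp add: c_def)
  have "M\<^sup>2 * c\<^sup>2 = (M * c * v)\<^sup>2 / v\<^sup>2" using v by (simp add: power_mult_distrib)
  also have "\<dots> = a\<^sup>2 * (1 + \<kappa> * a)\<^sup>2 / v\<^sup>2" by (simp add: Mc power_mult_distrib)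
  also have "\<dots> \<le> a\<^sup>2 * 4 / (V / 2)\<^sup>2"
  proof (intro frac_le mult_left_mono)
    have "(1 + \<kappa> * a)\<^sup>2 \<le> 2\<^sup>2" using ka by (intro power_mono) auto
    then show "(1 + \<kappa> * a)\<^sup>2 \<le> 4" by simp
    show "(V / 2)\<^sup>2 \<le> v\<^sup>2" using v V by (intro power_mono) auto
  qed (use V in auto)
  also have "\<dots> = \<kappa> * a\<^sup>2" by (simp add: \<kappa>_def power_divide)
  finally have "M\<^sup>2 * c\<^sup>2 \<le> \<kappa> * a\<^sup>2" .
  then have t: "tilted_mean m f ?r \<ge> a"
    using L(5) Mc unfolding M_def[symmetric] v_def[symmetric] by (simp add: power2_eq_square algebra_simps)
  have "rel_ent D ?r \<le> c\<^sup>2 * v / 2 * (1 + 2 * c)" using L(2) by (simp add: v_def)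
  also have "\<dots> \<le> c\<^sup>2 * v / 2 * (1 + 8 * a / V)"
    using c1 v by (intro mult_left_mono) auto
  also have "c\<^sup>2 * v / 2 = a\<^sup>2 / (2 * M\<^sup>2 * v) * (1 + \<kappa> * a)\<^sup>2"
    using M v by (simp add: c_def power_mult_distrib power_divide power2_eq_square field_simps)
  finally have "rel_ent D ?r \<le> a\<^sup>2 / (2 * M\<^sup>2 * v) * upper_factor V a"
    by (simp add: upper_factor_def \<kappa>_def mult.assoc)
  then show ?thesis using L(1) t unfolding M_def v_def by blast
qed

text \<open>The solution of \<open>c * (1 + 6 m) = V / 4\<close>: in \<open>tilted_mean_push\<close>
  the losses \<open>c\<close> and \<open>6 m c\<close> are set against a variance above
  \<open>V / 2\<close> and leave at least \<open>V / 4\<close>.\<close>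

definition push_const :: "nat \<Rightarrow> real \<Rightarrow> real" where
  "push_const m V = V / (4 * (1 + 6 * real m))"

lemma push_const_bounds:
  assumes "0 < V" "V \<le> 1" "m \<ge> 1"
  shows "0 < push_const m V" "push_const m V \<le> 1 / 2"
proof -
  show "0 < push_const m V" using assms by (simp add: push_const_def add_pos_nonneg)
  have "push_const m V \<le> 1 / (4 * 1)" unfolding push_const_def using assms by (intro frac_le) auto
  then show "push_const m V \<le> 1 / 2" by simp
qed

text \<open>Mixing a density of small entropy with \<open>1 + c \<phi>\<close> raises the tilted mean at a linear
  rate, because near the constant density the functional \<open>tilted_mean\<close> is nearly linear with
  gradient \<open>m \<phi>\<close>; entropy, being convex, increases at most linearly.\<close>

lemma tilted_mean_push:
  assumes f: "admissible m f" and V: "0 < V" "V \<le> 1" "V / 2 < kvar m f"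
    and w: "bounded_density D w" "rel_ent D w \<le> push_const m V ^ 4 / 4" and s: "0 \<le> s" "s \<le> 1"
  shows "\<exists>w'. bounded_density D w' \<and> tilted_mean m f w' \<ge> tilted_mean m f w + s * (real m * push_const m V * V / 4)
     \<and> rel_ent D w' \<le> rel_ent D w + s"
proof -
  define c where "c = push_const m V"
  define M where "M = real m"
  define v where "v = kvar m f"
  have m1: "m \<ge> 1" using admissibleD(1)[OF f] .
  have M: "M \<ge> 1" using m1 by (simp add: M_def)
  have c: "0 < c" "c \<le> 1 / 2" using push_const_bounds[OF V(1,2) m1] by (auto simp: c_def)
  have cV: "c * (1 + 6 * M) = V / 4"
    using M by (simp add: c_def push_const_def M_def[symmetric] field_simps)
  let ?r = "\<lambda>s. 1 + c * kproj m f s"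
  note L = linear_density[OF f less_imp_le[OF c(1)] c(2)]
  define w' where "w' x = (1 - s) * w x + s * ?r x" for x
  have w': "bounded_density D w'" and H': "rel_ent D w' \<le> (1 - s) * rel_ent D w + s * rel_ent D ?r"
    using bounded_density_mix[OF w(1) L(1) s] unfolding w'_def by auto
  note [measurable] = kproj_measurable[OF admissibleD(1-3)[OF f]] bounded_densityD(1)[OF w(1)]
  note b = kproj_bound[OF admissibleD(1-3)[OF f]]
  have iw: "integrable D w" by (rule integrable_bounded_density[OF w(1)])
  have ir: "integrable D ?r" by (rule integrable_bounded_density[OF L(1)])
  define \<tau> where "\<tau> = dist1 w (\<lambda>_. 1)"
  have \<tau>0: "0 \<le> \<tau>" by (simp add: \<tau>_def dist1_nonneg)
  \<comment> \<open>This is where the entropy bound \<open>c^4 / 4\<close> is used: it places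
    \<open>w\<close> within \<open>c^2\<close> of the constant density, much closer than
    \<open>1 + c * phi\<close>.\<close>
  have "\<tau>\<^sup>2 \<le> (c\<^sup>2)\<^sup>2"
    using dist1_rel_ent[OF w(1)] w(2) by (simp add: \<tau>_def c_def power_mult[symmetric])
  then have \<tau>: "\<tau> \<le> c\<^sup>2" using power2_le_imp_le by (metis zero_le_power2)
  have cc: "c\<^sup>2 \<le> c / 2" using c by (simp add: power2_eq_square mult_left_mono)
  have "dist1 w' w = (\<integral>x. s * \<bar>?r x - w x\<bar> \<partial>D)"
    unfolding dist1_def
  proof (rule Bochner_Integration.integral_cong[OF refl])
    fix x
    have "w' x - w x = s * (?r x - w x)" by (simp add: w'_def algebra_simps)
    then show "\<bar>w' x - w x\<bar> = s * \<bar>?r x - w x\<bar>" using s by (simp add: abs_mult)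
  qed
  also have "\<dots> = s * dist1 ?r w" by (simp add: dist1_def)
  also have "\<dots> \<le> s * (c + \<tau>)"
    using dist1_triangle[OF ir _ iw, of "\<lambda>_. 1"] L(3) s dist1_commute[of "\<lambda>_. 1" w]
    by (intro mult_left_mono) (auto simp: \<tau>_def)
  finally have d1: "dist1 w' w \<le> s * (c + \<tau>)" .
  have "dist1 w' (\<lambda>_. 1) \<le> dist1 w' w + \<tau>"
    unfolding \<tau>_def using integrable_bounded_density[OF w'] iw by (intro dist1_triangle) auto
  also have "\<dots> \<le> 1 * (c + \<tau>) + \<tau>"
    using d1 mult_right_mono[OF s(2), of "c + \<tau>"] c \<tau>0 by linarith
  finally have d2: "dist1 w' (\<lambda>_. 1) + dist1 w (\<lambda>_. 1) \<le> c + 3 * \<tau>" by (simp add: \<tau>_def)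
  have "dist1 w' w * (dist1 w' (\<lambda>_. 1) + dist1 w (\<lambda>_. 1)) \<le> (s * (c + \<tau>)) * (c + 3 * \<tau>)"
    using d1 d2 s c \<tau>0 by (intro mult_mono add_nonneg_nonneg dist1_nonneg mult_nonneg_nonneg) auto
  also have "\<dots> \<le> (s * (3 / 2 * c)) * (5 / 2 * c)"
    using \<tau> cc s c \<tau>0 by (intro mult_mono mult_left_mono) auto
  also have "\<dots> = s * (15 / 4 * c\<^sup>2)" by (simp add: power2_eq_square)
  also have "\<dots> \<le> s * (6 * c\<^sup>2)" using s by (intro mult_left_mono mult_right_mono) auto
  finally have rem: "M\<^sup>2 * (dist1 w' w * (dist1 w' (\<lambda>_. 1) + dist1 w (\<lambda>_. 1))) \<le> M\<^sup>2 * (s * (6 * c\<^sup>2))"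
    by (rule mult_left_mono) simp
  have ikw: "integrable D (\<lambda>x. w x * kproj m f x)"
    by (rule integrable_bounded_density_mult[OF w(1) _ b]) measurable
  have ikr: "integrable D (\<lambda>x. ?r x * kproj m f x)"
    by (rule integrable_bounded_density_mult[OF L(1) _ b]) measurable
  have kw: "(\<integral>x. w x * kproj m f x \<partial>D) \<le> \<tau>"
  proof -
    have "(\<integral>x. w x * kproj m f x \<partial>D) = (\<integral>x. (w x - 1) * kproj m f x \<partial>D)"
      using ikw kproj_int[OF f] kproj_centred[OF f] by (simp add: left_diff_distrib)
    also have "\<dots> \<le> (\<integral>x. \<bar>w x - 1\<bar> \<partial>D)"
    proof (rule integral_mono)
      show "integrable D (\<lambda>x. (w x - 1) * kproj m f x)"
        using ikw kproj_int[OF f] by (simp add: left_diff_distrib)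
      show "(w x - 1) * kproj m f x \<le> \<bar>w x - 1\<bar>" for x
        using mult_left_mono[OF b[of x], of "\<bar>w x - 1\<bar>"] abs_ge_self[of "(w x - 1) * kproj m f x"]
        by (simp add: abs_mult)
    qed (use iw in simp)
    finally show ?thesis by (simp add: \<tau>_def dist1_def)
  qed
  have "(\<integral>x. kproj m f x * (w' x - w x) \<partial>D) = (\<integral>x. s * (?r x * kproj m f x - w x * kproj m f x) \<partial>D)"
    by (simp add: w'_def algebra_simps)
  also have "\<dots> = s * (c * v - (\<integral>x. w x * kproj m f x \<partial>D))"
    using ikw ikr L(4) by (simp add: v_def mult.commute)
  also have "\<dots> \<ge> s * (c * v - c\<^sup>2)"
    using kw \<tau> s by (intro mult_left_mono) auto
  finally have lin: "M * (\<integral>x. kproj m f x * (w' x - w x) \<partial>D) \<ge> M * (s * (c * v - c\<^sup>2))"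
    using M by (intro mult_left_mono) auto
  \<comment> \<open>The gain \<open>s M c v\<close> of the linear part against its loss
    \<open>s M c^2\<close> and the remainder \<open>6 s M^2 c^2\<close>; the choice of
    \<open>c\<close> balances them.\<close>
  have "s * (M * c * V / 4) \<le> M * (s * (c * v - c\<^sup>2)) - M\<^sup>2 * (s * (6 * c\<^sup>2))"
  proof -
    have "M * (s * (c * v - c\<^sup>2)) - M\<^sup>2 * (s * (6 * c\<^sup>2)) = (s * M * c) * (v - c * (1 + 6 * M))"
      by (simp add: power2_eq_square algebra_simps)
    also have "\<dots> \<ge> (s * M * c) * (V / 4)"
      unfolding cV using V s M c by (intro mult_left_mono) (auto simp: v_def)
    finally show ?thesis by (simp add: mult_ac)
  qed
  then have tm: "tilted_mean m f w' \<ge> tilted_mean m f w + s * (M * c * V / 4)"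
    using tilted_mean_expansion[OF f w' w(1)] rem lin unfolding M_def[symmetric] by linarith
  have "rel_ent D ?r \<le> 1"
  proof -
    have "rel_ent D ?r \<le> c\<^sup>2 * v / 2 * (1 + 2 * c)" using L(2) by (simp add: v_def)
    also have "\<dots> \<le> (1 / 2 * 1 / 2) * 2"
      using c cc kvar_bounds[OF f] by (intro mult_mono divide_right_mono) (auto simp: v_def)
    finally show ?thesis by simp
  qed
  then have "rel_ent D w' \<le> rel_ent D w + s"
    using H' mult_left_mono[of "rel_ent D ?r" 1 s] mult_nonneg_nonneg[OF s(1) rel_ent_nonneg[OF w(1)]] s
    by (simp add: left_diff_distrib)
  then show ?thesis using w' tm unfolding M_def c_def by blast
qed

end

section \<open>The constrained entropy minimum as the rate of a single kernel\<close>

lemma has_log_rateI: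
  assumes low: "\<And>\<epsilon>. \<epsilon> > 0 \<Longrightarrow> \<forall>\<^sub>F n in sequentially. exp (- (real n * (K + \<epsilon>))) \<le> p n"
    and up: "\<And>\<epsilon>. \<epsilon> > 0 \<Longrightarrow> \<forall>\<^sub>F n in sequentially. p n \<le> exp (- (real n * (K - \<epsilon>)))"
  shows "has_log_rate p (- K)"
  unfolding has_log_rate_def
proof
  show "\<forall>\<^sub>F n in sequentially. p n > 0"
    using low[of 1] by (auto elim!: eventually_mono intro: less_le_trans[OF exp_gt_zero])
  show "(\<lambda>n. ln (p n) / real n) \<longlonglongrightarrow> - K"
  proof (rule tendstoI)
    fix e :: real assume "e > 0"
    then have e: "e / 2 > 0" by simp
    show "\<forall>\<^sub>F n in sequentially. dist (ln (p n) / real n) (- K) < e"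
      using low[OF e] up[OF e] eventually_gt_at_top[of 0]
    proof eventually_elim
      case (elim n)
      have p: "p n > 0" using less_le_trans[OF exp_gt_zero elim(1)] .
      have "- (real n * (K + e / 2)) \<le> ln (p n)" "ln (p n) \<le> - (real n * (K - e / 2))"
        using elim(1,2) p by (auto simp: ln_ge_iff[OF p] ln_le_cancel_iff[of "p n" "exp _", symmetric])
      then have "- (K + e / 2) \<le> ln (p n) / real n" "ln (p n) / real n \<le> - (K - e / 2)"
        using elim(3) by (auto simp: field_simps)
      then show ?case using \<open>e > 0\<close> by (simp add: dist_real_def abs_less_iff)
    qed
  qed
qed

context sample_law
begin

text \<open>The infimum is meaningful only if some density satisfies the constraint (see \<open>feasible\<close>);
  otherwise it is the unspecified value \<open>Inf {}\<close>.\<close>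

definition rateJ :: "nat \<Rightarrow> ((nat \<Rightarrow> 'b) \<Rightarrow> real) \<Rightarrow> real \<Rightarrow> real" where
  "rateJ m f a = (INF w\<in>{w. bounded_density D w \<and> a \<le> tilted_mean m f w}. rel_ent D w)"

text \<open>The three terms ensure that \<open>rel_ent_upper\<close> applies, that near-optimal densities have entropy
  small enough for \<open>tilted_mean_push\<close>, and that the mixing parameter there stays below 1.\<close>

definition small_limit :: "nat \<Rightarrow> real \<Rightarrow> real" where
  "small_limit m V = min (V\<^sup>2 / 16) (min ((push_const m V)\<^sup>2 * V / 6) (real m * push_const m V * V / 4))"

lemma rateJ_le:
  assumes "bounded_density D w" "a \<le> tilted_mean m f w"
  shows "rateJ m f a \<le> rel_ent D w"
  unfolding rateJ_def
  by (rule cINF_lower) (use assms rel_ent_nonneg in \<open>auto intro!: bdd_belowI2[where m=0]\<close>)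

lemma upper_factor_le:
  assumes "0 < V" "V \<le> 1" "0 < a" "a \<le> V\<^sup>2 / 16"
  shows "upper_factor V a \<le> 6" "0 < upper_factor V a"
proof -
  have "16 / V\<^sup>2 * a \<le> 1" using assms by (simp add: field_simps)
  then have "(1 + 16 / V\<^sup>2 * a)\<^sup>2 \<le> 2\<^sup>2" using assms by (intro power_mono) auto
  moreover have "8 * a / V \<le> 1 / 2"
  proof -
    have "V\<^sup>2 \<le> V" using assms by (simp add: power2_eq_square mult_left_le)
    then show ?thesis using assms by (simp add: field_simps)
  qed
  ultimately have "upper_factor V a \<le> 4 * (3 / 2)"
    unfolding upper_factor_def using assms by (intro mult_mono) auto
  then show "upper_factor V a \<le> 6" by simp
  show "0 < upper_factor V a"
    unfolding upper_factor_def using assms by (intro mult_pos_pos zero_less_power add_pos_pos) auto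
qed

context
  fixes m f V
  assumes f: "admissible m f" and V: "0 < V" "V \<le> 1" "V / 2 < kvar m f"
begin

lemma feasible:
  assumes "0 < a" "a < small_limit m V"
  shows "\<exists>w. bounded_density D w \<and> a \<le> tilted_mean m f w"
  using rel_ent_upper[OF f V assms(1)] assms(2) by (auto simp: small_limit_def)

lemma rateJ_approx:
  assumes "0 < a" "a < small_limit m V" "\<delta> > 0"
  shows "\<exists>w. bounded_density D w \<and> a \<le> tilted_mean m f w \<and> rel_ent D w < rateJ m f a + \<delta>"
proof -
  have "\<exists>x\<in>rel_ent D ` {w. bounded_density D w \<and> a \<le> tilted_mean m f w}. x < rateJ m f a + \<delta>"
    unfolding rateJ_def using feasible[OF assms(1,2)] assms(3) rel_ent_nonneg
    by (intro cInf_lessD) auto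
  then show ?thesis by auto
qed

lemma rateJ_greatest:
  assumes "0 < a" "a < small_limit m V"
    and "\<And>w. bounded_density D w \<Longrightarrow> a \<le> tilted_mean m f w \<Longrightarrow> K \<le> rel_ent D w"
  shows "K \<le> rateJ m f a"
  unfolding rateJ_def by (rule cINF_greatest) (use feasible[OF assms(1,2)] assms(3) in auto)

lemma rateJ_nonneg: "0 < a \<Longrightarrow> a < small_limit m V \<Longrightarrow> 0 \<le> rateJ m f a"
  by (rule rateJ_greatest) (auto intro: rel_ent_nonneg)

lemma rateJ_mono:
  assumes "a \<le> b" "0 < b" "b < small_limit m V"
  shows "rateJ m f a \<le> rateJ m f b"
  using assms by (intro rateJ_greatest) (auto intro: rateJ_le)

lemma rateJ_upper:
  assumes "0 < a" "a < small_limit m V"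
  shows "rateJ m f a \<le> a\<^sup>2 / (2 * (real m)\<^sup>2 * kvar m f) * upper_factor V a"
proof -
  obtain w where "bounded_density D w" "tilted_mean m f w \<ge> a"
     "rel_ent D w \<le> a\<^sup>2 / (2 * (real m)\<^sup>2 * kvar m f) * upper_factor V a"
    using rel_ent_upper[OF f V assms(1)] assms(2) by (auto simp: small_limit_def)
  then show ?thesis using rateJ_le[of w a m f] by linarith
qed

lemma rateJ_small:
  assumes "0 < a" "a < small_limit m V"
  shows "rateJ m f a < push_const m V ^ 4 / 4"
proof -
  let ?c = "push_const m V"
  have m1: "m \<ge> 1" using admissibleD(1)[OF f] .
  have c: "0 < ?c" using push_const_bounds[OF V(1,2) m1] by auto
  have a: "a \<le> V\<^sup>2 / 16" "a < ?c\<^sup>2 * V / 6" using assms(2) by (auto simp: small_limit_def)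
  have "rateJ m f a \<le> a\<^sup>2 / (2 * (real m)\<^sup>2 * kvar m f) * upper_factor V a" by (rule rateJ_upper[OF assms])
  also have "\<dots> \<le> a\<^sup>2 / V * 6"
  proof (rule mult_mono)
    have "2 * 1 * (V / 2) \<le> 2 * (real m)\<^sup>2 * kvar m f"
      using m1 V by (intro mult_mono) auto
    then show "a\<^sup>2 / (2 * (real m)\<^sup>2 * kvar m f) \<le> a\<^sup>2 / V"
      using V by (intro divide_left_mono mult_pos_pos less_le_trans[OF V(1)]) auto
  qed (use upper_factor_le[OF V(1,2) assms(1) a(1)] V in auto)
  also have "\<dots> \<le> (?c\<^sup>2 * V / 6)\<^sup>2 / V * 6"
    using a assms V by (intro mult_right_mono divide_right_mono power_mono) auto
  also have "\<dots> = ?c ^ 4 * V / 6" using V by (simp add: power2_eq_square power4_eq_xxxx field_simps)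
  also have "\<dots> < ?c ^ 4 / 4"
  proof -
    have "?c ^ 4 * V \<le> ?c ^ 4 * 1" using V by (intro mult_left_mono) auto
    moreover have "?c ^ 4 > 0" using c by simp
    ultimately show ?thesis by linarith
  qed
  finally show ?thesis .
qed

text \<open>Push a near-minimiser for \<open>a\<close> up to the level \<open>b\<close> by
  \<open>tilted_mean_push\<close>: the mixing parameter \<open>(b - a) / c0\<close> bounds the extra
  entropy. By \<open>rateJ_small\<close> the near-minimiser can be taken of entropy small enough for
  this. The constant depends on \<open>m\<close> and \<open>V\<close> only.\<close>

lemma rateJ_lipschitz:
  assumes "0 < a" "a \<le> b" "b < small_limit m V"
  shows "rateJ m f b \<le> rateJ m f a + (b - a) / (real m * push_const m V * V / 4)"
proof (rule field_le_epsilon)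
  let ?c0 = "real m * push_const m V * V / 4"
  fix e :: real assume e: "e > 0"
  have a: "a < small_limit m V" using assms by simp
  have m1: "m \<ge> 1" using admissibleD(1)[OF f] .
  have c0: "0 < ?c0" using push_const_bounds[OF V(1,2) m1] V m1 by simp
  define d where "d = min e (push_const m V ^ 4 / 4 - rateJ m f a)"
  have "d \<le> push_const m V ^ 4 / 4 - rateJ m f a" unfolding d_def by (rule min.cobounded2)
  moreover have "0 < d" "d \<le> e" using e rateJ_small[OF assms(1) a] by (auto simp: d_def)
  ultimately have d: "0 < d" "d \<le> e" "rateJ m f a + d \<le> push_const m V ^ 4 / 4" by linarith+
  obtain w where w: "bounded_density D w" "a \<le> tilted_mean m f w" "rel_ent D w < rateJ m f a + d"
    using rateJ_approx[OF assms(1) a d(1)] by blast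
  define s where "s = (b - a) / ?c0"
  have "b - a \<le> ?c0" using assms by (auto simp: small_limit_def)
  then have s: "0 \<le> s" "s \<le> 1" using assms c0 by (auto simp: s_def)
  have "rel_ent D w \<le> push_const m V ^ 4 / 4" using w(3) d(3) by linarith
  from tilted_mean_push[OF f V w(1) this s] obtain w' where w': "bounded_density D w'"
     "tilted_mean m f w' \<ge> tilted_mean m f w + s * ?c0" "rel_ent D w' \<le> rel_ent D w + s" by blast
  have "s * ?c0 = b - a"
    by (rule nonzero_eq_divide_eq[THEN iffD1, OF _ s_def]) (use c0 in linarith)
  then have "b \<le> tilted_mean m f w'" using w'(2) w(2) by linarith
  then have "rateJ m f b \<le> rel_ent D w'" by (rule rateJ_le[OF w'(1)])
  then show "rateJ m f b \<le> rateJ m f a + (b - a) / ?c0 + e"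
    using w'(3) w(3) d(2) unfolding s_def by linarith
qed

lemma rateJ_lower:
  assumes "0 < a" "a < small_limit m V" "kvar m f \<le> s" "a \<le> s"
  shows "a\<^sup>2 * (1 - a / s) / (2 * (real m)\<^sup>2 * (s + 4 * a)) \<le> rateJ m f a"
proof (rule rateJ_greatest[OF assms(1,2)])
  fix w assume w: "bounded_density D w" "a \<le> tilted_mean m f w"
  have s: "0 < s" using assms by linarith
  have "0 < 2 * (real m)\<^sup>2 * (s + 4 * a)" using admissibleD(1)[OF f] s assms(1) by simp
  then show "a\<^sup>2 * (1 - a / s) / (2 * (real m)\<^sup>2 * (s + 4 * a)) \<le> rel_ent D w"
    using rel_ent_lower[OF f assms(3) s assms(1,4) w] by (simp add: pos_divide_le_eq mult.commute)
qed

text \<open>Tilting needs a mean strictly above \<open>a\<close>. A near-minimiser for a slightly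
  larger level \<open>b\<close> has one, and the Lipschitz bound limits the cost.\<close>

lemma inj_avg_log_rate_lower:
  assumes "0 < a" "a < small_limit m V" "\<epsilon> > 0"
  shows "\<forall>\<^sub>F n in sequentially. exp (- (real n * (rateJ m f a + \<epsilon>)))
    \<le> avg_tail m f n a"
proof -
  let ?c0 = "real m * push_const m V * V / 4"
  have m1: "m \<ge> 1" using admissibleD(1)[OF f] .
  have c0: "0 < ?c0" using push_const_bounds[OF V(1,2) m1] V m1 by simp
  define b where "b = min ((a + small_limit m V) / 2) (a + ?c0 * \<epsilon> / 4)"
  have "0 < ?c0 * \<epsilon> / 4" using c0 assms(3) by simp
  moreover have "b \<le> (a + small_limit m V) / 2" "b \<le> a + ?c0 * \<epsilon> / 4" "b = (a + small_limit m V) / 2 \<or> b = a + ?c0 * \<epsilon> / 4"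
    unfolding b_def by (rule min.cobounded1, rule min.cobounded2, simp add: min_def)
  ultimately have b: "a < b" "b < small_limit m V" "b - a \<le> ?c0 * \<epsilon> / 4"
    using assms(2) by (auto simp: field_simps)
  have b0: "0 < b" using b assms by simp
  have "(b - a) / ?c0 \<le> \<epsilon> / 4" using b(3) c0 by (simp add: divide_le_eq mult.commute)
  then have Jb: "rateJ m f b \<le> rateJ m f a + \<epsilon> / 4"
    using rateJ_lipschitz[OF assms(1) less_imp_le[OF b(1)] b(2)] by linarith
  obtain w where w: "bounded_density D w" "b \<le> tilted_mean m f w" "rel_ent D w < rateJ m f b + \<epsilon> / 4"
    using rateJ_approx[OF b0 b(2), of "\<epsilon> / 4"] assms(3) by auto
  have "\<forall>\<^sub>F n in sequentially. exp (- (real n * (rel_ent D w + \<epsilon> / 2)))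
     \<le> avg_tail m f n a"
    using w b assms(3) by (intro inj_avg_lower_bound admissibleD[OF f]) (auto simp: tilted_mean_def)
  then show ?thesis
  proof eventually_elim
    case (elim n)
    have "real n * (rel_ent D w + \<epsilon> / 2) \<le> real n * (rateJ m f a + \<epsilon>)"
      using w(3) Jb by (intro mult_left_mono) auto
    then show ?case using elim by (meson dual_order.trans exp_le_cancel_iff neg_le_iff_le)
  qed
qed

lemma inj_avg_has_log_rate:
  assumes "0 < a" "a < small_limit m V"
  shows "has_log_rate (\<lambda>n. avg_tail m f n a) (- rateJ m f a)"
proof (rule has_log_rateI)
  show "\<forall>\<^sub>F n in sequentially. exp (- (real n * (rateJ m f a + \<epsilon>)))
      \<le> avg_tail m f n a" if "\<epsilon> > 0" for \<epsilon>
    by (rule inj_avg_log_rate_lower[OF assms that])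
  fix \<epsilon> :: real assume e: "\<epsilon> > 0"
  let ?c0 = "real m * push_const m V * V / 4"
  have m1: "m \<ge> 1" using admissibleD(1)[OF f] .
  have c0: "0 < ?c0" using push_const_bounds[OF V(1,2) m1] V m1 by simp
  \<comment> \<open>The slack of \<open>inj_avg_upper_bound\<close>, so small that by the Lipschitz
    bound it lowers the rate by at most \<open>\<epsilon> / 2\<close>.\<close>
  define d where "d = min (a / 2) (?c0 * \<epsilon> / 2)"
  have d: "0 < d" "d < a" "d \<le> ?c0 * \<epsilon> / 2" using c0 e assms by (auto simp: d_def)
  have "(a - (a - d)) / ?c0 \<le> \<epsilon> / 2" using d(3) c0 by (simp add: divide_le_eq mult.commute)
  then have J: "rateJ m f a - \<epsilon> / 2 \<le> rateJ m f (a - d)"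
    using rateJ_lipschitz[of "a - d" a] d assms by auto
  have "\<forall>\<^sub>F n in sequentially. avg_tail m f n a
      \<le> exp (- (real n * (rateJ m f a - \<epsilon> / 2 - \<epsilon> / 2)))"
  proof (rule inj_avg_upper_bound[OF admissibleD(2,3)[OF f] m1 d(1)])
    fix w assume w: "bounded_density D w" "a - d \<le> (\<integral>x. prod_density m w x * f x \<partial>DP m)"
    then show "rateJ m f a - \<epsilon> / 2 \<le> rel_ent D w"
      using J rateJ_le[of w "a - d" m f] by (auto simp: tilted_mean_def)
  qed (use e in auto)
  then show "\<forall>\<^sub>F n in sequentially. avg_tail m f n a
      \<le> exp (- (real n * (rateJ m f a - \<epsilon>)))"
    by simp
qed

end

section \<open>Suprema of families\<close>

text \<open>\<open>S n a\<close> abstracts the event that the supremum over the family exceeds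
  \<open>a\<close>. \<open>S_low\<close> places tails at single parameters inside it;
  \<open>S_up\<close> exhausts it by finitely many tails up to an error of any prescribed
  exponential rate.\<close>

context
  fixes \<Phi> :: "'i \<Rightarrow> (nat \<Rightarrow> 'b) \<Rightarrow> real" and I :: "'i set" and m :: nat
    and S :: "nat \<Rightarrow> real \<Rightarrow> (nat \<Rightarrow> 'b) set" and V :: real and T :: "'i set"
  assumes adm: "\<And>t. t \<in> I \<Longrightarrow> admissible m (\<Phi> t)" and I: "I \<noteq> {}"
    and V_def: "V = (SUP t\<in>I. kvar m (\<Phi> t))" and V0: "V > 0"
    and T_def: "T = {t \<in> I. V / 2 < kvar m (\<Phi> t)}"
    and S_meas: "\<And>n a. n \<ge> m \<Longrightarrow> 0 < a \<Longrightarrow> S n a \<in> sets (DP n)"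
    and S_low: "\<And>t a b n. t \<in> T \<Longrightarrow> 0 < a \<Longrightarrow> a < b \<Longrightarrow> n \<ge> m \<Longrightarrow>
      {x \<in> space (DP n). inj_avg m n (\<Phi> t) x \<ge> b} \<subseteq> S n a"
    and S_up: "\<And>a \<epsilon> L. 0 < \<epsilon> \<Longrightarrow> \<epsilon> < a \<Longrightarrow> \<exists>F\<subseteq>I. finite F \<and> (\<forall>\<^sub>F n in sequentially.
      measure (DP n) (S n a) \<le> (\<Sum>t\<in>F. avg_tail m (\<Phi> t) n (a - \<epsilon>))
        + exp (- (real n * L)))"
begin

private definition JT :: "real \<Rightarrow> real" where
  "JT a = (INF t\<in>T. rateJ m (\<Phi> t) a)"

private lemma kvar_le_V: "t \<in> I \<Longrightarrow> kvar m (\<Phi> t) \<le> V"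
  unfolding V_def using kvar_bounds[OF adm] by (intro cSUP_upper) (auto intro!: bdd_aboveI2[where M=1])

private lemma V_le_1: "V \<le> 1"
  unfolding V_def using kvar_bounds[OF adm] by (intro cSUP_least I) auto

private lemma m_ge_1: "m \<ge> 1"
  using I adm admissibleD(1) by blast

private lemma V_approx:
  assumes "c < V"
  shows "\<exists>t\<in>I. c < kvar m (\<Phi> t)"
proof -
  have "bdd_above ((\<lambda>t. kvar m (\<Phi> t)) ` I)"
    using kvar_bounds[OF adm] by (auto intro!: bdd_aboveI2[where M=1])
  from less_cSUP_iff[OF I this] show ?thesis using assms by (simp add: V_def)
qed

private lemma T_nonempty: "T \<noteq> {}"
  using V_approx[of "V / 2"] V0 by (auto simp: T_def)

private lemma T_props:
  assumes "t \<in> T"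
  shows "admissible m (\<Phi> t)" "0 < V" "V \<le> 1" "V / 2 < kvar m (\<Phi> t)"
  using assms adm V0 V_le_1 by (auto simp: T_def)

private abbreviation a1 :: real where "a1 \<equiv> small_limit m V"

private lemma a1_pos: "0 < a1"
  using V0 m_ge_1 push_const_bounds[OF V0 V_le_1 m_ge_1] by (simp add: small_limit_def)

private lemma a1_le: "a1 \<le> V\<^sup>2 / 16" "a1 \<le> V / 16"
proof -
  show 1: "a1 \<le> V\<^sup>2 / 16" by (simp add: small_limit_def)
  have "V\<^sup>2 \<le> V" using V0 V_le_1 by (simp add: power2_eq_square mult_left_le)
  with 1 show "a1 \<le> V / 16" by simp
qed

private lemma JT_le: "t \<in> T \<Longrightarrow> 0 < a \<Longrightarrow> a < a1 \<Longrightarrow> JT a \<le> rateJ m (\<Phi> t) a"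
  unfolding JT_def using rateJ_nonneg[OF T_props]
  by (intro cINF_lower) (auto intro!: bdd_belowI2[where m=0])

private lemma JT_greatest: "(\<And>t. t \<in> T \<Longrightarrow> K \<le> rateJ m (\<Phi> t) a) \<Longrightarrow> K \<le> JT a"
  unfolding JT_def using T_nonempty by (intro cINF_greatest) auto

private lemma JT_approx:
  assumes "0 < a" "a < a1" "e > 0"
  shows "\<exists>t\<in>T. rateJ m (\<Phi> t) a < JT a + e"
proof (rule ccontr)
  assume "\<not> ?thesis"
  then have "JT a + e \<le> JT a" by (intro JT_greatest) (auto simp: not_less)
  with assms show False by simp
qed

private definition lip :: real where "lip = 1 / (real m * push_const m V * V / 4)"

private lemma lip_pos: "0 < lip"
  using V0 m_ge_1 push_const_bounds[OF V0 V_le_1 m_ge_1] by (simp add: lip_def)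

private lemma JT_lip:
  assumes "0 < a" "a \<le> b" "b < a1"
  shows "JT a \<le> JT b" "JT b \<le> JT a + (b - a) * lip"
proof -
  show "JT a \<le> JT b"
  proof (rule JT_greatest)
    fix t assume t: "t \<in> T"
    have "JT a \<le> rateJ m (\<Phi> t) a" using assms by (intro JT_le t) auto
    also have "\<dots> \<le> rateJ m (\<Phi> t) b" using assms by (intro rateJ_mono[OF T_props[OF t]]) auto
    finally show "JT a \<le> rateJ m (\<Phi> t) b" .
  qed
  have "JT b - (b - a) * lip \<le> JT a"
  proof (rule JT_greatest)
    fix t assume t: "t \<in> T"
    have "JT b \<le> rateJ m (\<Phi> t) b" using assms by (intro JT_le t) auto
    also have "\<dots> \<le> rateJ m (\<Phi> t) a + (b - a) * lip"
      using rateJ_lipschitz[OF T_props[OF t] assms] by (simp add: lip_def)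
    finally show "JT b - (b - a) * lip \<le> rateJ m (\<Phi> t) a" by simp
  qed
  then show "JT b \<le> JT a + (b - a) * lip" by simp
qed

private lemma JT_dist:
  assumes "0 < a" "a < a1" "0 < b" "b < a1"
  shows "\<bar>JT a - JT b\<bar> \<le> lip * \<bar>a - b\<bar>"
  using JT_lip[of a b] JT_lip[of b a] assms by (cases "a \<le> b") (auto simp: mult.commute)

private lemma JT_continuous: "continuous_on {0<..<a1} JT"
  using JT_dist lip_pos
  by (intro lipschitz_on_continuous_on[of lip]) (auto simp: lipschitz_on_def dist_real_def)

text \<open>The supremum \<open>V\<close> need not be attained. If the bound failed, a parameter
  whose variance is close enough to \<open>V\<close> would lie in \<open>T\<close> and violate
  \<open>rateJ_upper\<close>.\<close>

private lemma JT_upper: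
  assumes a: "0 < a" "a < a1"
  shows "JT a \<le> a\<^sup>2 / (2 * (real m)\<^sup>2 * V) * upper_factor V a"
proof (rule ccontr)
  define C where "C = a\<^sup>2 / (2 * (real m)\<^sup>2) * upper_factor V a"
  have C: "C > 0" using a m_ge_1 upper_factor_le(2)[OF V0 V_le_1 a(1)] a1_le by (simp add: C_def)
  assume "\<not> ?thesis"
  then have J: "JT a > C / V" by (simp add: C_def)
  then have J0: "JT a > 0" using C V0 by (smt (verit) divide_pos_pos)
  have "C / JT a < V" using J J0 V0 by (simp add: field_simps)
  then obtain t where t: "t \<in> I" "max (C / JT a) (V / 2) < kvar m (\<Phi> t)"
    using V_approx[of "max (C / JT a) (V / 2)"] V0 by auto
  then have tT: "t \<in> T" by (simp add: T_def)
  have "rateJ m (\<Phi> t) a \<le> C / kvar m (\<Phi> t)"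
    using rateJ_upper[OF T_props[OF tT] a] by (simp add: C_def)
  also have "\<dots> < JT a" using t J0 C V0 by (simp add: field_simps)
  also have "\<dots> \<le> rateJ m (\<Phi> t) a" by (rule JT_le[OF tT a])
  finally show False by simp
qed

private lemma JT_lower:
  assumes a: "0 < a" "a < a1"
  shows "a\<^sup>2 * (1 - a / V) / (2 * (real m)\<^sup>2 * (V + 4 * a)) \<le> JT a"
proof (rule JT_greatest)
  fix t assume t: "t \<in> T"
  then show "a\<^sup>2 * (1 - a / V) / (2 * (real m)\<^sup>2 * (V + 4 * a)) \<le> rateJ m (\<Phi> t) a"
    using a a1_le V0 by (intro rateJ_lower[OF T_props[OF t]] kvar_le_V) (auto simp: T_def)
qed

private lemma upper_factor_tendsto: "(upper_factor V \<longlongrightarrow> 1) (at_right 0)"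
proof -
  have "((\<lambda>a. (1 + 16 / V\<^sup>2 * a)\<^sup>2 * (1 + 8 * a / V)) \<longlongrightarrow> (1 + 16 / V\<^sup>2 * 0)\<^sup>2 * (1 + 8 * 0 / V)) (at_right 0)"
    using V0 by (intro tendsto_intros) auto
  then show ?thesis by (simp add: upper_factor_def[abs_def])
qed

private lemma JT_asymp: "(\<lambda>a. - JT a) \<sim>[at_right 0] (\<lambda>a. - (a\<^sup>2 / (2 * (real m)\<^sup>2 * V)))"
proof (rule asymp_equivI')
  let ?c = "2 * (real m)\<^sup>2 * V"
  have c: "?c > 0" using V0 m_ge_1 by simp
  have ev: "\<forall>\<^sub>F a in at_right 0. 0 < a \<and> a < a1"
    using eventually_at_right_less[of 0] eventually_at_right_real[OF a1_pos] by eventually_elim auto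
  have "((\<lambda>a. JT a * ?c / a\<^sup>2) \<longlongrightarrow> 1) (at_right 0)"
  proof (rule tendsto_sandwich[OF _ _ _ upper_factor_tendsto])
    show "((\<lambda>a. (1 - a / V) * V / (V + 4 * a)) \<longlongrightarrow> 1) (at_right 0)"
    proof -
      have "((\<lambda>a. (1 - a / V) * V / (V + 4 * a)) \<longlongrightarrow> (1 - 0 / V) * V / (V + 4 * 0)) (at_right 0)"
        using V0 by (intro tendsto_intros) auto
      then show ?thesis using V0 by simp
    qed
    show "\<forall>\<^sub>F a in at_right 0. (1 - a / V) * V / (V + 4 * a) \<le> JT a * ?c / a\<^sup>2"
      using ev
    proof eventually_elim
      case (elim a)
      then have a: "0 < a" "a < a1" by auto
      have "(1 - a / V) * V / (V + 4 * a) = a\<^sup>2 * (1 - a / V) / (2 * (real m)\<^sup>2 * (V + 4 * a)) * (?c / a\<^sup>2)"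
      proof -
        have "V + 4 * a \<noteq> 0" "real m \<noteq> 0" "a \<noteq> 0" using a V0 m_ge_1 by auto
        then show ?thesis by (simp add: divide_simps)
      qed
      also have "\<dots> \<le> JT a * (?c / a\<^sup>2)"
        using c by (intro mult_right_mono JT_lower[OF a]) auto
      finally show ?case by simp
    qed
    show "\<forall>\<^sub>F a in at_right 0. JT a * ?c / a\<^sup>2 \<le> upper_factor V a"
      using ev
    proof eventually_elim
      case (elim a)
      then have a: "0 < a" "a < a1" by auto
      have "JT a * (?c / a\<^sup>2) \<le> a\<^sup>2 / ?c * upper_factor V a * (?c / a\<^sup>2)"
        using c by (intro mult_right_mono JT_upper[OF a]) auto
      also have "\<dots> = upper_factor V a"
      proof -
        have "x / y * u * (y / x) = u" if "0 < x" "0 < y" for x y u :: real using that by simp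
        from this[of "a\<^sup>2" ?c "upper_factor V a"] c a show ?thesis by (simp only: zero_less_power)
      qed
      finally show ?case by simp
    qed
  qed
  moreover have "- JT a / - (a\<^sup>2 / ?c) = JT a * ?c / a\<^sup>2" for a by simp
  ultimately show "((\<lambda>a. - JT a / - (a\<^sup>2 / ?c)) \<longlongrightarrow> 1) (at_right 0)" by simp
qed

text \<open>Off \<open>T\<close> the variance is at most \<open>V / 2\<close>, which makes the entropy cost about twice as large.\<close>

private lemma off_T:
  "\<exists>a2>0. \<forall>a t w. 0 < a \<longrightarrow> a < a2 \<longrightarrow> a < a1 \<longrightarrow> t \<in> I \<longrightarrow> bounded_density D w \<longrightarrow> a \<le> tilted_mean m (\<Phi> t) w
     \<longrightarrow> JT a \<le> rel_ent D w"
proof -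
  \<comment> \<open>After clearing denominators this is the lower bound \<open>rel_ent_lower\<close>
    with \<open>s = V / 2\<close> minus the upper bound \<open>JT_upper\<close>. It tends to
    \<open>V - V / 2\<close>, hence is positive for small \<open>a\<close>.\<close>
  have "((\<lambda>a. (1 - 2 * a / V) * V - (V / 2 + 4 * a) * upper_factor V a)
      \<longlongrightarrow> (1 - 2 * 0 / V) * V - (V / 2 + 4 * 0) * 1) (at_right 0)"
    using V0 by (intro tendsto_intros upper_factor_tendsto) auto
  then have "\<forall>\<^sub>F a in at_right 0. (1 - 2 * a / V) * V - (V / 2 + 4 * a) * upper_factor V a > 0"
    by (rule order_tendstoD(1)) (use V0 in simp)
  then obtain a2 where a2: "a2 > 0"
     "\<And>a. 0 < a \<Longrightarrow> a < a2 \<Longrightarrow> (1 - 2 * a / V) * V - (V / 2 + 4 * a) * upper_factor V a > 0"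
    unfolding eventually_at_right_field by auto
  have "JT a \<le> rel_ent D w"
    if a: "0 < a" "a < a2" "a < a1" and t: "t \<in> I" and w: "bounded_density D w" "a \<le> tilted_mean m (\<Phi> t) w" for a t w
  proof (cases "t \<in> T")
    case True
    then show ?thesis using JT_le[OF True a(1,3)] rateJ_le[OF w] by linarith
  next
    case False
    then have k: "kvar m (\<Phi> t) \<le> V / 2" using t by (auto simp: T_def)
    have s: "0 < V / 2" "a \<le> V / 2" using V0 a a1_le by auto
    let ?d = "2 * (real m)\<^sup>2"
    have d: "?d > 0" using m_ge_1 by simp
    have pos: "V / 2 + 4 * a > 0" using s a by simp
    have low: "a\<^sup>2 * (1 - a / (V / 2)) / (?d * (V / 2 + 4 * a)) \<le> rel_ent D w"
      using rel_ent_lower[OF adm[OF t] k s(1) a(1) s(2) w] pos d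
      by (simp add: pos_divide_le_eq mult.commute mult.left_commute)
    have "(V / 2 + 4 * a) * upper_factor V a \<le> (1 - 2 * a / V) * V"
      using a2(2)[OF a(1,2)] by simp
    then have "a\<^sup>2 / ?d * ((V / 2 + 4 * a) * upper_factor V a) / (V * (V / 2 + 4 * a))
        \<le> a\<^sup>2 / ?d * ((1 - 2 * a / V) * V) / (V * (V / 2 + 4 * a))"
      using pos V0 by (intro divide_right_mono mult_left_mono) auto
    moreover have "a\<^sup>2 / ?d * ((V / 2 + 4 * a) * upper_factor V a) / (V * (V / 2 + 4 * a)) = a\<^sup>2 / (?d * V) * upper_factor V a"
    proof -
      have "x / y * (p * u) / (z * p) = x / (y * z) * u" if "0 < p" "0 < y" "0 < z" for x y z p u :: real
        using that by (simp add: field_simps)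
      from this[OF pos d V0] show ?thesis .
    qed
    moreover have "a\<^sup>2 / ?d * ((1 - 2 * a / V) * V) / (V * (V / 2 + 4 * a)) = a\<^sup>2 * (1 - a / (V / 2)) / (?d * (V / 2 + 4 * a))"
      using pos V0 d by (simp add: mult.commute)
    ultimately show ?thesis using low JT_upper[OF a(1,3)] by linarith
  qed
  with a2(1) show ?thesis by blast
qed

text \<open>A single near-optimal parameter in \<open>T\<close> gives the lower bound. For the upper
  bound each of the finitely many tails is estimated by \<open>inj_avg_upper_bound\<close> with the
  entropy bound from \<open>off_T\<close>, so parameters outside \<open>T\<close> are covered
  although no rate is asserted for them.\<close>

lemma sup_log_rate:
  "\<exists>a0>0. (\<forall>a. 0 < a \<and> a < a0 \<longrightarrow>
      (\<forall>t\<in>T. has_log_rate (\<lambda>n. avg_tail m (\<Phi> t) n a) (- rateJ m (\<Phi> t) a)) \<and>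
      has_log_rate (\<lambda>n. measure (DP n) (S n a)) (- (INF t\<in>T. rateJ m (\<Phi> t) a))) \<and>
    continuous_on {0<..<a0} (\<lambda>a. - (INF t\<in>T. rateJ m (\<Phi> t) a))"
  "(\<lambda>a. - (INF t\<in>T. rateJ m (\<Phi> t) a)) \<sim>[at_right 0] (\<lambda>a. - (a\<^sup>2 / (2 * (real m)\<^sup>2 * V)))"
  "T \<noteq> {}"
proof -
  show "(\<lambda>a. - (INF t\<in>T. rateJ m (\<Phi> t) a)) \<sim>[at_right 0] (\<lambda>a. - (a\<^sup>2 / (2 * (real m)\<^sup>2 * V)))"
    using JT_asymp by (simp add: JT_def)
  show "T \<noteq> {}" by (rule T_nonempty)
  obtain a2 where a2: "a2 > 0" and off: "\<And>a t w. 0 < a \<Longrightarrow> a < a2 \<Longrightarrow> a < a1 \<Longrightarrow> t \<in> I \<Longrightarrow> bounded_density D w \<Longrightarrow>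
      a \<le> tilted_mean m (\<Phi> t) w \<Longrightarrow> JT a \<le> rel_ent D w"
    using off_T by blast
  define a0 where "a0 = min a1 a2"
  have a0: "a0 > 0" using a1_pos a2 by (simp add: a0_def)
  have "has_log_rate (\<lambda>n. measure (DP n) (S n a)) (- JT a)" if a: "0 < a" "a < a0" for a
  proof (rule has_log_rateI)
    have a': "a < a1" "a < a2" using a by (auto simp: a0_def)
    fix \<epsilon> :: real assume e: "\<epsilon> > 0"
    show "\<forall>\<^sub>F n in sequentially. exp (- (real n * (JT a + \<epsilon>))) \<le> measure (DP n) (S n a)"
    proof -
      obtain t where t: "t \<in> T" "rateJ m (\<Phi> t) a < JT a + \<epsilon> / 3"
        using JT_approx[OF a(1) a'(1), of "\<epsilon> / 3"] e by auto
      \<comment> \<open>\<open>S_low\<close> asks for a level strictly above \<open>a\<close>;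
        moving to \<open>b\<close> costs at most \<open>(b - a) * lip\<close>, a third of
        \<open>\<epsilon>\<close>.\<close>
      define b where "b = min ((a + a1) / 2) (a + \<epsilon> / (3 * lip))"
      have "0 < \<epsilon> / (3 * lip)" using e lip_pos by simp
      moreover have "b \<le> (a + a1) / 2" "b \<le> a + \<epsilon> / (3 * lip)" "b = (a + a1) / 2 \<or> b = a + \<epsilon> / (3 * lip)"
        unfolding b_def by (rule min.cobounded1, rule min.cobounded2, simp add: min_def)
      ultimately have b: "a < b" "b < a1" "b - a \<le> \<epsilon> / (3 * lip)" using a' by (auto simp: field_simps)
      have "(b - a) * lip \<le> \<epsilon> / (3 * lip) * lip" using b(3) lip_pos by (intro mult_right_mono) auto
      then have "(b - a) * lip \<le> \<epsilon> / 3" using lip_pos by simp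
      then have "rateJ m (\<Phi> t) b \<le> rateJ m (\<Phi> t) a + \<epsilon> / 3"
        using rateJ_lipschitz[OF T_props[OF t(1)] a(1) less_imp_le[OF b(1)] b(2)]
        unfolding lip_def by (simp only: times_divide_eq_right mult_1_right)
      with t(2) have J: "rateJ m (\<Phi> t) b + \<epsilon> / 3 \<le> JT a + \<epsilon>" by linarith
      have "\<forall>\<^sub>F n in sequentially. exp (- (real n * (rateJ m (\<Phi> t) b + \<epsilon> / 3)))
          \<le> avg_tail m (\<Phi> t) n b"
        using a b e by (intro inj_avg_log_rate_lower[OF T_props[OF t(1)]]) auto
      then show ?thesis
        using eventually_ge_at_top[of m]
      proof eventually_elim
        case (elim n)
        interpret N: prob_space "DP n" by (rule prob_space_DP)
        have "exp (- (real n * (JT a + \<epsilon>))) \<le> exp (- (real n * (rateJ m (\<Phi> t) b + \<epsilon> / 3)))"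
          using J by (simp add: mult_left_mono)
        also have "\<dots> \<le> avg_tail m (\<Phi> t) n b" by (rule elim(1))
        also have "\<dots> \<le> measure (DP n) (S n a)"
          by (rule N.finite_measure_mono[OF S_low[OF t(1) a(1) b(1) elim(2)] S_meas[OF elim(2) a(1)]])
        finally show ?case .
      qed
    qed
    show "\<forall>\<^sub>F n in sequentially. measure (DP n) (S n a) \<le> exp (- (real n * (JT a - \<epsilon>)))"
    proof -
      \<comment> \<open>The threshold drops by \<open>h\<close> twice: once for the finite set of
        parameters, once as the slack of \<open>inj_avg_upper_bound\<close>.\<close>
      define h where "h = min (a / 3) (\<epsilon> / (8 * lip))"
      have h: "0 < h" "2 * h < a" using a e lip_pos by (auto simp: h_def min_def)
      have "h \<le> \<epsilon> / (8 * lip)" unfolding h_def by (rule min.cobounded2)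
      then have "h * lip \<le> \<epsilon> / (8 * lip) * lip" using lip_pos by (intro mult_right_mono) auto
      then have hl: "h * lip \<le> \<epsilon> / 8" using lip_pos by simp
      define K where "K = JT (a - h - h)"
      have "JT a \<le> K + (a - (a - h - h)) * lip"
        unfolding K_def using h a a' by (intro JT_lip(2)) auto
      then have K: "JT a \<le> K + \<epsilon> / 4" using hl by (simp add: algebra_simps)
      obtain F where F: "F \<subseteq> I" "finite F" and ev: "\<forall>\<^sub>F n in sequentially.
          measure (DP n) (S n a) \<le> (\<Sum>t\<in>F. avg_tail m (\<Phi> t) n (a - h))
            + exp (- (real n * JT a))"
        using S_up[of h a "JT a"] h a by auto
      have each: "\<forall>\<^sub>F n in sequentially. avg_tail m (\<Phi> t) n (a - h)
          \<le> exp (- (real n * (K - \<epsilon> / 4)))" if t: "t \<in> F" for t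
      proof -
        have tI: "t \<in> I" using t F by auto
        show ?thesis
        proof (rule inj_avg_upper_bound[OF admissibleD(2,3)[OF adm[OF tI]] m_ge_1 h(1)])
          fix w assume w: "bounded_density D w" "a - h - h \<le> (\<integral>x. prod_density m w x * \<Phi> t x \<partial>DP m)"
          then show "K \<le> rel_ent D w"
            unfolding K_def using h a a' by (intro off[OF _ _ _ tI w(1)]) (auto simp: tilted_mean_def)
        qed (use e in auto)
      qed
      have "(\<lambda>n. 2 * real (n + 1) ^ 1 * exp (- (real n * (\<epsilon> / 2)))) \<longlonglongrightarrow> 0"
        using e by (intro poly_times_exp_tendsto_0) auto
      then have ev2: "\<forall>\<^sub>F n in sequentially. 2 * real (n + 1) ^ 1 * exp (- (real n * (\<epsilon> / 2))) < 1"
        by (intro order_tendstoD(2)) auto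
      have "\<forall>\<^sub>F n in sequentially. \<forall>t\<in>F. avg_tail m (\<Phi> t) n (a - h)
          \<le> exp (- (real n * (K - \<epsilon> / 4)))"
        using each F(2) by (simp add: eventually_ball_finite)
      then show ?thesis
        using ev ev2 eventually_ge_at_top[of "card F"]
      proof eventually_elim
        case (elim n)
        have "(\<Sum>t\<in>F. avg_tail m (\<Phi> t) n (a - h))
            \<le> (\<Sum>t\<in>F. exp (- (real n * (JT a - \<epsilon> / 2))))"
        proof (rule sum_mono)
          fix t assume "t \<in> F"
          then have "avg_tail m (\<Phi> t) n (a - h) \<le> exp (- (real n * (K - \<epsilon> / 4)))"
            using elim(1) by blast
          also have "\<dots> \<le> exp (- (real n * (JT a - \<epsilon> / 2)))" using K by (simp add: mult_left_mono)
          finally show "avg_tail m (\<Phi> t) n (a - h) \<le> exp (- (real n * (JT a - \<epsilon> / 2)))" .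
        qed
        also have "\<dots> \<le> real n * exp (- (real n * (JT a - \<epsilon> / 2)))"
          using elim(4) by (simp add: mult_right_mono)
        finally have "measure (DP n) (S n a) \<le> real n * exp (- (real n * (JT a - \<epsilon> / 2))) + exp (- (real n * JT a))"
          using elim(2) by linarith
        also have "exp (- (real n * JT a)) \<le> 1 * exp (- (real n * (JT a - \<epsilon> / 2)))"
          using e by (simp add: mult_left_mono)
        also have "real n * exp (- (real n * (JT a - \<epsilon> / 2))) + 1 * exp (- (real n * (JT a - \<epsilon> / 2)))
            = (real (n + 1) ^ 1 * exp (- (real n * (\<epsilon> / 2)))) * exp (- (real n * (JT a - \<epsilon>)))"
          by (simp add: mult.assoc mult_exp_exp algebra_simps)
        also have "\<dots> \<le> 1 * exp (- (real n * (JT a - \<epsilon>)))"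
        proof (rule mult_right_mono)
          have "0 \<le> real (n + 1) ^ 1 * exp (- (real n * (\<epsilon> / 2)))" by simp
          then show "real (n + 1) ^ 1 * exp (- (real n * (\<epsilon> / 2))) \<le> 1" using elim(3) by linarith
        qed simp
        finally show ?case by simp
      qed
    qed
  qed
  moreover have "has_log_rate (\<lambda>n. avg_tail m (\<Phi> t) n a) (- rateJ m (\<Phi> t) a)"
    if "0 < a" "a < a0" "t \<in> T" for a t
    using that by (intro inj_avg_has_log_rate[OF T_props[OF that(3)]]) (auto simp: a0_def)
  moreover have "continuous_on {0<..<a0} (\<lambda>a. - JT a)"
    by (intro continuous_on_minus continuous_on_subset[OF JT_continuous]) (auto simp: a0_def)
  ultimately show "\<exists>a0>0. (\<forall>a. 0 < a \<and> a < a0 \<longrightarrow>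
      (\<forall>t\<in>T. has_log_rate (\<lambda>n. avg_tail m (\<Phi> t) n a) (- rateJ m (\<Phi> t) a)) \<and>
      has_log_rate (\<lambda>n. measure (DP n) (S n a)) (- (INF t\<in>T. rateJ m (\<Phi> t) a))) \<and>
    continuous_on {0<..<a0} (\<lambda>a. - (INF t\<in>T. rateJ m (\<Phi> t) a))"
    unfolding JT_def[symmetric] using a0 by blast
qed

end

end

section \<open>Transfer of rates, coordinate averages and bracketing\<close>

lemma has_log_rate_cong:
  assumes "\<forall>\<^sub>F n in sequentially. p n = q n"
  shows "has_log_rate p L \<longleftrightarrow> has_log_rate q L"
proof -
  have "(\<forall>\<^sub>F n in sequentially. p n > 0) \<longleftrightarrow> (\<forall>\<^sub>F n in sequentially. q n > 0)"
    by (rule eventually_cong[OF assms]) simp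
  moreover have "((\<lambda>n. ln (p n) / real n) \<longlonglongrightarrow> L) \<longleftrightarrow> ((\<lambda>n. ln (q n) / real n) \<longlonglongrightarrow> L)"
    by (rule tendsto_cong) (use assms in eventually_elim, simp)
  ultimately show ?thesis by (simp add: has_log_rate_def)
qed

lemma rate_eqI:
  assumes "has_log_rate (U_tail M X m \<Phi> a t) (- c)"
  shows "rate M X m \<Phi> a t = c" "rate_defined M X m \<Phi> a t"
proof -
  show "rate M X m \<Phi> a t = c"
    unfolding rate_def using assms
    by (rule the_equality) (use assms LIMSEQ_unique in \<open>fastforce simp: has_log_rate_def\<close>)
  show "rate_defined M X m \<Phi> a t" using assms by (auto simp: rate_defined_def)
qed

text \<open>Under a uniformly random permutation every coordinate is uniform on the sample. The
  lemma makes the empirical distribution function a U-statistic of degree \<open>m\<close>, so that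
  \<open>SU\<close> becomes a supremum of U-statistics with kernel \<open>Psi\<close>.\<close>

lemma (in sample_law) inj_avg_coordinate_mean:
  fixes u :: "'b \<Rightarrow> real"
  assumes m: "m \<ge> 1" "m \<le> n"
  shows "inj_avg m n (\<lambda>x. (\<Sum>j<m. u (x j)) / real m) x = (\<Sum>i<n. u (x i)) / real n"
proof -
  have single: "(\<Sum>\<pi> | \<pi> permutes {..<n}. u (x (\<pi> a))) / fact n = (\<Sum>i<n. u (x i)) / real n" if a: "a < n" for a
  proof -
    define e where "e = (\<lambda>j\<in>{..<Suc 0}. a)"
    have e: "e \<in> inj_tuples (Suc 0) n" using a by (auto simp: e_def inj_tuples_def inj_on_def)
    have "(\<Sum>i\<in>inj_tuples (Suc 0) n. u (x (i 0))) = (\<Sum>i<n. u (x i))"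
    proof (rule sum.reindex_bij_witness[of _ "\<lambda>i. \<lambda>j\<in>{..<Suc 0}. i" "\<lambda>i. i 0"])
      fix i assume i: "i \<in> inj_tuples (Suc 0) n"
      show "(\<lambda>j\<in>{..<Suc 0}. i 0) = i"
        using inj_tuples_ext[OF i] by (auto simp: fun_eq_iff extensional_def)
      show "i 0 \<in> {..<n}" using inj_tuples_less[OF i] by simp
    qed (auto simp: inj_tuples_def inj_on_def)
    moreover have "card (inj_tuples (Suc 0) n) = n" by (simp add: card_inj_tuples)
    ultimately show ?thesis
      using inj_avg_eq_permutation_average[OF e, of "\<lambda>y. u (y 0)" x] by (simp add: inj_avg_def e_def)
  qed
  define e where "e = (\<lambda>j\<in>{..<m}. j)"
  have e: "e \<in> inj_tuples m n" using m by (auto simp: e_def inj_tuples_def inj_on_def)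
  have "inj_avg m n (\<lambda>x. (\<Sum>j<m. u (x j)) / real m) x
      = (\<Sum>\<pi> | \<pi> permutes {..<n}. (\<Sum>j<m. u (x (\<pi> j))) / real m) / fact n"
    unfolding inj_avg_eq_permutation_average[OF e] by (simp add: e_def)
  also have "\<dots> = (\<Sum>j<m. (\<Sum>\<pi> | \<pi> permutes {..<n}. u (x (\<pi> j))) / fact n) / real m"
    by (simp add: sum_divide_distrib[symmetric] sum.swap[of _ "{..<m}"])
  also have "\<dots> = (\<Sum>i<n. u (x i)) / real n" using m single by simp
  finally show ?thesis .
qed

lemma (in sample_law) admissible_minus:
  assumes f: "admissible m f"
  shows "admissible m (\<lambda>x. - f x)" "kvar m (\<lambda>x. - f x) = kvar m f"
  using f by (auto simp: admissible_def kvar_def kproj_def)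

text \<open>The points are quantiles of \<open>G\<close> at the levels \<open>k / N\<close>, which
  exist by the intermediate value theorem. Towards either end, where no such point is available,
  \<open>G\<close> is within \<open>\<delta>\<close> of its limit 0 or 1.\<close>

lemma bracket_points:
  fixes G :: "real \<Rightarrow> real"
  assumes cont: "continuous_on UNIV G" and mono: "mono G"
    and bot: "(G \<longlongrightarrow> 0) at_bot" and top: "(G \<longlongrightarrow> 1) at_top" and d: "\<delta> > 0"
  shows "\<exists>F. finite F \<and> (\<forall>s\<in>F. 0 < G s \<and> G s < 1) \<and>
    (\<forall>t. ((\<exists>s\<in>F. s \<le> t \<and> G t - G s \<le> \<delta>) \<or> G t \<le> \<delta>) \<and> ((\<exists>s\<in>F. t \<le> s \<and> G s - G t \<le> \<delta>) \<or> 1 - G t \<le> \<delta>))"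
proof -
  have ge0: "0 \<le> G t" for t
    using tendsto_upperbound[OF bot, of "G t"] mono
    by (auto simp: eventually_at_bot_linorder mono_def intro: exI[of _ t])
  have le1: "G t \<le> 1" for t
    using tendsto_lowerbound[OF top, of "G t"] mono
    by (auto simp: eventually_at_top_linorder mono_def intro: exI[of _ t])
  have ex: "\<exists>q. G q = y" if y: "0 < y" "y < 1" for y
  proof -
    obtain p where p: "G p < y" using order_tendstoD(2)[OF bot y(1)] by (auto simp: eventually_at_bot_linorder)
    obtain r where r: "y < G r" using order_tendstoD(1)[OF top y(2)] by (auto simp: eventually_at_top_linorder)
    have "p \<le> r" using p r mono by (metis less_trans linear mono_def not_less)
    then show ?thesis
      using IVT'[of G p y r] p r continuous_on_subset[OF cont] by auto
  qed
  then obtain q where q: "\<And>y. 0 < y \<Longrightarrow> y < 1 \<Longrightarrow> G (q y) = y" by metis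
  obtain N :: nat where N: "2 / \<delta> < real N" using reals_Archimedean2 by blast
  have N0: "0 < real N" using N d by (smt (verit) divide_pos_pos)
  have Nd: "2 / real N \<le> \<delta>" using N N0 d by (simp add: field_simps)
  define F where "F = (\<lambda>k. q (real k / real N)) ` {1..<N}"
  have qk: "G (q (real k / real N)) = real k / real N" if "1 \<le> k" "k < N" for k
    using that N0 by (intro q) auto
  have lt: "s < t" if "G s < G t" for s t using that mono by (metis mono_def not_less)
  have "(\<exists>s\<in>F. s \<le> t \<and> G t - G s \<le> \<delta>) \<or> G t \<le> \<delta>" "(\<exists>s\<in>F. t \<le> s \<and> G s - G t \<le> \<delta>) \<or> 1 - G t \<le> \<delta>" for t
  proof -
    define k where "k = nat \<lfloor>real N * G t\<rfloor>"
    have "real k = of_int \<lfloor>real N * G t\<rfloor>" using ge0[of t] by (simp add: k_def)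
    then have "real k \<le> real N * G t" "real N * G t < real k + 1" by linarith+
    then have k: "real k / real N \<le> G t" "G t < (real k + 1) / real N"
      using N0 by (auto simp: field_simps)
    have "real k \<le> real N * 1" using \<open>real k \<le> real N * G t\<close> mult_left_mono[OF le1[of t], of "real N"] by linarith
    then have kN: "k \<le> N" by simp
    have dd: "(real k + 1) / real N = (real k - 1) / real N + 2 / real N" by (simp add: diff_divide_distrib add_divide_distrib)
    show "(\<exists>s\<in>F. s \<le> t \<and> G t - G s \<le> \<delta>) \<or> G t \<le> \<delta>"
    \<comment> \<open>Level \<open>k - 1\<close> instead of \<open>k\<close>: if
      \<open>G t = k / N\<close>, the chosen quantile of level \<open>k / N\<close> may lie to the
      right of \<open>t\<close> on a flat piece of \<open>G\<close>. Hence the requirement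
      \<open>2 / N \<le> \<delta>\<close>.\<close>
    proof (cases "k \<ge> 2")
      case True
      let ?s = "q (real (k - 1) / real N)"
      have Gs: "G ?s = (real k - 1) / real N" using qk[of "k - 1"] True kN by (simp add: of_nat_diff)
      have "(real k - 1) / real N < real k / real N" using N0 by (simp add: divide_strict_right_mono)
      then have "?s < t" using lt[of ?s t] Gs k by simp
      moreover have "G t - G ?s \<le> \<delta>" using Gs k dd Nd by linarith
      moreover have "?s \<in> F" unfolding F_def by (rule image_eqI[OF refl]) (use True kN in auto)
      ultimately show ?thesis by (intro disjI1 bexI[of _ ?s]) auto
    next
      case False
      then have "(real k + 1) / real N \<le> 2 / real N" using N0 by (intro divide_right_mono) auto
      then show ?thesis using k Nd by linarith
    qed
    show "(\<exists>s\<in>F. t \<le> s \<and> G s - G t \<le> \<delta>) \<or> 1 - G t \<le> \<delta>"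
    proof (cases "k + 1 < N")
      case True
      let ?s = "q (real (k + 1) / real N)"
      have Gs: "G ?s = (real k + 1) / real N" using qk[of "k + 1"] True by simp
      have "t < ?s" using lt[of t ?s] Gs k by simp
      moreover have "(real k + 1) / real N = real k / real N + 1 / real N" by (simp add: add_divide_distrib)
      then have "G ?s - G t \<le> \<delta>" using Gs k Nd N0 divide_right_mono[of 1 2 "real N"] by linarith
      moreover have "?s \<in> F" unfolding F_def by (rule image_eqI[OF refl]) (use True in auto)
      ultimately show ?thesis by (intro disjI1 bexI[of _ ?s]) auto
    next
      case False
      then have "real N \<le> real k + 1" by simp
      then have "1 \<le> real k / real N + 1 / real N" using N0 by (simp add: add_divide_distrib[symmetric])
      then show ?thesis using k Nd N0 divide_right_mono[of 1 2 "real N"] by linarith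
    qed
  qed
  moreover have "finite F" by (simp add: F_def)
  moreover have "\<forall>s\<in>F. 0 < G s \<and> G s < 1" using qk N0 by (auto simp: F_def)
  ultimately show ?thesis by blast
qed

section \<open>Empirical distribution functions\<close>

locale kernel_sample = prob_space M for M :: "'a measure" +
  fixes X :: "nat \<Rightarrow> 'a \<Rightarrow> real" and m :: nat and h :: "(nat \<Rightarrow> real) \<Rightarrow> real" and \<alpha> \<beta> :: ereal
  assumes indep: "indep_vars (\<lambda>_. borel) X UNIV"
    and ident: "\<And>i. distr M borel (X i) = distr M borel (X 0)"
    and m1: "m \<ge> 1"
    and h_meas: "h \<in> borel_measurable (PiM {..<m} (\<lambda>_. borel))"
    and h_sym: "symmetric_kernel m h"
    and ab: "\<alpha> < \<beta>"
    and G_cont: "continuous_on UNIV (\<lambda>t::real. kernel_df M X m h (ereal t))"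
    and G_\<alpha>: "kernel_df M X m h \<alpha> = 0" and G_\<beta>: "kernel_df M X m h \<beta> = 1"
begin

abbreviation law :: "real measure" where "law \<equiv> distr M borel (X 0)"

abbreviation G :: "ereal \<Rightarrow> real" where "G \<equiv> kernel_df M X m h"

lemma X_meas [measurable]: "X i \<in> borel_measurable M"
  using indep by (simp add: indep_vars_def2)

sublocale L: sample_law law
  by (simp add: sample_law_def prob_space_distr)

lemma sets_DP: "sets (L.DP n) = sets (PiM {..<n} (\<lambda>_. borel))"
  by (intro sets_PiM_cong) auto

lemma sample_meas [measurable]: "(\<lambda>\<omega>. \<lambda>i\<in>{..<n}. X i \<omega>) \<in> measurable M (L.DP n)"
  by (rule measurable_cong_sets[THEN equalityD1, THEN subsetD, OF refl sets_DP[symmetric]]) measurable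

lemma distr_sample:
  assumes "n \<ge> 1"
  shows "distr M (L.DP n) (\<lambda>\<omega>. \<lambda>i\<in>{..<n}. X i \<omega>) = L.DP n"
proof -
  have "indep_vars (\<lambda>_. borel) X {..<n}" by (rule indep_vars_subset[OF indep]) auto
  moreover have "{..<n} \<noteq> {}" using assms by (auto simp: lessThan_empty_iff)
  ultimately have "distr M (PiM {..<n} (\<lambda>_. borel)) (\<lambda>\<omega>. \<lambda>i\<in>{..<n}. X i \<omega>) = PiM {..<n} (\<lambda>i. distr M borel (X i))"
    by (subst (asm) indep_vars_iff_distr_eq_PiM') auto
  also have "\<dots> = L.DP n" by (intro PiM_cong refl ident)
  finally show ?thesis
    using distr_cong[of M M "L.DP n" "PiM {..<n} (\<lambda>_. borel)"] sets_DP[of n] by metis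
qed

lemma measure_sample:
  assumes "n \<ge> 1" "A \<in> sets (L.DP n)"
  shows "measure M {\<omega> \<in> space M. (\<lambda>i\<in>{..<n}. X i \<omega>) \<in> A} = measure (L.DP n) A"
proof -
  have "measure (L.DP n) A = measure (distr M (L.DP n) (\<lambda>\<omega>. \<lambda>i\<in>{..<n}. X i \<omega>)) A"
    using distr_sample[OF assms(1)] by simp
  also have "\<dots> = measure M ((\<lambda>\<omega>. \<lambda>i\<in>{..<n}. X i \<omega>) -` A \<inter> space M)"
    by (rule measure_distr[OF sample_meas assms(2)])
  finally show ?thesis by (simp add: vimage_def Int_def conj_commute)
qed

lemma integral_tuple:
  fixes f :: "(nat \<Rightarrow> real) \<Rightarrow> real"
  assumes "f \<in> borel_measurable (L.DP m)"
  shows "(\<integral>\<omega>. f (tuple m X \<omega>) \<partial>M) = (\<integral>x. f x \<partial>L.DP m)"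
  unfolding tuple_def using integral_distr[OF sample_meas assms] distr_sample[OF m1] by simp

lemma inj_avg_restrict: "inj_avg m n f (\<lambda>i\<in>{..<n}. x i) = inj_avg m n f x"
  unfolding inj_avg_def
  by (intro arg_cong2[where f="(/)"] sum.cong refl arg_cong[where f=f]) (auto simp: fun_eq_iff dest: inj_tuples_less)

lemma U_stat_sample:
  assumes "symmetric_kernel m k" "n \<ge> m"
  shows "U_stat m k n X \<omega> = inj_avg m n k (\<lambda>i\<in>{..<n}. X i \<omega>)"
  by (simp add: U_stat_eq_inj_avg[OF assms] inj_avg_restrict)

lemma symmetric_admissible:
  assumes "f \<in> borel_measurable (L.DP m)" "\<And>x. \<bar>f x\<bar> \<le> 1" "symmetric_kernel m f" "(\<integral>x. f x \<partial>L.DP m) = 0"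
  shows "L.admissible m f"
  using assms m1 by (auto simp: L.admissible_def symmetric_kernel_def)

text \<open>\<open>cond_exp_at\<close> picks an arbitrary version of the conditional expectation. By
  \<open>integral_kproj\<close>, tested on indicators, \<open>kproj\<close> is a version too;
  versions agree almost surely and have the same second moment.\<close>

lemma variance_fun_eq:
  assumes f: "L.admissible m (\<lambda>y. \<Phi> y t)"
  shows "variance_fun M X m \<Phi> t = L.kvar m (\<lambda>y. \<Phi> y t)"
proof -
  let ?f = "\<lambda>y. \<Phi> y t"
  let ?Y = "\<lambda>\<omega>. \<Phi> (tuple m X \<omega>) t"
  let ?F = "vimage_algebra (space M) (X 0) borel"
  let ?k = "L.kproj m ?f"
  have m0: "0 < m" using m1 by simp
  note f_meas = L.admissibleD(2)[OF f] and f_bound = L.admissibleD(3)[OF f]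
  have k_meas[measurable]: "?k \<in> borel_measurable borel"
    using L.kproj_measurable[OF L.admissibleD(1-3)[OF f]] by simp
  have k_bound: "\<bar>?k s\<bar> \<le> 1" for s using L.kproj_bound[OF L.admissibleD(1-3)[OF f]] .
  have X_F: "X 0 \<in> measurable ?F borel" by (rule measurable_vimage_algebra1) auto
  have sub: "subalgebra M ?F"
    unfolding subalgebra_def using X_meas[of 0]
    by (auto simp: sets_vimage_algebra2 dest: measurable_sets)
  interpret finite_measure_subalgebra M ?F by unfold_locales (rule sub)
  have Y_meas[measurable]: "?Y \<in> borel_measurable M"
    unfolding tuple_def by (rule measurable_compose[OF sample_meas f_meas])
  have Y_int: "integrable M ?Y" using f_bound by (intro integrable_bounded[where B=1]) auto
  have k_int: "integrable M (\<lambda>\<omega>. ?k (X 0 \<omega>))" using k_bound by (intro integrable_bounded[where B=1]) auto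
  have ce: "AE \<omega> in M. real_cond_exp M ?F ?Y \<omega> = ?k (X 0 \<omega>)"
  proof (rule real_cond_exp_charact[OF _ Y_int k_int])
    show "(\<lambda>\<omega>. ?k (X 0 \<omega>)) \<in> borel_measurable ?F" by (rule measurable_compose[OF X_F k_meas])
    fix A assume "A \<in> sets ?F"
    then obtain B where B: "B \<in> sets borel" "A = X 0 -` B \<inter> space M"
      by (auto simp: sets_vimage_algebra2)
    have "set_lebesgue_integral M A ?Y = (\<integral>\<omega>. ?f (tuple m X \<omega>) * indicator B (tuple m X \<omega> 0) \<partial>M)"
      unfolding set_lebesgue_integral_def using m0
      by (intro Bochner_Integration.integral_cong refl) (auto simp: B(2) indicator_def tuple_def)
    also have "\<dots> = (\<integral>x. ?f x * indicator B (x 0) \<partial>L.DP m)"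
      using f_meas B(1) m0
      by (intro integral_tuple borel_measurable_times
          measurable_compose[OF measurable_component_singleton[of 0 "{..<m}" "\<lambda>_. law"]]) auto
    also have "\<dots> = (\<integral>s. ?k s * indicator B s \<partial>law)"
      using B(1) by (intro L.integral_kproj[OF L.admissibleD(1-3)[OF f], where B=1]) (auto simp: indicator_def)
    also have "\<dots> = (\<integral>\<omega>. ?k (X 0 \<omega>) * indicator B (X 0 \<omega>) \<partial>M)"
      using B(1) by (intro integral_distr) auto
    also have "\<dots> = set_lebesgue_integral M A (\<lambda>\<omega>. ?k (X 0 \<omega>))"
      unfolding set_lebesgue_integral_def
      by (intro Bochner_Integration.integral_cong refl) (auto simp: B(2) indicator_def)
    finally show "set_lebesgue_integral M A ?Y = set_lebesgue_integral M A (\<lambda>\<omega>. ?k (X 0 \<omega>))" .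
  qed
  define \<phi> where "\<phi> = cond_exp_at M ?Y (X 0)"
  have "\<phi> \<in> borel_measurable borel \<and> (AE \<omega> in M. \<phi> (X 0 \<omega>) = real_cond_exp M ?F ?Y \<omega>)"
    unfolding \<phi>_def cond_exp_at_def
    by (rule someI[of _ ?k]) (use ce k_meas in \<open>auto elim: eventually_mono\<close>)
  then have \<phi>[measurable]: "\<phi> \<in> borel_measurable borel" and eq: "AE \<omega> in M. \<phi> (X 0 \<omega>) = real_cond_exp M ?F ?Y \<omega>"
    by auto
  have "variance_fun M X m \<Phi> t = (\<integral>\<omega>. (\<phi> (X 0 \<omega>))\<^sup>2 \<partial>M)"
    by (simp add: variance_fun_def projection_def \<phi>_def)
  also have "\<dots> = (\<integral>\<omega>. (?k (X 0 \<omega>))\<^sup>2 \<partial>M)"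
    using eq ce by (intro integral_cong_AE) auto
  also have "\<dots> = L.kvar m ?f"
    unfolding L.kvar_def by (intro integral_distr[symmetric]) auto
  finally show ?thesis .
qed

lemma h_meas_DP [measurable]: "h \<in> borel_measurable (L.DP m)"
  using h_meas measurable_cong_sets[OF sets_DP[of m] refl] by blast

lemma G_integral: "G t = (\<integral>x. of_bool (ereal (h x) < t) \<partial>L.DP m)"
proof -
  interpret S: prob_space "L.DP m" by (rule L.prob_space_DP)
  have A: "{x \<in> space (L.DP m). ereal (h x) < t} \<in> sets (L.DP m)" by measurable
  have "{\<omega> \<in> space M. ereal (h (tuple m X \<omega>)) < t}
      = {\<omega> \<in> space M. (\<lambda>i\<in>{..<m}. X i \<omega>) \<in> {x \<in> space (L.DP m). ereal (h x) < t}}"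
    by (auto simp: tuple_def space_PiM)
  then have "G t = measure (L.DP m) {x \<in> space (L.DP m). ereal (h x) < t}"
    using measure_sample[OF m1 A] by (simp add: kernel_df_def)
  also have "\<dots> = (\<integral>x. indicator {x \<in> space (L.DP m). ereal (h x) < t} x \<partial>L.DP m)"
    using A by simp
  also have "\<dots> = (\<integral>x. of_bool (ereal (h x) < t) \<partial>L.DP m)"
    by (intro Bochner_Integration.integral_cong refl) (auto simp: indicator_def)
  finally show ?thesis .
qed

lemma G_bounds: "0 \<le> G t" "G t \<le> 1"
  by (auto simp: kernel_df_def)

lemma G_infty: "G \<infinity> = 1" "G (-\<infinity>) = 0"
  by (simp_all add: kernel_df_def prob_space)

lemma hX_meas [measurable]: "(\<lambda>\<omega>. h (tuple m X \<omega>)) \<in> borel_measurable M"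
  unfolding tuple_def by (rule measurable_compose[OF sample_meas h_meas_DP])

lemma G_mono: "s \<le> t \<Longrightarrow> G s \<le> G t"
  unfolding kernel_df_def by (intro finite_measure_mono) (auto intro: less_le_trans)

text \<open>\<open>G\<close> is defined with a strict inequality, so it is squeezed between the
  values of the cdf at \<open>t - 1\<close> and at \<open>t\<close>.\<close>

lemma G_limits: "((\<lambda>t. G (ereal t)) \<longlongrightarrow> 0) at_bot" "((\<lambda>t. G (ereal t)) \<longlongrightarrow> 1) at_top"
proof -
  let ?H = "distr M borel (\<lambda>\<omega>. h (tuple m X \<omega>))"
  interpret H: real_distribution ?H by (simp add: real_distribution_distr)
  have cdf: "cdf ?H t = measure M {\<omega> \<in> space M. h (tuple m X \<omega>) \<le> t}" for t
    by (simp add: cdf_def measure_distr vimage_def Int_def conj_commute)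
  have le: "G (ereal t) \<le> cdf ?H t" for t
    unfolding cdf kernel_df_def by (intro finite_measure_mono) auto
  have ge: "cdf ?H (t - 1) \<le> G (ereal t)" for t
    unfolding cdf kernel_df_def by (intro finite_measure_mono) auto
  show "((\<lambda>t. G (ereal t)) \<longlongrightarrow> 0) at_bot"
    by (rule tendsto_sandwich[OF _ _ tendsto_const H.cdf_lim_at_bot]) (auto simp: G_bounds le)
  have "filterlim (\<lambda>t::real. t - 1) at_top at_top" by real_asymp
  from filterlim_compose[OF H.cdf_lim_at_top_prob this]
  show "((\<lambda>t. G (ereal t)) \<longlongrightarrow> 1) at_top"
    by (rule tendsto_sandwich[OF _ _ _ tendsto_const, rotated 2]) (auto simp: G_bounds ge)
qed

text \<open>Places the bracket points in the parameter interval, where the families are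
  centred.\<close>

lemma G_interior:
  assumes "0 < G (ereal s)" "G (ereal s) < 1"
  shows "ereal s \<in> {\<alpha>..\<beta>}"
proof -
  have "\<not> ereal s \<le> \<alpha>" "\<not> \<beta> \<le> ereal s"
    using G_mono[of "ereal s" \<alpha>] G_mono[of \<beta> "ereal s"] G_\<alpha> G_\<beta> assms by auto
  then show ?thesis by (simp add: not_le less_imp_le)
qed

end

section \<open>Discretising the supremum over the parameter\<close>

lemma inj_avg_diff: "inj_avg m n (\<lambda>y. f y - g y) x = inj_avg m n f x - inj_avg m n g x"
  by (simp add: inj_avg_def sum_subtractf diff_divide_distrib)

lemma inj_avg_minus: "inj_avg m n (\<lambda>y. - f y) x = - inj_avg m n f x"
  by (simp add: inj_avg_def sum_negf)

lemma inj_avg_mono: "(\<And>y. f y \<le> g y) \<Longrightarrow> inj_avg m n f x \<le> inj_avg m n g x"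
  unfolding inj_avg_def by (intro divide_right_mono sum_mono) auto

lemma indicator_left_limit:
  "((\<lambda>t. of_bool (ereal y < ereal t) :: real) \<longlongrightarrow> of_bool (ereal y < ereal t)) (at_left t)"
proof (rule tendsto_eventually)
  show "\<forall>\<^sub>F s in at_left t. (of_bool (ereal y < ereal s) :: real) = of_bool (ereal y < ereal t)"
  proof (cases "y < t")
    case True
    then have "\<forall>\<^sub>F s in at_left t. s \<in> {y<..<t}" by (rule eventually_at_left_real)
    then show ?thesis using True by (auto elim: eventually_mono)
  next
    case False
    have "\<forall>\<^sub>F s in at_left t. s < t" by (auto simp: eventually_at_filter)
    then show ?thesis using False by (auto elim: eventually_mono)
  qed
qed

context kernel_sample
begin

text \<open>The common form of the two families: \<open>b\<close> is what is subtracted from the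
  indicator of \<open>h\<close>, namely \<open>G t\<close> itself for \<open>Theta\<close> and the
  mean of the coordinate indicators for \<open>Psi\<close>. It shares with that indicator the
  monotonicity, the left continuity and the mean \<open>G t\<close>.\<close>

context
  fixes b :: "(nat \<Rightarrow> real) \<Rightarrow> ereal \<Rightarrow> real" and \<Phi> :: kernel_family
  assumes b_meas: "\<And>t. (\<lambda>y. b y t) \<in> borel_measurable (L.DP m)"
    and b_sym: "\<And>t. symmetric_kernel m (\<lambda>y. b y t)"
    and b_bounds: "\<And>y t. 0 \<le> b y t" "\<And>y t. b y t \<le> 1"
    and b_mono: "\<And>y s t. s \<le> t \<Longrightarrow> b y s \<le> b y t"
    and b_infty: "\<And>y. b y \<infinity> = 1" "\<And>y. b y (-\<infinity>) = 0"
    and b_left: "\<And>y t. ((\<lambda>t. b y (ereal t)) \<longlongrightarrow> b y (ereal t)) (at_left t)"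
    and b_integral: "\<And>t. t \<in> {\<alpha>..\<beta>} \<Longrightarrow> (\<integral>y. b y t \<partial>L.DP m) = G t"
    and \<Phi>_eq: "\<Phi> = (\<lambda>y t. of_bool (ereal (h y) < t) - b y t)"
begin

private lemma ind_meas: "(\<lambda>y. of_bool (ereal (h y) < t) :: real) \<in> borel_measurable (L.DP m)"
  by measurable

private lemma \<Phi>_meas: "(\<lambda>y. \<Phi> y t) \<in> borel_measurable (L.DP m)"
  unfolding \<Phi>_eq by (intro borel_measurable_diff ind_meas b_meas)

private lemma \<Phi>_bound: "\<bar>\<Phi> y t\<bar> \<le> 1"
  using b_bounds[of y t] by (auto simp: \<Phi>_eq of_bool_def)

private lemma \<Phi>_sym: "symmetric_kernel m (\<lambda>y. \<Phi> y t)"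
  using h_sym b_sym[of t] by (simp add: symmetric_kernel_def \<Phi>_eq)

private lemma \<Phi>_adm: "t \<in> {\<alpha>..\<beta>} \<Longrightarrow> L.admissible m (\<lambda>y. \<Phi> y t)"
proof (rule symmetric_admissible[OF \<Phi>_meas \<Phi>_bound \<Phi>_sym])
  interpret S: prob_space "L.DP m" by (rule L.prob_space_DP)
  assume t: "t \<in> {\<alpha>..\<beta>}"
  have "integrable (L.DP m) (\<lambda>y. of_bool (ereal (h y) < t) :: real)"
    by (rule S.integrable_bounded[OF ind_meas, where B=1]) auto
  moreover have "integrable (L.DP m) (\<lambda>y. b y t)"
    using b_bounds by (intro S.integrable_bounded[OF b_meas, where B=1]) (auto simp: abs_le_iff intro: order_trans[of _ 0])
  ultimately show "(\<integral>x. \<Phi> x t \<partial>L.DP m) = 0"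
    unfolding \<Phi>_eq using b_integral[OF t] G_integral[of t] by simp
qed

text \<open>An absolute deviation is a deviation in one of two directions; the Boolean merges
  \<open>\<Phi>\<close> and its negative into one family, to which \<open>sup_log_rate\<close>
  applies once.\<close>

private definition signed :: "ereal \<times> bool \<Rightarrow> (nat \<Rightarrow> real) \<Rightarrow> real" where
  "signed p = (if snd p then (\<lambda>y. \<Phi> y (fst p)) else (\<lambda>y. - \<Phi> y (fst p)))"

private definition E :: "nat \<Rightarrow> real \<Rightarrow> (nat \<Rightarrow> real) set" where
  "E n a = {x \<in> space (L.DP n). \<exists>t::real. a < \<bar>inj_avg m n (\<lambda>y. \<Phi> y (ereal t)) x\<bar>}"

private lemma Z_left: "((\<lambda>t. inj_avg m n (\<lambda>y. \<Phi> y (ereal t)) x) \<longlongrightarrow> inj_avg m n (\<lambda>y. \<Phi> y (ereal t)) x) (at_left t)"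
  unfolding inj_avg_def divide_inverse \<Phi>_eq
  by (intro tendsto_mult tendsto_sum tendsto_diff tendsto_const indicator_left_limit b_left)

text \<open>A deviation above \<open>a\<close> at \<open>t\<close> persists slightly to the left of
  \<open>t\<close>, by left continuity, so rational parameters suffice and the union is
  countable.\<close>

private lemma E_meas: "E n a \<in> sets (L.DP n)"
proof -
  have Z_meas: "inj_avg m n (\<lambda>y. \<Phi> y t) \<in> borel_measurable (L.DP n)" for t
    by (rule L.measurable_inj_avg[OF \<Phi>_meas])
  have "E n a = (\<Union>t\<in>\<rat>. {x \<in> space (L.DP n). a < \<bar>inj_avg m n (\<lambda>y. \<Phi> y (ereal t)) x\<bar>})"
  proof (intro equalityI subsetI)
    fix x assume "x \<in> E n a"
    then obtain t :: real where x: "x \<in> space (L.DP n)" and t: "a < \<bar>inj_avg m n (\<lambda>y. \<Phi> y (ereal t)) x\<bar>"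
      by (auto simp: E_def)
    have "\<forall>\<^sub>F s in at_left t. a < \<bar>inj_avg m n (\<lambda>y. \<Phi> y (ereal s)) x\<bar>"
      by (rule order_tendstoD(1)[OF tendsto_rabs[OF Z_left] t])
    then obtain c where c: "c < t" "\<And>s. c < s \<Longrightarrow> s < t \<Longrightarrow> a < \<bar>inj_avg m n (\<lambda>y. \<Phi> y (ereal s)) x\<bar>"
      unfolding eventually_at_left_field by auto
    obtain s where "s \<in> \<rat>" "c < s" "s < t" using Rats_dense_in_real[OF c(1)] by blast
    with c(2) x show "x \<in> (\<Union>t\<in>\<rat>. {x \<in> space (L.DP n). a < \<bar>inj_avg m n (\<lambda>y. \<Phi> y (ereal t)) x\<bar>})"
      by blast
  qed (auto simp: E_def)
  also have "\<dots> \<in> sets (L.DP n)"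
    using Z_meas countable_rat by (intro sets.countable_UN') (auto simp: image_subset_iff)
  finally show ?thesis .
qed

private lemma b_integral_ends:
  assumes "p \<in> ereal ` F \<union> {-\<infinity>, \<infinity>}" "\<forall>s\<in>F. 0 < G (ereal s) \<and> G (ereal s) < 1"
  shows "(\<integral>y. b y p \<partial>L.DP m) = G p"
proof -
  interpret S: prob_space "L.DP m" by (rule L.prob_space_DP)
  show ?thesis
    using assms b_integral[OF G_interior] by (auto simp: b_infty G_infty S.prob_space)
qed

text \<open>Between two neighbouring bracket points the monotone process \<open>b\<close> moves by at least \<open>\<epsilon>\<close>
  only with superexponentially small probability, so a finite set of parameters suffices.\<close>

private lemma E_discretize:
  assumes e: "0 < \<epsilon>" "\<epsilon> < a"
  shows "\<exists>F\<subseteq>{\<alpha>..\<beta>} \<times> UNIV. finite F \<and> (\<forall>\<^sub>F n in sequentially.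
      measure (L.DP n) (E n a) \<le> (\<Sum>p\<in>F. L.avg_tail m (signed p) n (a - \<epsilon>))
        + exp (- (real n * K)))"
proof -
  \<comment> \<open>One more than the required rate, so that the number of brackets is
    absorbed.\<close>
  define L' where "L' = max K 0 + 1"
  have L': "0 \<le> L'" "K + 1 \<le> L'" by (auto simp: L'_def)
  define r where "r = (2 * real m * L' + 1) / \<epsilon>"
  have r: "0 < r" "r * \<epsilon> = 2 * real m * L' + 1" using e L' by (auto simp: r_def add_nonneg_pos)
  \<comment> \<open>An increment of \<open>b\<close> over a bracket is bounded by 1 and has mean at
    most \<open>2 * \<delta>\<close>, exactly what \<open>exp_integral_le_2\<close> admits at this
    \<open>r\<close>.\<close>
  define \<delta> where "\<delta> = 1 / (2 * (r * exp r))"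
  have d: "0 < \<delta>" "r * exp r * (2 * \<delta>) = 1" using r by (auto simp: \<delta>_def)
  have "mono (\<lambda>t. G (ereal t))" by (auto simp: mono_def intro: G_mono)
  from bracket_points[OF G_cont this G_limits d(1)]
  obtain F where F: "finite F" "\<forall>s\<in>F. 0 < G (ereal s) \<and> G (ereal s) < 1"
    and br: "\<And>t. (\<exists>s\<in>F. s \<le> t \<and> G (ereal t) - G (ereal s) \<le> \<delta>) \<or> G (ereal t) \<le> \<delta>"
      "\<And>t. (\<exists>s\<in>F. t \<le> s \<and> G (ereal s) - G (ereal t) \<le> \<delta>) \<or> 1 - G (ereal t) \<le> \<delta>"
    by blast
  define P where "P = ereal ` F \<union> {-\<infinity>, \<infinity>}"
  define Br where "Br = {(l, u) \<in> P \<times> P. l \<le> u \<and> G u - G l \<le> 2 * \<delta>}"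
  have finP: "finite P" using F by (simp add: P_def)
  have finBr: "finite Br" by (rule finite_subset[of _ "P \<times> P"]) (use finP in \<open>auto simp: Br_def\<close>)
  have bracket: "\<exists>l u. (l, u) \<in> Br \<and> l \<le> ereal t \<and> ereal t \<le> u" for t
  proof -
    have "\<exists>l\<in>P. l \<le> ereal t \<and> G (ereal t) - G l \<le> \<delta>"
    proof (cases "G (ereal t) \<le> \<delta>")
      case True
      then show ?thesis by (intro bexI[of _ "-\<infinity>"]) (auto simp: P_def G_infty)
    next
      case False
      then obtain s where "s \<in> F" "s \<le> t" "G (ereal t) - G (ereal s) \<le> \<delta>" using br(1)[of t] by auto
      then show ?thesis by (intro bexI[of _ "ereal s"]) (auto simp: P_def)
    qed
    then obtain l where l: "l \<in> P" "l \<le> ereal t" "G (ereal t) - G l \<le> \<delta>" by blast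
    have "\<exists>u\<in>P. ereal t \<le> u \<and> G u - G (ereal t) \<le> \<delta>"
    proof (cases "1 - G (ereal t) \<le> \<delta>")
      case True
      then show ?thesis by (intro bexI[of _ "\<infinity>"]) (auto simp: P_def G_infty)
    next
      case False
      then obtain s where "s \<in> F" "t \<le> s" "G (ereal s) - G (ereal t) \<le> \<delta>" using br(2)[of t] by auto
      then show ?thesis by (intro bexI[of _ "ereal s"]) (auto simp: P_def)
    qed
    then obtain u where u: "u \<in> P" "ereal t \<le> u" "G u - G (ereal t) \<le> \<delta>" by blast
    show ?thesis
      by (rule exI[of _ l], rule exI[of _ u]) (use l u in \<open>auto simp: Br_def\<close>)
  qed
  define FF where "FF = ereal ` F \<times> (UNIV :: bool set)"
  have finFF: "finite FF" using F by (simp add: FF_def)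
  have subFF: "FF \<subseteq> {\<alpha>..\<beta>} \<times> UNIV" using F(2) G_interior by (auto simp: FF_def)
  let ?U = "\<lambda>n p. {x \<in> space (L.DP n). inj_avg m n (signed p) x \<ge> a - \<epsilon>}"
  let ?B = "\<lambda>n q. {x \<in> space (L.DP n). inj_avg m n (\<lambda>y. b y (snd q) - b y (fst q)) x \<ge> \<epsilon>}"
  have signed_meas: "signed p \<in> borel_measurable (L.DP m)" for p
    using \<Phi>_meas by (auto simp: signed_def)
  have U_meas: "?U n p \<in> sets (L.DP n)" for n p
    using L.measurable_inj_avg[OF signed_meas] by measurable
  have db_meas: "(\<lambda>y. b y (snd q) - b y (fst q)) \<in> borel_measurable (L.DP m)" for q
    by (intro borel_measurable_diff b_meas)
  have B_meas: "?B n q \<in> sets (L.DP n)" for n q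
    using L.measurable_inj_avg[OF db_meas] by measurable
  \<comment> \<open>By monotonicity a positive deviation at \<open>t\<close> persists at the upper
    bracket point and a negative one at the lower, up to the increment of the average of
    \<open>b\<close> over the bracket.\<close>
  have cover: "E n a \<subseteq> (\<Union>p\<in>FF. ?U n p) \<union> (\<Union>q\<in>Br. ?B n q)" for n
  proof
    fix x assume "x \<in> E n a"
    then obtain t where x: "x \<in> space (L.DP n)" and t: "a < \<bar>inj_avg m n (\<lambda>y. \<Phi> y (ereal t)) x\<bar>"
      by (auto simp: E_def)
    obtain l u where lu: "(l, u) \<in> Br" "l \<le> ereal t" "ereal t \<le> u" using bracket by blast
    let ?H = "\<lambda>t. inj_avg m n (\<lambda>y. of_bool (ereal (h y) < t)) x"
    let ?b = "\<lambda>t. inj_avg m n (\<lambda>y. b y t) x"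
    have Z: "inj_avg m n (\<lambda>y. \<Phi> y s) x = ?H s - ?b s" for s
      unfolding \<Phi>_eq by (rule inj_avg_diff)
    have Hm: "?H s \<le> ?H s'" if "s \<le> s'" for s s'
      using that by (intro inj_avg_mono) (auto simp: of_bool_def intro: less_le_trans)
    have bm: "?b s \<le> ?b s'" if "s \<le> s'" for s s'
      using that by (intro inj_avg_mono b_mono)
    \<comment> \<open>At infinite bracket points the kernel vanishes identically, so a deviation of
      at least \<open>a - \<epsilon> > 0\<close> can only come from a finite one.\<close>
    have Zinf: "inj_avg m n (\<lambda>y. \<Phi> y s) x = 0" if "s = \<infinity> \<or> s = -\<infinity>" for s
      using that by (auto simp: \<Phi>_eq b_infty inj_avg_def)
    have inFF: "(s, c) \<in> FF" if "s \<in> P" "inj_avg m n (\<lambda>y. \<Phi> y s) x \<noteq> 0" for s c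
      using that Zinf[of s] by (auto simp: FF_def P_def)
    have P: "l \<in> P" "u \<in> P" using lu(1) by (auto simp: Br_def)
    show "x \<in> (\<Union>p\<in>FF. ?U n p) \<union> (\<Union>q\<in>Br. ?B n q)"
    proof (cases "?b u - ?b l \<ge> \<epsilon>")
      case True
      then have "x \<in> ?B n (l, u)" using x by (simp add: inj_avg_diff)
      with lu(1) show ?thesis by blast
    next
      case False
      consider "?H (ereal t) - ?b (ereal t) > a" | "?b (ereal t) - ?H (ereal t) > a"
        using t unfolding Z by linarith
      then show ?thesis
      proof cases
        case 1
        then have ge: "inj_avg m n (\<lambda>y. \<Phi> y u) x \<ge> a - \<epsilon>"
          using Hm[OF lu(3)] bm[OF lu(2)] False unfolding Z by linarith
        then have "(u, True) \<in> FF" using e by (intro inFF P) auto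
        moreover have "x \<in> ?U n (u, True)" using x ge by (simp add: signed_def)
        ultimately show ?thesis by blast
      next
        case 2
        then have ge: "- inj_avg m n (\<lambda>y. \<Phi> y l) x \<ge> a - \<epsilon>"
          using Hm[OF lu(2)] bm[OF lu(3)] False unfolding Z by linarith
        then have "(l, False) \<in> FF" using e by (intro inFF P) auto
        moreover have "x \<in> ?U n (l, False)" using x ge by (simp add: signed_def inj_avg_minus)
        ultimately show ?thesis by blast
      qed
    qed
  qed
  have B_small: "measure (L.DP n) (?B n q) \<le> exp (- (real n * L'))" if q: "q \<in> Br" and n: "n \<ge> m" for q n
  proof -
    interpret S: prob_space "L.DP m" by (rule L.prob_space_DP)
    let ?f = "\<lambda>y. b y (snd q) - b y (fst q)"
    obtain l u where lu: "q = (l, u)" "l \<in> P" "u \<in> P" "l \<le> u" "G u - G l \<le> 2 * \<delta>"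
      using q by (auto simp: Br_def)
    have f_bound: "\<bar>?f y\<bar> \<le> 1" for y
      using b_bounds[of y u] b_bounds[of y l] by (simp add: lu(1) abs_le_iff)
    have ib: "integrable (L.DP m) (\<lambda>y. b y s)" for s
      using b_bounds by (intro S.integrable_bounded[OF b_meas, where B=1]) (auto simp: abs_le_iff intro: order_trans[of _ 0])
    have "(\<integral>y. \<bar>?f y\<bar> \<partial>L.DP m) = (\<integral>y. b y u - b y l \<partial>L.DP m)"
      using b_mono[OF lu(4)] by (intro Bochner_Integration.integral_cong refl) (simp add: lu(1))
    also have "\<dots> = G u - G l"
      using ib b_integral_ends[OF _ F(2)] lu(2,3) by (simp add: P_def)
    finally have "r * exp r * (\<integral>y. \<bar>?f y\<bar> \<partial>L.DP m) \<le> r * exp r * (2 * \<delta>)"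
      using r lu(5) by (intro mult_left_mono) auto
    then have small: "r * exp r * (\<integral>y. \<bar>?f y\<bar> \<partial>L.DP m) \<le> 1" using d(2) by linarith
    have mgf: "(\<integral>y. exp (r * ?f y) \<partial>L.DP m) \<le> 2"
      by (rule L.exp_integral_le_2[OF db_meas f_bound _ _ small]) (use r in auto)
    show ?thesis
      by (rule L.inj_avg_superexp_tail[OF db_meas f_bound m1 n _ _ mgf L'(1)]) (use r in auto)
  qed
  have "(\<lambda>n. 2 * real (n + 1) ^ 1 * exp (- (real n * 1))) \<longlonglongrightarrow> 0"
    by (rule poly_times_exp_tendsto_0) simp
  then have "\<forall>\<^sub>F n in sequentially. 2 * real (n + 1) ^ 1 * exp (- (real n * 1)) < 1"
    by (rule order_tendstoD(2)) simp
  then have "\<forall>\<^sub>F n in sequentially. measure (L.DP n) (E n a) \<le> (\<Sum>p\<in>FF. measure (L.DP n) (?U n p)) + exp (- (real n * K))"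
    using eventually_ge_at_top[of m] eventually_ge_at_top[of "card Br"]
  proof eventually_elim
    case (elim n)
    interpret N: prob_space "L.DP n" by (rule L.prob_space_DP)
    have UU: "(\<Union>p\<in>FF. ?U n p) \<in> sets (L.DP n)" by (rule sets.finite_UN[OF finFF U_meas])
    have UB: "(\<Union>q\<in>Br. ?B n q) \<in> sets (L.DP n)" by (rule sets.finite_UN[OF finBr B_meas])
    have "measure (L.DP n) (E n a) \<le> measure (L.DP n) ((\<Union>p\<in>FF. ?U n p) \<union> (\<Union>q\<in>Br. ?B n q))"
      by (rule N.finite_measure_mono[OF cover sets.Un[OF UU UB]])
    also have "\<dots> \<le> measure (L.DP n) (\<Union>p\<in>FF. ?U n p) + measure (L.DP n) (\<Union>q\<in>Br. ?B n q)"
      by (rule measure_Un_le[OF UU UB])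
    also have "\<dots> \<le> (\<Sum>p\<in>FF. measure (L.DP n) (?U n p)) + (\<Sum>q\<in>Br. measure (L.DP n) (?B n q))"
      by (intro add_mono measure_UNION_le finFF finBr U_meas B_meas)
    also have "(\<Sum>q\<in>Br. measure (L.DP n) (?B n q)) \<le> (\<Sum>q\<in>Br. exp (- (real n * L')))"
      using B_small elim(2) by (intro sum_mono) auto
    also have "\<dots> = real (card Br) * exp (- (real n * L'))" by simp
    also have "\<dots> \<le> real (n + 1) ^ 1 * exp (- (real n * (K + 1)))"
      using elim(3) L'(2) by (intro mult_mono) (auto intro!: mult_left_mono)
    also have "\<dots> = (real (n + 1) ^ 1 * exp (- (real n * 1))) * exp (- (real n * K))"
      by (simp add: mult.assoc mult_exp_exp algebra_simps)
    also have "\<dots> \<le> 1 * exp (- (real n * K))"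
    proof (rule mult_right_mono)
      have "0 \<le> real (n + 1) ^ 1 * exp (- (real n * 1))" by simp
      then show "real (n + 1) ^ 1 * exp (- (real n * 1)) \<le> 1" using elim(1) by linarith
    qed simp
    finally show ?case by simp
  qed
  then show ?thesis using finFF subFF by blast
qed

private lemma signed_adm: "p \<in> {\<alpha>..\<beta>} \<times> UNIV \<Longrightarrow> L.admissible m (signed p)"
  using \<Phi>_adm L.admissible_minus(1)[OF \<Phi>_adm] by (auto simp: signed_def)

private lemma signed_kvar: "p \<in> {\<alpha>..\<beta>} \<times> UNIV \<Longrightarrow> L.kvar m (signed p) = variance_fun M X m \<Phi> (fst p)"
  using variance_fun_eq[of \<Phi> "fst p"] \<Phi>_adm L.admissible_minus(2)[OF \<Phi>_adm, of "fst p"]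
  by (auto simp: signed_def)

private lemma neg_variance: "t \<in> {\<alpha>..\<beta>} \<Longrightarrow> variance_fun M X m (neg_family \<Phi>) t = variance_fun M X m \<Phi> t"
  using variance_fun_eq[of \<Phi> t] variance_fun_eq[of "neg_family \<Phi>" t] \<Phi>_adm[of t] L.admissible_minus[OF \<Phi>_adm, of t]
  by (simp add: neg_family_def)

private lemma neg_T:
  "large_variance_set M X m \<alpha> \<beta> (neg_family \<Phi>) = large_variance_set M X m \<alpha> \<beta> \<Phi>"
proof -
  have "sup_variance M X m \<alpha> \<beta> (neg_family \<Phi>) = sup_variance M X m \<alpha> \<beta> \<Phi>"
    unfolding sup_variance_def using neg_variance by (intro SUP_cong) auto
  then show ?thesis unfolding large_variance_set_def using neg_variance by auto
qed

private lemma U_tail_eq: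
  assumes "n \<ge> m"
  shows "U_tail M X m \<Phi> a t n = L.avg_tail m (signed (t, True)) n a"
    "U_tail M X m (neg_family \<Phi>) a t n = L.avg_tail m (signed (t, False)) n a"
proof -
  have n1: "n \<ge> 1" using assms m1 by simp
  have gen: "measure M {\<omega> \<in> space M. U_stat m f n X \<omega> \<ge> a} = L.avg_tail m f n a"
    if f: "f \<in> borel_measurable (L.DP m)" "symmetric_kernel m f" for f
  proof -
    have A: "{x \<in> space (L.DP n). inj_avg m n f x \<ge> a} \<in> sets (L.DP n)"
      using L.measurable_inj_avg[OF f(1)] by measurable
    have "{\<omega> \<in> space M. U_stat m f n X \<omega> \<ge> a}
        = {\<omega> \<in> space M. (\<lambda>i\<in>{..<n}. X i \<omega>) \<in> {x \<in> space (L.DP n). inj_avg m n f x \<ge> a}}"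
      by (auto simp: U_stat_sample[OF f(2) assms] space_PiM)
    then show ?thesis using measure_sample[OF n1 A] by simp
  qed
  have "symmetric_kernel m (\<lambda>y. - \<Phi> y t)" using \<Phi>_sym[of t] by (simp add: symmetric_kernel_def)
  then show "U_tail M X m \<Phi> a t n = L.avg_tail m (signed (t, True)) n a"
    "U_tail M X m (neg_family \<Phi>) a t n = L.avg_tail m (signed (t, False)) n a"
    using gen[OF \<Phi>_meas \<Phi>_sym, of t] gen[of "\<lambda>y. - \<Phi> y t"] \<Phi>_meas[of t]
    by (auto simp: U_tail_def signed_def neg_family_def)
qed

private lemma sup_event:
  assumes n: "n \<ge> m" and W: "\<And>\<omega>. W \<omega> = (SUP t::real. \<bar>U_stat m (\<lambda>y. \<Phi> y (ereal t)) n X \<omega>\<bar>)"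
  shows "measure M {\<omega> \<in> space M. W \<omega> > a} = measure (L.DP n) (E n a)"
proof -
  have "W \<omega> > a \<longleftrightarrow> (\<lambda>i\<in>{..<n}. X i \<omega>) \<in> E n a" for \<omega>
  proof -
    let ?x = "\<lambda>i\<in>{..<n}. X i \<omega>"
    have "W \<omega> = (SUP t::real. \<bar>inj_avg m n (\<lambda>y. \<Phi> y (ereal t)) ?x\<bar>)"
      unfolding W U_stat_sample[OF \<Phi>_sym n] ..
    moreover have "bdd_above (range (\<lambda>t::real. \<bar>inj_avg m n (\<lambda>y. \<Phi> y (ereal t)) ?x\<bar>))"
      using L.inj_avg_bound[OF \<Phi>_bound] by (intro bdd_aboveI2[where M=1])
    ultimately show ?thesis by (simp add: less_cSUP_iff E_def space_PiM)
  qed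
  then show ?thesis using measure_sample[OF _ E_meas[of n a]] n m1 by simp
qed

lemma sup_U_stat_log_rate:
  assumes nondeg: "nondegenerate M X m \<alpha> \<beta> \<Phi>"
    and W: "\<And>n \<omega>. n \<ge> m \<Longrightarrow> W n \<omega> = (SUP t::real. \<bar>U_stat m (\<lambda>y. \<Phi> y (ereal t)) n X \<omega>\<bar>)"
    and v: "\<And>a. v a = - min (rate_inf M X m \<alpha> \<beta> \<Phi> a) (rate_inf M X m \<alpha> \<beta> (neg_family \<Phi>) a)"
  shows "(\<exists>a\<^sub>0>0.
      (\<forall>a. 0 < a \<and> a < a\<^sub>0 \<longrightarrow>
         (\<forall>t\<in>large_variance_set M X m \<alpha> \<beta> \<Phi>.
            rate_defined M X m \<Phi> a t \<and> rate_defined M X m (neg_family \<Phi>) a t) \<and>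
         has_log_rate (\<lambda>n. measure M {\<omega> \<in> space M. W n \<omega> > a}) (v a)) \<and>
      continuous_on {0<..<a\<^sub>0} v) \<and>
    v \<sim>[at_right 0] (\<lambda>a. - (a\<^sup>2 / (2 * (real m)\<^sup>2 * sup_variance M X m \<alpha> \<beta> \<Phi>)))"
proof -
  define V where "V = sup_variance M X m \<alpha> \<beta> \<Phi>"
  define T where "T = large_variance_set M X m \<alpha> \<beta> \<Phi>"
  let ?I = "{\<alpha>..\<beta>} \<times> (UNIV :: bool set)"
  let ?T = "T \<times> (UNIV :: bool set)"
  have V_eq: "V = (SUP p\<in>?I. L.kvar m (signed p))"
  proof -
    have "(\<lambda>p. L.kvar m (signed p)) ` ?I = variance_fun M X m \<Phi> ` {\<alpha>..\<beta>}"
      using signed_kvar by (force simp: image_iff)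
    then show ?thesis by (simp add: V_def sup_variance_def)
  qed
  have var: "variance_fun M X m \<Phi> t = L.kvar m (\<lambda>y. \<Phi> y t)" if "t \<in> {\<alpha>..\<beta>}" for t
    by (rule variance_fun_eq[of \<Phi> t, OF \<Phi>_adm[OF that]])
  have V0: "V > 0"
  proof -
    \<comment> \<open>Finitely many zeros cannot fill a nonempty open interval, so some variance is
      positive.\<close>
    have "infinite {\<alpha><..<\<beta>}" using ab by (rule infinite_Ioo)
    then have "{\<alpha><..<\<beta>} - {t \<in> {\<alpha><..<\<beta>}. variance_fun M X m \<Phi> t = 0} \<noteq> {}"
      using nondeg unfolding nondegenerate_def by (metis finite.emptyI finite_Diff2)
    then obtain t where "t \<in> {\<alpha><..<\<beta>}" "variance_fun M X m \<Phi> t \<noteq> 0" by blast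
    then have t: "t \<in> {\<alpha>..\<beta>}" "variance_fun M X m \<Phi> t \<noteq> 0" by auto
    have "0 < variance_fun M X m \<Phi> t" using t L.kvar_bounds[OF \<Phi>_adm[OF t(1)]] var[OF t(1)] by simp
    also have "\<dots> \<le> V"
      unfolding V_def sup_variance_def using t(1) var L.kvar_bounds[OF \<Phi>_adm]
      by (intro cSUP_upper) (auto intro!: bdd_aboveI2[where M=1])
    finally show ?thesis .
  qed
  have T_eq: "?T = {p \<in> ?I. V / 2 < L.kvar m (signed p)}"
    using signed_kvar by (auto simp: T_def large_variance_set_def V_def)
  have low: "{x \<in> space (L.DP n). inj_avg m n (signed p) x \<ge> c} \<subseteq> E n a"
    if p: "p \<in> ?T" and a: "0 < a" "a < c" for p a c n
  proof
    fix x assume x: "x \<in> {x \<in> space (L.DP n). inj_avg m n (signed p) x \<ge> c}"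
    have abs: "a < \<bar>inj_avg m n (\<lambda>y. \<Phi> y (fst p)) x\<bar>"
      using x a by (auto simp: signed_def inj_avg_minus split: if_splits)
    \<comment> \<open>The supremum runs over real parameters but \<open>T\<close> may contain
      infinite endpoints; there the kernel is 0 and no deviation above \<open>a > 0\<close>
      occurs.\<close>
    have "fst p \<noteq> \<infinity>" "fst p \<noteq> -\<infinity>"
      using abs a by (auto simp: \<Phi>_eq b_infty inj_avg_def)
    then obtain t where "fst p = ereal t" by (cases "fst p") auto
    with abs x show "x \<in> E n a" by (auto simp: E_def)
  qed
  have ne: "?I \<noteq> {}" using ab by auto
  note R = L.sup_log_rate[of ?I m signed V ?T E, OF signed_adm ne V_eq V0 T_eq E_meas low E_discretize]
  have Tne: "T \<noteq> {}" using R(3) by auto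
  let ?J = "\<lambda>a. INF p\<in>?T. L.rateJ m (signed p) a"
  obtain a0 where a0: "a0 > 0"
    and rates: "\<And>a p. 0 < a \<Longrightarrow> a < a0 \<Longrightarrow> p \<in> ?T \<Longrightarrow>
       has_log_rate (\<lambda>n. L.avg_tail m (signed p) n a) (- L.rateJ m (signed p) a)"
    and sup: "\<And>a. 0 < a \<Longrightarrow> a < a0 \<Longrightarrow> has_log_rate (\<lambda>n. measure (L.DP n) (E n a)) (- ?J a)"
    and cont: "continuous_on {0<..<a0} (\<lambda>a. - ?J a)"
    using R(1) by blast
  have tails: "has_log_rate (U_tail M X m \<Phi> a t) (- L.rateJ m (signed (t, True)) a)"
      "has_log_rate (U_tail M X m (neg_family \<Phi>) a t) (- L.rateJ m (signed (t, False)) a)"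
    if "0 < a" "a < a0" "t \<in> T" for a t
  proof -
    have "\<forall>\<^sub>F n in sequentially. U_tail M X m \<Phi> a t n = L.avg_tail m (signed (t, True)) n a"
      "\<forall>\<^sub>F n in sequentially. U_tail M X m (neg_family \<Phi>) a t n = L.avg_tail m (signed (t, False)) n a"
      by (rule eventually_sequentiallyI[of m], erule U_tail_eq)+
    from this[THEN has_log_rate_cong] show
      "has_log_rate (U_tail M X m \<Phi> a t) (- L.rateJ m (signed (t, True)) a)"
      "has_log_rate (U_tail M X m (neg_family \<Phi>) a t) (- L.rateJ m (signed (t, False)) a)"
      using rates[OF that(1,2), of "(t, True)"] rates[OF that(1,2), of "(t, False)"] that(3) by auto
  qed
  have v_eq: "v a = - ?J a" if a: "0 < a" "a < a0" for a
  proof -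
    have r1: "rate_inf M X m \<alpha> \<beta> \<Phi> a = (INF p\<in>T \<times> {True}. L.rateJ m (signed p) a)"
    proof -
      have "(\<lambda>p. L.rateJ m (signed p) a) ` (T \<times> {True}) = (\<lambda>t. rate M X m \<Phi> a t) ` T"
        using rate_eqI(1)[OF tails(1)[OF a]] by (force simp: image_iff)
      then show ?thesis by (simp add: rate_inf_def T_def)
    qed
    have r2: "rate_inf M X m \<alpha> \<beta> (neg_family \<Phi>) a = (INF p\<in>T \<times> {False}. L.rateJ m (signed p) a)"
    proof -
      have "(\<lambda>p. L.rateJ m (signed p) a) ` (T \<times> {False}) = (\<lambda>t. rate M X m (neg_family \<Phi>) a t) ` T"
        using rate_eqI(1)[OF tails(2)[OF a]] by (force simp: image_iff)
      then show ?thesis by (simp add: rate_inf_def T_def neg_T)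
    qed
    \<comment> \<open>Probabilities are at most 1, so their logarithmic rates cannot be negative.
      The common lower bound is needed to split the infimum over both signs into a minimum of two
      infima.\<close>
    have nonneg: "0 \<le> L.rateJ m (signed p) a" if p: "p \<in> ?T" for p
    proof (rule ccontr)
      assume neg: "\<not> ?thesis"
      let ?q = "\<lambda>n. ln (L.avg_tail m (signed p) n a) / real n"
      have "?q \<longlonglongrightarrow> - L.rateJ m (signed p) a" using rates[OF a p] by (simp add: has_log_rate_def)
      moreover have "\<forall>\<^sub>F n in sequentially. ?q n \<le> 0"
        using rates[OF a p] unfolding has_log_rate_def
        by (auto elim!: eventually_mono intro!: divide_nonpos_nonneg simp: prob_space.prob_le_1[OF L.prob_space_DP])
      ultimately have "- L.rateJ m (signed p) a \<le> 0"
        by (rule tendsto_upperbound) simp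
      with neg show False by simp
    qed
    have bdd: "bdd_below ((\<lambda>p. L.rateJ m (signed p) a) ` A)" if "A \<subseteq> ?T" for A
      using that nonneg by (intro bdd_belowI2[where m=0]) auto
    have "?J a = (INF p\<in>T \<times> {True} \<union> T \<times> {False}. L.rateJ m (signed p) a)"
      by (intro arg_cong[where f=Inf] arg_cong2[where f="(`)"]) (auto simp: UNIV_bool)
    also have "\<dots> = min (INF p\<in>T \<times> {True}. L.rateJ m (signed p) a) (INF p\<in>T \<times> {False}. L.rateJ m (signed p) a)"
      using Tne by (subst cINF_union) (auto intro!: bdd simp: inf_min)
    finally show ?thesis by (simp add: v r1 r2)
  qed
  have ev: "\<forall>\<^sub>F a in at_right 0. v a = - ?J a"
    using eventually_at_right_less[of 0] eventually_at_right_real[OF a0] by eventually_elim (auto intro: v_eq)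
  have asymp: "v \<sim>[at_right 0] (\<lambda>a. - (a\<^sup>2 / (2 * (real m)\<^sup>2 * V)))"
    by (rule asymp_equiv_cong[THEN iffD2, OF ev _ R(2)]) simp
  have "has_log_rate (\<lambda>n. measure M {\<omega> \<in> space M. W n \<omega> > a}) (v a)" if a: "0 < a" "a < a0" for a
  proof -
    have "\<forall>\<^sub>F n in sequentially. measure M {\<omega> \<in> space M. W n \<omega> > a} = measure (L.DP n) (E n a)"
      using eventually_ge_at_top[of m] by eventually_elim (rule sup_event, use W in auto)
    from has_log_rate_cong[OF this] show ?thesis using sup[OF a] v_eq[OF a] by simp
  qed
  moreover have "rate_defined M X m \<Phi> a t \<and> rate_defined M X m (neg_family \<Phi>) a t" if "0 < a" "a < a0" "t \<in> T" for a t
    using rate_eqI(2)[OF tails(1)[OF that]] rate_eqI(2)[OF tails(2)[OF that]] by simp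
  moreover have "continuous_on {0<..<a0} v"
    using cont by (rule continuous_on_cong[THEN iffD1, rotated 2]) (auto simp: v_eq)
  ultimately show ?thesis
    unfolding V_def[symmetric] T_def[symmetric] using a0 asymp by blast
qed

end

end

section \<open>Specialisation to the two statistics\<close>

theorem theorem2p4:
  fixes M :: "'a measure" and X :: "nat \<Rightarrow> 'a \<Rightarrow> real" and F :: "real \<Rightarrow> real"
    and m :: nat and h :: "(nat \<Rightarrow> real) \<Rightarrow> real" and \<alpha> \<beta> :: ereal
  assumes "prob_space M"
    and "prob_space.indep_vars M (\<lambda>_. borel) X UNIV"
    and "\<And>i. cdf (distr M borel (X i)) = F"
    and "continuous_on UNIV F"
    and "m \<ge> 1"
    and "h \<in> borel_measurable (PiM {..<m} (\<lambda>_. borel))"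
    and "symmetric_kernel m h"
    and "\<alpha> < \<beta>"
    and "continuous_on UNIV (\<lambda>t::real. kernel_df M X m h (ereal t))"
    and "kernel_df M X m h \<alpha> = 0"
    and "kernel_df M X m h \<beta> = 1"
    and "strict_mono_on {\<alpha>..\<beta>} (kernel_df M X m h)"
  shows
    "(nondegenerate M X m \<alpha> \<beta> (Theta M X m h) \<longrightarrow>
       (\<exists>a\<^sub>0>0.
          (\<forall>a. 0 < a \<and> a < a\<^sub>0 \<longrightarrow>
             (\<forall>t\<in>large_variance_set M X m \<alpha> \<beta> (Theta M X m h).
                rate_defined M X m (Theta M X m h) a t \<and>
                rate_defined M X m (neg_family (Theta M X m h)) a t) \<and>
             has_log_rate (\<lambda>n. measure M {\<omega> \<in> space M. DU M X m h n \<omega> > a}) (v_D M X m h \<alpha> \<beta> a)) \<and>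
          continuous_on {0<..<a\<^sub>0} (v_D M X m h \<alpha> \<beta>)) \<and>
       v_D M X m h \<alpha> \<beta> \<sim>[at_right 0]
         (\<lambda>a. - (a\<^sup>2 / (2 * (real m)\<^sup>2 * sup_variance M X m \<alpha> \<beta> (Theta M X m h)))))
     \<and>
     (nondegenerate M X m \<alpha> \<beta> (Psi m h) \<and> centred M X m \<alpha> \<beta> (Psi m h) \<longrightarrow>
       (\<exists>a\<^sub>0>0.
          (\<forall>a. 0 < a \<and> a < a\<^sub>0 \<longrightarrow>
             (\<forall>t\<in>large_variance_set M X m \<alpha> \<beta> (Psi m h).
                rate_defined M X m (Psi m h) a t \<and>
                rate_defined M X m (neg_family (Psi m h)) a t) \<and>
             has_log_rate (\<lambda>n. measure M {\<omega> \<in> space M. SU X m h n \<omega> > a}) (v_S M X m h \<alpha> \<beta> a)) \<and>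
          continuous_on {0<..<a\<^sub>0} (v_S M X m h \<alpha> \<beta>)) \<and>
       v_S M X m h \<alpha> \<beta> \<sim>[at_right 0]
         (\<lambda>a. - (a\<^sup>2 / (2 * (real m)\<^sup>2 * sup_variance M X m \<alpha> \<beta> (Psi m h)))))"
proof -
  interpret prob_space M by fact
  have X_meas: "X i \<in> borel_measurable M" for i
    using assms(2) by (simp add: indep_vars_def2)
  have ident: "distr M borel (X i) = distr M borel (X 0)" for i
    using assms(3)[of i] assms(3)[of 0] X_meas by (intro cdf_unique real_distribution_distr) auto
  interpret kernel_sample M X m h \<alpha> \<beta>
    by unfold_locales (use assms ident in auto)
  have h_lt_sym: "symmetric_kernel m (\<lambda>y. of_bool (ereal (h y) < t))" for t
    using h_sym by (simp add: symmetric_kernel_def)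
  have emp: "U_emp_df m h n X \<omega> t = inj_avg m n (\<lambda>y. of_bool (ereal (h y) < ereal t)) (\<lambda>i\<in>{..<n}. X i \<omega>)"
    if "n \<ge> m" for n \<omega> t
    using U_stat_sample[OF h_lt_sym[of "ereal t"] that] by (simp add: U_emp_df_def)
  {
    let ?b = "\<lambda>(_ :: nat \<Rightarrow> real) t. G t"
    assume nondeg: "nondegenerate M X m \<alpha> \<beta> (Theta M X m h)"
    have DU: "DU M X m h n \<omega> = (SUP t::real. \<bar>U_stat m (\<lambda>y. Theta M X m h y (ereal t)) n X \<omega>\<bar>)"
      if n: "n \<ge> m" for n \<omega>
    proof -
      have "U_stat m (\<lambda>y. Theta M X m h y (ereal t)) n X \<omega> = U_emp_df m h n X \<omega> t - G (ereal t)" for t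
      proof -
        have "symmetric_kernel m (\<lambda>y. Theta M X m h y (ereal t))"
          using h_sym by (simp add: symmetric_kernel_def Theta_def)
        moreover have "inj_avg m n (\<lambda>_. G (ereal t)) x = G (ereal t)" for x :: "nat \<Rightarrow> real"
          using inj_tuples_nonempty[OF n] by (simp add: inj_avg_def)
        ultimately show ?thesis
          by (simp only: U_stat_sample[OF _ n] Theta_def inj_avg_diff emp[OF n])
      qed
      then show ?thesis by (simp add: DU_def)
    qed
    have G_left: "((\<lambda>t. G (ereal t)) \<longlongrightarrow> G (ereal t)) (at_left t)" for t
      using G_cont by (auto simp: continuous_on_def intro: tendsto_within_subset)
    have Theta_eq: "Theta M X m h = (\<lambda>y t. of_bool (ereal (h y) < t) - ?b y t)"
      by (simp add: Theta_def fun_eq_iff)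
    have G_int: "(\<integral>y. G t \<partial>L.DP m) = G t" for t
      using prob_space.prob_space[OF L.prob_space_DP] by simp
    note sup_U_stat_log_rate[of ?b "Theta M X m h" "DU M X m h" "v_D M X m h \<alpha> \<beta>",
        OF _ _ G_bounds G_mono G_infty G_left G_int Theta_eq nondeg DU v_D_def]
  }
  note D = this
  {
    let ?b = "\<lambda>y t. (\<Sum>i<m. of_bool (ereal (y i) < t)) / real m"
    assume "nondegenerate M X m \<alpha> \<beta> (Psi m h) \<and> centred M X m \<alpha> \<beta> (Psi m h)"
    then have nondeg: "nondegenerate M X m \<alpha> \<beta> (Psi m h)" and cent: "centred M X m \<alpha> \<beta> (Psi m h)" by auto
    have b_sym: "symmetric_kernel m (\<lambda>y. ?b y t)" for t
      unfolding symmetric_kernel_def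
    proof (intro allI impI)
      fix \<pi> and x :: "nat \<Rightarrow> real" assume "\<pi> permutes {..<m} \<and> x \<in> {..<m} \<rightarrow>\<^sub>E UNIV"
      then have "\<pi> permutes {..<m}" by blast
      from sum.permute[OF this, of "\<lambda>i. of_bool (ereal (x i) < t) :: real"]
      show "?b (x \<circ> \<pi>) t = ?b x t" by (simp add: o_def)
    qed
    have b_meas: "(\<lambda>y. ?b y t) \<in> borel_measurable (L.DP m)" for t
    proof -
      have "(\<lambda>y. of_bool (ereal (y i) < t) :: real) \<in> borel_measurable (L.DP m)" if "i < m" for i
      proof -
        have "(\<lambda>z. of_bool (ereal z < t) :: real) \<in> borel_measurable law" by measurable
        then show ?thesis
          using that by (intro measurable_compose[OF measurable_component_singleton[of i "{..<m}" "\<lambda>_. law"]]) auto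
      qed
      then show ?thesis by (intro borel_measurable_divide borel_measurable_sum) auto
    qed
    have b_nonneg: "0 \<le> ?b y t" for y t by (intro divide_nonneg_nonneg sum_nonneg) auto
    have b_le1: "?b y t \<le> 1" for y t
    proof -
      have "(\<Sum>i<m. of_bool (ereal (y i) < t)) \<le> (\<Sum>i<m. 1 :: real)" by (intro sum_mono) auto
      then show ?thesis using m1 by (simp add: divide_le_eq)
    qed
    have b_mono: "?b y s \<le> ?b y t" if "s \<le> t" for y s t
      using that by (intro divide_right_mono sum_mono) (auto simp: of_bool_def intro: less_le_trans)
    have b_infty: "?b y \<infinity> = 1" "?b y (-\<infinity>) = 0" for y
      using m1 by auto
    have b_left: "((\<lambda>t. ?b y (ereal t)) \<longlongrightarrow> ?b y (ereal t)) (at_left t)" for y t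
      using m1 by (intro tendsto_divide tendsto_sum tendsto_const indicator_left_limit) auto
    have Psi_sym: "symmetric_kernel m (\<lambda>y. Psi m h y t)" for t
      using h_sym b_sym[of t] by (simp add: symmetric_kernel_def Psi_def)
    have h_lt_meas: "(\<lambda>y. of_bool (ereal (h y) < t) :: real) \<in> borel_measurable (L.DP m)" for t
      by measurable
    \<comment> \<open>Centring of \<open>Psi\<close> says exactly that the mean of the subtracted
      process is \<open>G t\<close>.\<close>
    have b_int: "(\<integral>y. ?b y t \<partial>L.DP m) = G t" if t: "t \<in> {\<alpha>..\<beta>}" for t
    proof -
      interpret S: prob_space "L.DP m" by (rule L.prob_space_DP)
      have "(\<integral>y. Psi m h y t \<partial>L.DP m) = (\<integral>\<omega>. Psi m h (tuple m X \<omega>) t \<partial>M)"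
        unfolding Psi_def by (intro integral_tuple[symmetric] borel_measurable_diff b_meas h_lt_meas)
      also have "\<dots> = 0" using cent t by (simp add: centred_def)
      finally have "(\<integral>y. of_bool (ereal (h y) < t) - ?b y t \<partial>L.DP m) = 0" by (simp add: Psi_def)
      moreover have "integrable (L.DP m) (\<lambda>y. of_bool (ereal (h y) < t) :: real)"
        by (rule S.integrable_bounded[OF h_lt_meas, where B=1]) auto
      moreover have "integrable (L.DP m) (\<lambda>y. ?b y t)"
        by (rule S.integrable_bounded[OF b_meas, where B=1]) (use b_nonneg b_le1 in \<open>simp only: abs_of_nonneg\<close>)
      ultimately show ?thesis by (simp only: Bochner_Integration.integral_diff G_integral)
    qed
    have SU: "SU X m h n \<omega> = (SUP t::real. \<bar>U_stat m (\<lambda>y. Psi m h y (ereal t)) n X \<omega>\<bar>)"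
      if n: "n \<ge> m" for n \<omega>
    proof -
      have "U_stat m (\<lambda>y. Psi m h y (ereal t)) n X \<omega> = U_emp_df m h n X \<omega> t - emp_df n X \<omega> t" for t
      proof -
        have "inj_avg m n (\<lambda>y. ?b y (ereal t)) (\<lambda>i\<in>{..<n}. X i \<omega>) = emp_df n X \<omega> t"
          using L.inj_avg_coordinate_mean[OF m1 n, of "\<lambda>z. of_bool (ereal z < ereal t)" "\<lambda>i\<in>{..<n}. X i \<omega>"]
          by (simp add: emp_df_def)
        then show ?thesis
          using U_stat_sample[OF Psi_sym[of "ereal t"] n] by (simp only: Psi_def inj_avg_diff emp[OF n])
      qed
      then show ?thesis by (simp add: SU_def)
    qed
    have Psi_eq: "Psi m h = (\<lambda>y t. of_bool (ereal (h y) < t) - ?b y t)"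
      by (simp add: Psi_def fun_eq_iff)
    note sup_U_stat_log_rate[of ?b "Psi m h" "SU X m h" "v_S M X m h \<alpha> \<beta>",
        OF b_meas b_sym b_nonneg b_le1 b_mono b_infty b_left b_int Psi_eq nondeg SU v_S_def]
  }
  note S = this
  show ?thesis
    using D S by (simp add: symmetric_kernel_def)
qed

end
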